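(* Consider the finite-horizon LQR problem with linear policies described in the context, under the assumptions stated there. The policy gradient objective function $l$ satisfies the PŁK condition on $\Theta$: $$l(\theta)-l(\theta^* )\le\frac1{2\mu_l}\min_{g=(g_0,\dots,g_{T-1})\in N_\Theta(\theta)}\sum_{t=0}^{T-1}\|\nabla_{\theta_t}l(\theta)+g_t\|_F^2\qquad\forall\theta\in\Theta,$$ for a constant $\mu_l>0$. In addition, the reciprocal of the PŁK constant $\mu_l$ is polynomial in the model parameters $(m,n,T,\bar\sigma_Q,\bar\sigma_R,\underline\sigma_R^{-1},\bar\sigma_\Theta,\bar\sigma_X,\underline\sigma_X^{-1},\bar\sigma_W,\|B\|_2)$.
   Context: LQR: states $s_t\in\mathbb R^m$, actions $a_t\in\mathbb R^n$, dynamics $s_{t+1}=As_t+Ba_t+w_t$ for $t=0,\dots,T-1$, $s_0\sim\rho$, where $\{w_t\}_{t=0}^{T-1}$ are i.i.d. with zero mean and independent of $s_0$. Linear policies $a_t=\theta_ts_t$, $\theta_t\in\mathbb R^{n\times m}$, and $$l(\theta)=\mathbb E\Big[\sum_{t=0}^{T-1}\big(s_t^\top Q_ts_t+(\theta_ts_t)^\top R_t(\theta_ts_t)\big)+s_T^\top Q_Ts_T\,\Big|\,s_0\sim\rho\Big].$$ Assumptions: $Q_t\in\mathbb R^{m\times m}$ and $R_t\in\mathbb R^{n\times n}$ are positive definite for $t=0,\dots,T-1$; the second moments of $s_0$ and of $w_t$ are finite, and $\mathbb E[s_0s_0^\top]$ and $\mathbb E[w_tw_t^\top]$ are positive definite for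 $t=0,\dots,T-1$. $\Theta=\Theta_0\times\dots\times\Theta_{T-1}$ is a convex and compact set such that $\|A+B\theta_t\|_2\le1$ (spectral norm) for all $\theta_t\in\Theta_t$ and $0\le t\le T-1$. The class of linear policies with $\theta\in\Theta$ is assumed to contain an optimal policy; $\theta^*$ is a minimizer of $l$ over $\Theta$. Constants: $\underline\sigma_R=\min_{0\le t\le T-1}\sigma_{\min}(R_t)>0$; $\underline\sigma_X>0$ is the minimum over $t=0,\dots,T$ of the smallest eigenvalue of $\mathbb E[s_ts_t^\top]$, with $s_t$ generated by the policy with parameter $\theta$ (taken over all $\theta\in\Theta$); $\bar\sigma_\Theta=\max_t\max_{\theta_t\in\Theta_t}\|\theta_t\|_2$; $\bar\sigma_Q,\bar\sigma_R,\bar\sigma_X,\bar\sigma_W$ are upper bounds on the eigenvalues of $Q_t$, $R_t$, $\mathbb E[s_0s_0^\top]$, $\mathbb E[w_tw_t^\top]$ respectively for all $t=0,\dots,T-1$, and in addition the spectral radius of $Q_T$ is assumed to be at most $\bar\sigma_Q$. $N_\Theta(\theta)=\{g:\langle g,\theta'-\theta\rangle\le0\ \forall\theta'\in\Theta\}$ is the normal cone, with the Frobenius inner product; $\|\cdot\|_F$ is the Frobenius norm.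
   Formalization: The terminal cost matrix Q_T is assumed symmetric positive semidefinite; with only its spectral radius bounded the polynomial claim fails, e.g. m=n=T=1, A=0, B=R=Q_0=1, Q_T=-(1-ε), Θ=[-1,1], ε→0. *)

theory Defs
  imports
    "HOL-Probability.Probability"
    "Jordan_Normal_Form.Spectral_Radius"
begin

text \<open>
  The dimensions are values (not types), because the constant in the theorem is a single
  polynomial in which the dimensions occur as arguments. Matrices and vectors are therefore the
  carrier-based ones. Random vectors are distributed according to measures on the product space
  \<^term>\<open>Pi\<^sub>M {..<d} (\<lambda>_. borel :: real measure)\<close>; the function \<^term>\<open>vec d\<close> turns a
  point of that space into a vector.
\<close>

subsection \<open>Matrices\<close>

definition vnorm :: "real vec \<Rightarrow> real" where
  "vnorm v = sqrt (scalar_prod v v)"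

definition spectral_norm :: "real mat \<Rightarrow> real" where
  "spectral_norm M = (SUP v\<in>{v \<in> carrier_vec (dim_col M). vnorm v \<le> 1}. vnorm (M *\<^sub>v v))"

definition frob_inner :: "real mat \<Rightarrow> real mat \<Rightarrow> real" where
  "frob_inner M N = (\<Sum>i<dim_row M. \<Sum>j<dim_col M. M $$ (i, j) * N $$ (i, j))"

definition frob_norm :: "real mat \<Rightarrow> real" where
  "frob_norm M = sqrt (frob_inner M M)"

definition pos_def :: "nat \<Rightarrow> real mat \<Rightarrow> bool" where
  "pos_def d M \<longleftrightarrow> M \<in> carrier_mat d d \<and> transpose_mat M = M \<and>
     (\<forall>v\<in>carrier_vec d. v \<noteq> 0\<^sub>v d \<longrightarrow> scalar_prod v (M *\<^sub>v v) > 0)"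

definition pos_semidef :: "nat \<Rightarrow> real mat \<Rightarrow> bool" where
  "pos_semidef d M \<longleftrightarrow> M \<in> carrier_mat d d \<and> transpose_mat M = M \<and>
     (\<forall>v\<in>carrier_vec d. scalar_prod v (M *\<^sub>v v) \<ge> 0)"

definition min_eigenvalue :: "real mat \<Rightarrow> real" where
  "min_eigenvalue M = Min (spectrum M)"

definition min_singular_value :: "real mat \<Rightarrow> real" where
  "min_singular_value M = sqrt (min_eigenvalue (transpose_mat M * M))"

subsection \<open>Problem data\<close>

record lqr_data =
  dimS :: nat
  dimA :: nat
  horizon :: nat
  matA :: "real mat"
  matB :: "real mat"
  costQ :: "nat \<Rightarrow> real mat"
  costR :: "nat \<Rightarrow> real mat"
  init_law :: "(nat \<Rightarrow> real) measure"
  noise_law :: "(nat \<Rightarrow> real) measure"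
  param_sets :: "nat \<Rightarrow> real mat set"

definition Theta :: "lqr_data \<Rightarrow> (nat \<Rightarrow> real mat) set" where
  "Theta L = Pi\<^sub>E {..<horizon L} (param_sets L)"

text \<open>
  A sample point is a pair of the initial state and the noise sequence. On this product space the
  noise vectors are i.i.d. and independent of the initial state, and the expected costs depend on
  the joint law of the initial state and the noise only.
\<close>

definition sample_space :: "lqr_data \<Rightarrow> ((nat \<Rightarrow> real) \<times> (nat \<Rightarrow> nat \<Rightarrow> real)) measure" where
  "sample_space L = init_law L \<Otimes>\<^sub>M Pi\<^sub>M {..<horizon L} (\<lambda>_. noise_law L)"

definition state0 :: "lqr_data \<Rightarrow> (nat \<Rightarrow> real) \<times> (nat \<Rightarrow> nat \<Rightarrow> real) \<Rightarrow> real vec" where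
  "state0 L \<omega> = vec (dimS L) (fst \<omega>)"

definition noise :: "lqr_data \<Rightarrow> (nat \<Rightarrow> real) \<times> (nat \<Rightarrow> nat \<Rightarrow> real) \<Rightarrow> nat \<Rightarrow> real vec" where
  "noise L \<omega> t = vec (dimS L) (snd \<omega> t)"

type_synonym policy = "nat \<Rightarrow> real vec \<Rightarrow> real vec"

primrec state ::
  "lqr_data \<Rightarrow> policy \<Rightarrow> (nat \<Rightarrow> real) \<times> (nat \<Rightarrow> nat \<Rightarrow> real) \<Rightarrow> nat \<Rightarrow> real vec" where
  "state L \<pi> \<omega> 0 = state0 L \<omega>"
| "state L \<pi> \<omega> (Suc t) =
     matA L *\<^sub>v state L \<pi> \<omega> t + matB L *\<^sub>v \<pi> t (state L \<pi> \<omega> t) + noise L \<omega> t"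

definition total_cost ::
  "lqr_data \<Rightarrow> policy \<Rightarrow> (nat \<Rightarrow> real) \<times> (nat \<Rightarrow> nat \<Rightarrow> real) \<Rightarrow> real" where
  "total_cost L \<pi> \<omega> =
     (\<Sum>t<horizon L.
        (let s = state L \<pi> \<omega> t; a = \<pi> t s
         in scalar_prod s (costQ L t *\<^sub>v s) + scalar_prod a (costR L t *\<^sub>v a)))
     + (let s = state L \<pi> \<omega> (horizon L) in scalar_prod s (costQ L (horizon L) *\<^sub>v s))"

definition lin_policy :: "(nat \<Rightarrow> real mat) \<Rightarrow> policy" where
  "lin_policy \<theta> t s = \<theta> t *\<^sub>v s"

definition objective :: "lqr_data \<Rightarrow> (nat \<Rightarrow> real mat) \<Rightarrow> real" where
  "objective L \<theta> = (\<integral>\<omega>. total_cost L (lin_policy \<theta>) \<omega> \<partial>sample_space L)"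

text \<open>
  Optimality is among all measurable, deterministic, time-dependent state-feedback policies. Such a
  policy may have infinite expected cost, hence the nonnegative integral (the costs are
  nonnegative).
\<close>

definition admissible_policy :: "lqr_data \<Rightarrow> policy \<Rightarrow> bool" where
  "admissible_policy L \<pi> \<longleftrightarrow>
     (\<forall>t<horizon L.
        (\<forall>s\<in>carrier_vec (dimS L). \<pi> t s \<in> carrier_vec (dimA L)) \<and>
        (\<forall>i<dimA L. (\<lambda>x. vec_index (\<pi> t (vec (dimS L) x)) i)
           \<in> borel_measurable (Pi\<^sub>M {..<dimS L} (\<lambda>_. borel))))"

definition optimal_policy :: "lqr_data \<Rightarrow> policy \<Rightarrow> bool" where
  "optimal_policy L \<pi> \<longleftrightarrow> admissible_policy L \<pi> \<and>
     (\<forall>\<pi>'. admissible_policy L \<pi>' \<longrightarrow>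
        (\<integral>\<^sup>+\<omega>. ennreal (total_cost L \<pi> \<omega>) \<partial>sample_space L)
        \<le> (\<integral>\<^sup>+\<omega>. ennreal (total_cost L \<pi>' \<omega>) \<partial>sample_space L))"

subsection \<open>Assumptions\<close>

definition random_vector_law :: "nat \<Rightarrow> (nat \<Rightarrow> real) measure \<Rightarrow> bool" where
  "random_vector_law d N \<longleftrightarrow> prob_space N \<and> sets N = sets (Pi\<^sub>M {..<d} (\<lambda>_. borel)) \<and>
     (\<forall>i<d. integrable N (\<lambda>x. (x i)\<^sup>2))"

definition second_moment :: "nat \<Rightarrow> 'w measure \<Rightarrow> ('w \<Rightarrow> real vec) \<Rightarrow> real mat" where
  "second_moment d N X = mat d d (\<lambda>(i, j). \<integral>\<omega>. vec_index (X \<omega>) i * vec_index (X \<omega>) j \<partial>N)"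

definition convex_params :: "nat \<Rightarrow> (nat \<Rightarrow> real mat) set \<Rightarrow> bool" where
  "convex_params T S \<longleftrightarrow>
     (\<forall>\<theta>\<in>S. \<forall>\<theta>'\<in>S. \<forall>u\<in>{0..1}. (\<lambda>t\<in>{..<T}. (1 - u) \<cdot>\<^sub>m \<theta> t + u \<cdot>\<^sub>m \<theta>' t) \<in> S)"

text \<open>
  Compactness is that of the set of coordinate families, in the product topology on
  \<^typ>\<open>nat \<times> nat \<times> nat \<Rightarrow> real\<close>. All but finitely many coordinates are fixed by the restriction,
  so that this is the Euclidean topology on the matrix entries.
\<close>

definition compact_params :: "nat \<Rightarrow> nat \<Rightarrow> nat \<Rightarrow> (nat \<Rightarrow> real mat) set \<Rightarrow> bool" where
  "compact_params n m T S \<longleftrightarrow>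
     compact ((\<lambda>\<theta>. \<lambda>(t, i, j)\<in>{..<T} \<times> {..<n} \<times> {..<m}. \<theta> t $$ (i, j)) ` S)"

definition lqr :: "lqr_data \<Rightarrow> bool" where
  "lqr L \<longleftrightarrow>
     dimS L \<ge> 1 \<and> dimA L \<ge> 1 \<and> horizon L \<ge> 1 \<and>
     matA L \<in> carrier_mat (dimS L) (dimS L) \<and>
     matB L \<in> carrier_mat (dimS L) (dimA L) \<and>
     (\<forall>t<horizon L. pos_def (dimS L) (costQ L t) \<and> pos_def (dimA L) (costR L t)) \<and>
     pos_semidef (dimS L) (costQ L (horizon L)) \<and>
     random_vector_law (dimS L) (init_law L) \<and>
     random_vector_law (dimS L) (noise_law L) \<and>
     (\<forall>i<dimS L. (\<integral>x. x i \<partial>noise_law L) = 0) \<and>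
     pos_def (dimS L) (second_moment (dimS L) (init_law L) (vec (dimS L))) \<and>
     pos_def (dimS L) (second_moment (dimS L) (noise_law L) (vec (dimS L))) \<and>
     (\<forall>t<horizon L. param_sets L t \<subseteq> carrier_mat (dimA L) (dimS L)) \<and>
     convex_params (horizon L) (Theta L) \<and>
     compact_params (dimA L) (dimS L) (horizon L) (Theta L) \<and>
     (\<forall>t<horizon L. \<forall>M\<in>param_sets L t. spectral_norm (matA L + matB L * M) \<le> 1) \<and>
     (\<exists>\<theta>\<in>Theta L. optimal_policy L (lin_policy \<theta>))"

subsection \<open>Constants\<close>

definition sigmaR_min :: "lqr_data \<Rightarrow> real" where
  "sigmaR_min L = (MIN t\<in>{..<horizon L}. min_singular_value (costR L t))"

definition sigmaX_min :: "lqr_data \<Rightarrow> real" where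
  "sigmaX_min L =
     (INF (\<theta>, t)\<in>Theta L \<times> {..horizon L}.
        min_eigenvalue
          (second_moment (dimS L) (sample_space L) (\<lambda>\<omega>. state L (lin_policy \<theta>) \<omega> t)))"

definition sigmaTheta_max :: "lqr_data \<Rightarrow> real" where
  "sigmaTheta_max L = (SUP M\<in>(\<Union>t<horizon L. param_sets L t). spectral_norm M)"

definition upper_bounds :: "lqr_data \<Rightarrow> real \<Rightarrow> real \<Rightarrow> real \<Rightarrow> real \<Rightarrow> bool" where
  "upper_bounds L sQ sR sX sW \<longleftrightarrow>
     (\<forall>t<horizon L. \<forall>k\<in>spectrum (costQ L t). k \<le> sQ) \<and>
     spectral_radius (map_mat complex_of_real (costQ L (horizon L))) \<le> sQ \<and>
     (\<forall>t<horizon L. \<forall>k\<in>spectrum (costR L t). k \<le> sR) \<and>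
     (\<forall>k\<in>spectrum (second_moment (dimS L) (init_law L) (vec (dimS L))). k \<le> sX) \<and>
     (\<forall>k\<in>spectrum (second_moment (dimS L) (noise_law L) (vec (dimS L))). k \<le> sW)"

subsection \<open>Gradient and normal cone\<close>

definition grad :: "lqr_data \<Rightarrow> (nat \<Rightarrow> real mat) \<Rightarrow> nat \<Rightarrow> real mat" where
  "grad L \<theta> t = mat (dimA L) (dimS L) (\<lambda>(i, j).
     deriv (\<lambda>x. objective L
       (\<theta>(t := \<theta> t + mat (dimA L) (dimS L) (\<lambda>p. if p = (i, j) then x else 0)))) 0)"

definition normal_cone :: "lqr_data \<Rightarrow> (nat \<Rightarrow> real mat) \<Rightarrow> (nat \<Rightarrow> real mat) set" where
  "normal_cone L \<theta> =
     {g \<in> Pi\<^sub>E {..<horizon L} (\<lambda>_. carrier_mat (dimA L) (dimS L)).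
        \<forall>\<theta>'\<in>Theta L. (\<Sum>t<horizon L. frob_inner (g t) (\<theta>' t - \<theta> t)) \<le> 0}"

definition residual :: "lqr_data \<Rightarrow> (nat \<Rightarrow> real mat) \<Rightarrow> (nat \<Rightarrow> real mat) \<Rightarrow> real" where
  "residual L \<theta> g = (\<Sum>t<horizon L. (frob_norm (grad L \<theta> t + g t))\<^sup>2)"

text \<open>
  The minimum over the normal cone is rendered as the value of the residual at a minimizer, so
  that it is part of the condition that the minimum is attained.
\<close>

definition PLK_condition :: "lqr_data \<Rightarrow> real \<Rightarrow> bool" where
  "PLK_condition L \<mu> \<longleftrightarrow>
     (\<forall>\<theta>s. is_arg_min (objective L) (\<lambda>\<theta>. \<theta> \<in> Theta L) \<theta>s \<longrightarrow>
       (\<forall>\<theta>\<in>Theta L. \<exists>g. is_arg_min (residual L \<theta>) (\<lambda>g. g \<in> normal_cone L \<theta>) g \<and>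
          objective L \<theta> - objective L \<theta>s \<le> 1 / (2 * \<mu>) * residual L \<theta> g))"

end

theory Submission
  imports Defs
begin

text \<open>
  Since some \<open>\<theta>\<^sup>o \<in> \<Theta>\<close> is optimal among all policies, in particular among all linear ones, its
  gradient vanishes, and so \<open>R\<^sub>t \<theta>\<^sup>o\<^sub>t + B\<^sup>T P\<^sup>o\<^sub>t\<^sub>+\<^sub>1 (A + B \<theta>\<^sup>o\<^sub>t) = 0\<close> with the value matrices \<open>P\<^sup>o\<close> of \<open>\<theta>\<^sup>o\<close>.
  The performance difference formula then reads \<open>l(\<theta>) - l(\<theta>\<^sup>o) = \<Sum>\<^sub>t \<delta>\<^sub>t\<close> with
  \<open>\<delta>\<^sub>t = E[d\<^sup>T (R\<^sub>t + B\<^sup>T P\<^sup>o\<^sub>t\<^sub>+\<^sub>1 B) d]\<close> and \<open>d = (\<theta>\<^sub>t - \<theta>\<^sup>o\<^sub>t) s\<^sub>t\<close>, the states being those of \<open>\<theta>\<close>.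
  With \<open>D = P - P\<^sup>o\<close> one has \<open>\<langle>\<nabla>\<^sub>t l(\<theta>), \<theta>\<^sub>t - \<theta>\<^sup>o\<^sub>t\<rangle> = 2 \<delta>\<^sub>t + 2 E[(B d)\<^sup>T D\<^sub>t\<^sub>+\<^sub>1 s']\<close>, where \<open>s'\<close> is the
  noiseless successor state. The cross term is of second order: \<open>D\<^sub>t\<^sub>+\<^sub>1\<close> is positive semidefinite
  and \<open>E[s'\<^sup>T D\<^sub>t\<^sub>+\<^sub>1 s']\<close> is at most \<open>G\<^sub>t\<^sub>+\<^sub>1 = \<Sum>\<^sub>k\<^sub>>\<^sub>t \<delta>\<^sub>k\<close>, so Cauchy--Schwarz bounds the term by a multiple of
  \<open>G\<^sub>t\<^sub>+\<^sub>1 \<surd>\<delta>\<^sub>t\<close>. Hence \<open>G\<^sub>t \<le> G\<^sub>t\<^sub>+\<^sub>1 + a r\<^sub>t\<^sup>2 + c G\<^sub>t\<^sub>+\<^sub>1\<^sup>2\<close> with \<open>r\<^sub>t\<close> the norm of the residual at stage \<open>t\<close>.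
  If \<open>\<Sum> r\<^sub>t\<^sup>2 \<le> 1 / (4 a c T)\<close>, this recursion yields \<open>G\<^sub>0 \<le> 2 a \<Sum> r\<^sub>t\<^sup>2\<close>, without a factor exponential
  in \<open>T\<close>; otherwise a polynomial bound on \<open>l\<close> is already a polynomial multiple of \<open>\<Sum> r\<^sub>t\<^sup>2\<close>.
\<close>

unbundle no inner_syntax
no_notation Finite_Cartesian_Product.vec_nth (infixl "$" 90)

subsection \<open>Symmetric matrices and compactness\<close>

text \<open>A quadratic polynomial without negative values has nonpositive discriminant. This serves
  every Cauchy-Schwarz inequality for quadratic forms below and, with \<open>a = 0\<close>, every
  first-order condition: the linear coefficient must then vanish.\<close>

lemma discriminant_le:
  fixes a b c :: real
  assumes "\<And>k. a + 2 * b * k + c * k\<^sup>2 \<ge> 0"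
  shows "b\<^sup>2 \<le> a * c"
proof (cases "c = 0")
  case True
  have "b = 0"
  proof (rule ccontr)
    assume "b \<noteq> 0"
    then show False using assms[of "- (a + 1) / (2 * b)"] True by simp
  qed
  then show ?thesis using True by simp
next
  case False
  have "c \<ge> 0"
  proof (rule ccontr)
    assume c: "\<not> c \<ge> 0"
    define e where "e = \<bar>a\<bar> + 2 * \<bar>b\<bar> + 1"
    \<comment> \<open>For this \<open>k\<close> one has \<open>k \<ge> 1\<close>, and
      \<open>- c * k\<close> exceeds \<open>\<bar>a\<bar> + 2 * \<bar>b\<bar> + 1\<close>, so that
      \<open>c * k\<^sup>2\<close> outweighs the two other terms.\<close>
    define k where "k = e / (- c) + 1"
    have "e > 0" by (simp add: e_def)
    then have k1: "k \<ge> 1" using c by (simp add: k_def divide_le_0_iff)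
    have "c * k = - e + c" using c by (simp add: k_def field_simps)
    then have "c * k = - (\<bar>a\<bar> + 2 * \<bar>b\<bar> + 1) + c" by (simp add: e_def)
    then have "c * k\<^sup>2 = (- (\<bar>a\<bar> + 2 * \<bar>b\<bar> + 1) + c) * k"
      unfolding power2_eq_square by (simp flip: mult.assoc)
    then have "c * k\<^sup>2 = - (\<bar>a\<bar> * k) - 2 * (\<bar>b\<bar> * k) - k + c * k" by (simp add: algebra_simps)
    moreover have "b * k \<le> \<bar>b\<bar> * k" using k1 by (simp add: mult_right_mono)
    moreover have "a \<le> \<bar>a\<bar> * k" using k1 mult_left_mono[of 1 k "\<bar>a\<bar>"] by auto
    moreover have "c * k < 0" using c k1 by (simp add: mult_neg_pos)
    ultimately have "a + 2 * b * k + c * k\<^sup>2 < 0" using k1 by linarith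
    with assms[of k] show False by simp
  qed
  with False have c: "c > 0" by simp
  have "0 \<le> (a + 2 * b * (- b / c) + c * (- b / c)\<^sup>2) * c"
    using assms[of "- b / c"] c by (intro mult_nonneg_nonneg) auto
  also have "\<dots> = a * c - b\<^sup>2" using c by (simp add: power2_eq_square field_simps)
  finally show ?thesis by simp
qed

text \<open>Coordinates outside \<open>I\<close> are pinned to \<open>undefined\<close>, so the box
  is a product of compact sets over the whole index type and Tychonoff's theorem applies.\<close>

lemma compact_box:
  fixes K :: real
  shows "compact (Pi\<^sub>E I (\<lambda>_. {-K..K}) :: ('i \<Rightarrow> real) set)"
proof -
  define S where "S i = (if i \<in> I then {-K..K} else {undefined})" for i
  have "(Pi\<^sub>E I (\<lambda>_. {-K..K}) :: ('i \<Rightarrow> real) set) = Pi\<^sub>E UNIV S"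
    by (auto simp: S_def PiE_iff extensional_def split: if_splits)
  moreover have "compactin (product_topology (\<lambda>_. euclidean) UNIV) (Pi\<^sub>E UNIV S)"
    unfolding compactin_PiE by (auto simp: S_def)
  ultimately show ?thesis
    by (simp add: euclidean_product_topology flip: compactin_euclidean_iff)
qed

lemma continuous_on_coordinate [continuous_intros]: "continuous_on S (\<lambda>f. f i :: real)"
  by (rule continuous_on_subset[OF continuous_on_product_coordinates]) simp

lemma scalar_prod_lessThan:
  "v \<in> carrier_vec d \<Longrightarrow> u \<bullet> v = (\<Sum>i<d. u $ i * v $ i)"
  by (simp add: scalar_prod_def lessThan_atLeast0)

lemma mult_mat_vec_index_lessThan:
  "M \<in> carrier_mat n m \<Longrightarrow> v \<in> carrier_vec m \<Longrightarrow> i < n \<Longrightarrow> (M *\<^sub>v v) $ i = (\<Sum>j<m. M $$ (i, j) * v $ j)"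
  by (simp add: scalar_prod_def lessThan_atLeast0)

lemma sprod_self_nonneg: "(v :: real vec) \<bullet> v \<ge> 0"
  by (simp add: scalar_prod_def sum_nonneg)

lemma sprod_self_eq_0_iff: "(v :: real vec) \<in> carrier_vec d \<Longrightarrow> v \<bullet> v = 0 \<longleftrightarrow> v = 0\<^sub>v d"
  by (auto simp: scalar_prod_lessThan sum_nonneg_eq_0_iff intro!: eq_vecI)

lemma vnorm_square: "(vnorm v)\<^sup>2 = v \<bullet> v"
  by (simp add: vnorm_def sprod_self_nonneg)

lemma vnorm_nonneg: "vnorm v \<ge> 0"
  by (simp add: vnorm_def sprod_self_nonneg)

lemma sym_sprod:
  assumes "M \<in> carrier_mat d d" "transpose_mat M = M" "x \<in> carrier_vec d" "y \<in> carrier_vec d"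
  shows "x \<bullet> (M *\<^sub>v y) = y \<bullet> (M *\<^sub>v (x :: real vec))"
  using transpose_vec_mult_scalar[of M d d y x] assms comm_scalar_prod[of y d "M *\<^sub>v x"] by simp

lemma quad_add:
  assumes M: "M \<in> carrier_mat d d" "transpose_mat M = M" "x \<in> carrier_vec d" "y \<in> carrier_vec d"
  shows "(x + y) \<bullet> (M *\<^sub>v (x + y)) = x \<bullet> (M *\<^sub>v x) + 2 * (y \<bullet> (M *\<^sub>v x)) + y \<bullet> (M *\<^sub>v (y :: real vec))"
proof -
  have "M *\<^sub>v x \<in> carrier_vec d" "M *\<^sub>v y \<in> carrier_vec d" using M by auto
  then show ?thesis
    using M sym_sprod[OF M]
    by (simp add: mult_add_distrib_mat_vec[OF M(1)] scalar_prod_add_distrib[of _ d] add_scalar_prod_distrib[of _ d])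
qed

lemma quad_smult:
  assumes "M \<in> carrier_mat d d" "x \<in> carrier_vec d"
  shows "(k \<cdot>\<^sub>v x) \<bullet> (M *\<^sub>v (k \<cdot>\<^sub>v x)) = k\<^sup>2 * (x \<bullet> (M *\<^sub>v (x :: real vec)))"
  using assms mult_mat_vec[of M d d x k]
  by (simp add: smult_scalar_prod_distrib[of _ d] scalar_prod_smult_distrib[of _ d] power2_eq_square)

lemma Cauchy_Schwarz_psd:
  assumes M: "pos_semidef d M" and x: "x \<in> carrier_vec d" "y \<in> carrier_vec d"
  shows "(x \<bullet> (M *\<^sub>v y))\<^sup>2 \<le> (x \<bullet> (M *\<^sub>v x)) * (y \<bullet> (M *\<^sub>v y))"
proof (rule discriminant_le)
  fix k :: real
  have M': "M \<in> carrier_mat d d" "transpose_mat M = M" using M by (auto simp: pos_semidef_def)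
  have "0 \<le> (x + k \<cdot>\<^sub>v y) \<bullet> (M *\<^sub>v (x + k \<cdot>\<^sub>v y))"
    using M x by (auto simp: pos_semidef_def)
  also have "\<dots> = x \<bullet> (M *\<^sub>v x) + 2 * (x \<bullet> (M *\<^sub>v y)) * k + (y \<bullet> (M *\<^sub>v y)) * k\<^sup>2"
    using M' x sym_sprod[OF M' x] mult_mat_vec[OF M'(1) x(2), of k]
    by (simp add: quad_add[OF M'] smult_scalar_prod_distrib[of _ d] scalar_prod_smult_distrib[of _ d]
        power2_eq_square mult_ac)
  finally show "0 \<le> \<dots>" .
qed

lemma Cauchy_Schwarz_vec:
  assumes "x \<in> carrier_vec d" "(y :: real vec) \<in> carrier_vec d"
  shows "(x \<bullet> y)\<^sup>2 \<le> (x \<bullet> x) * (y \<bullet> y)"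
  using Cauchy_Schwarz_psd[of d "1\<^sub>m d" x y] assms by (simp add: pos_semidef_def sprod_self_nonneg)

section \<open>Extreme eigenvalues as bounds on quadratic forms\<close>

text \<open>The form attains its minimum \<open>k\<close> over the unit sphere at some
  \<open>u\<close>. The shifted form
  \<open>v \<bullet> (M *\<^sub>v v) - k * (v \<bullet> v)\<close> is nonnegative by homogeneity and
  vanishes at \<open>u\<close>, so its first variation at \<open>u\<close> is zero, which is the
  eigenvalue equation.\<close>

lemma Rayleigh_min_eigenvalue:
  assumes M: "M \<in> carrier_mat d d" "transpose_mat M = M" and d: "d \<ge> 1"
  shows "\<exists>k::real. eigenvalue M k \<and> (\<forall>v\<in>carrier_vec d. v \<bullet> (M *\<^sub>v v) \<ge> k * (v \<bullet> v))"
proof -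
  define q where "q f = vec d f \<bullet> (M *\<^sub>v vec d f)" for f :: "nat \<Rightarrow> real"
  \<comment> \<open>The unit sphere in coordinates. The box around it loses no unit vector and makes
    it a closed subset of a compact set.\<close>
  define S where "S = Pi\<^sub>E {..<d} (\<lambda>_. {-1..1::real}) \<inter> {f. (\<Sum>i<d. (f i)\<^sup>2) = 1}"
  have q: "q f = (\<Sum>i<d. f i * (\<Sum>j<d. M $$ (i, j) * f j))" for f
    using M by (auto simp: q_def scalar_prod_def lessThan_atLeast0 intro!: sum.cong)
  have sq: "vec d f \<bullet> vec d f = (\<Sum>i<d. (f i)\<^sup>2)" for f :: "nat \<Rightarrow> real"
    by (simp add: scalar_prod_def lessThan_atLeast0 power2_eq_square)
  have "closed {f :: nat \<Rightarrow> real. (\<Sum>i<d. (f i)\<^sup>2) = 1}"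
    by (intro closed_Collect_eq continuous_intros)
  then have "compact S" unfolding S_def using compact_box[of "{..<d}" 1] by (rule compact_Int_closed[rotated])
  moreover have "(\<lambda>i\<in>{..<d}. if i = 0 then 1 else 0) \<in> S"
    using d by (auto simp: S_def if_distrib[of "\<lambda>x. x\<^sup>2"] sum.If_cases cong: if_cong)
  moreover have "continuous_on S q" unfolding q by (intro continuous_intros)
  ultimately obtain f where f: "f \<in> S" "\<And>g. g \<in> S \<Longrightarrow> q f \<le> q g"
    using continuous_attains_inf[of S q] by blast
  define u where "u = vec d f"
  define k where "k = q f"
  have u: "u \<in> carrier_vec d" "u \<bullet> u = 1" using f(1) by (auto simp: u_def sq S_def)
  have min: "v \<bullet> (M *\<^sub>v v) \<ge> k * (v \<bullet> v)" if v: "v \<in> carrier_vec d" for v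
  proof (cases "v \<bullet> v = 0")
    case True
    then have "v = 0\<^sub>v d" using v sprod_self_eq_0_iff by blast
    then show ?thesis using M by simp
  next
    case False
    define r where "r = sqrt (v \<bullet> v)"
    have r: "r > 0" "r\<^sup>2 = v \<bullet> v" using False sprod_self_nonneg[of v] by (auto simp: r_def)
    define g where "g = (\<lambda>i\<in>{..<d}. v $ i / r)"
    have g: "vec d g = (1 / r) \<cdot>\<^sub>v v" using v by (auto simp: g_def)
    have "(\<Sum>i<d. (g i)\<^sup>2) = (v \<bullet> v) / r\<^sup>2"
      using v by (simp add: g_def scalar_prod_lessThan power_divide sum_divide_distrib power2_eq_square)
    then have gS: "(\<Sum>i<d. (g i)\<^sup>2) = 1" using r False by simp
    have "g i \<in> {-1..1}" if "i < d" for i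
    proof -
      have "\<bar>g i\<bar> \<le> 1"
        using gS member_le_sum[of i "{..<d}" "\<lambda>i. (g i)\<^sup>2"] that by (simp add: abs_square_le_1)
      then show ?thesis by auto
    qed
    then have "g \<in> S" using gS by (auto simp: S_def g_def)
    then have "k \<le> q g" using f(2) by (simp add: k_def)
    also have "q g = (v \<bullet> (M *\<^sub>v v)) / r\<^sup>2"
      using quad_smult[OF M(1) v, of "1 / r"] by (simp add: q_def g power_divide)
    finally show ?thesis using r(1) unfolding r(2)[symmetric] by (simp add: pos_le_divide_eq)
  qed
  \<comment> \<open>The residual of the eigenvalue equation is itself the test direction: the linear
    coefficient of the shifted form along \<open>u + t w\<close> is
    \<open>2 * (w \<bullet> w)\<close>, and \<open>discriminant_le\<close> with \<open>a = 0\<close>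
    makes it vanish.\<close>
  define w where "w = M *\<^sub>v u - k \<cdot>\<^sub>v u"
  have w: "w \<in> carrier_vec d" using M u by (auto simp: w_def)
  have 1: "M *\<^sub>v u \<in> carrier_vec d" using M u by auto
  have "0 + 2 * (w \<bullet> w) * t + (w \<bullet> (M *\<^sub>v w) - k * (w \<bullet> w)) * t\<^sup>2 \<ge> 0" for t
  proof -
    have "0 \<le> (u + t \<cdot>\<^sub>v w) \<bullet> (M *\<^sub>v (u + t \<cdot>\<^sub>v w)) - k * ((u + t \<cdot>\<^sub>v w) \<bullet> (u + t \<cdot>\<^sub>v w))"
      using min[of "u + t \<cdot>\<^sub>v w"] u w by simp
    also have "\<dots> = (u \<bullet> (M *\<^sub>v u) - k) + 2 * t * (w \<bullet> (M *\<^sub>v u) - k * (w \<bullet> u)) + t\<^sup>2 * (w \<bullet> (M *\<^sub>v w) - k * (w \<bullet> w))"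
      using quad_add[OF M u(1), of "t \<cdot>\<^sub>v w"] quad_add[of "1\<^sub>m d" d u "t \<cdot>\<^sub>v w"] w u M 1
      by (simp add: mult_mat_vec[OF M(1) w] smult_scalar_prod_distrib[of _ d] scalar_prod_smult_distrib[of _ d] algebra_simps
          power2_eq_square)
    also have "u \<bullet> (M *\<^sub>v u) - k = 0" by (simp add: k_def q_def u_def)
    also have "w \<bullet> (M *\<^sub>v u) - k * (w \<bullet> u) = w \<bullet> w"
    proof -
      have "w \<bullet> w = w \<bullet> (M *\<^sub>v u) - w \<bullet> (k \<cdot>\<^sub>v u)"
        using scalar_prod_minus_distrib[of w d "M *\<^sub>v u" "k \<cdot>\<^sub>v u"] w 1 u by (simp flip: w_def)
      then show ?thesis using w u by (simp add: scalar_prod_smult_distrib[of _ d])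
    qed
    finally show ?thesis by (simp add: algebra_simps)
  qed
  from discriminant_le[OF this] have "w = 0\<^sub>v d" using w sprod_self_eq_0_iff[of w d] by simp
  have "M *\<^sub>v u = k \<cdot>\<^sub>v u"
  proof (rule eq_vecI)
    fix i assume "i < dim_vec (k \<cdot>\<^sub>v u)"
    then have "i < d" using u by simp
    then have "w $ i = (M *\<^sub>v u) $ i - (k \<cdot>\<^sub>v u) $ i" using M u by (simp add: w_def)
    moreover have "w $ i = 0" using \<open>w = 0\<^sub>v d\<close> \<open>i < d\<close> by simp
    ultimately show "(M *\<^sub>v u) $ i = (k \<cdot>\<^sub>v u) $ i" by simp
  qed (use M u in auto)
  moreover have "u \<noteq> 0\<^sub>v d" using u by auto
  ultimately have "eigenvalue M k" unfolding eigenvalue_def eigenvector_def using M u by auto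
  then show ?thesis using min by blast
qed

text \<open>The Rayleigh eigenvalue shows that the finite spectrum is nonempty, so that its
  \<open>Min\<close> is meaningful, and \<open>Min\<close> does not exceed it.\<close>

lemma min_eigenvalue_le_quad:
  assumes M: "M \<in> carrier_mat d d" "transpose_mat M = M" and d: "d \<ge> 1"
  shows "min_eigenvalue M \<in> spectrum M"
    and "v \<in> carrier_vec d \<Longrightarrow> min_eigenvalue M * (v \<bullet> v) \<le> v \<bullet> (M *\<^sub>v v)"
proof -
  obtain k where k: "k \<in> spectrum M" "\<And>v. v \<in> carrier_vec d \<Longrightarrow> k * (v \<bullet> v) \<le> v \<bullet> (M *\<^sub>v v)"
    using Rayleigh_min_eigenvalue[OF M d] by (auto simp: spectrum_def)
  have fin: "finite (spectrum M)" using card_finite_spectrum M by blast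
  then show "min_eigenvalue M \<in> spectrum M"
    unfolding min_eigenvalue_def using k(1) by (intro Min_in) auto
  assume v: "v \<in> carrier_vec d"
  have "min_eigenvalue M \<le> k" using fin k by (simp add: min_eigenvalue_def)
  then have "min_eigenvalue M * (v \<bullet> v) \<le> k * (v \<bullet> v)"
    by (intro mult_right_mono sprod_self_nonneg)
  with k(2)[OF v] show "min_eigenvalue M * (v \<bullet> v) \<le> v \<bullet> (M *\<^sub>v v)" by simp
qed

lemma spectrum_Rayleigh:
  assumes "M \<in> carrier_mat d d" "k \<in> spectrum (M :: real mat)"
  obtains v where "v \<in> carrier_vec d" "M *\<^sub>v v = k \<cdot>\<^sub>v v" "v \<bullet> v > 0" "v \<bullet> (M *\<^sub>v v) = k * (v \<bullet> v)"
proof -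
  obtain v where v: "v \<in> carrier_vec d" "v \<noteq> 0\<^sub>v d" "M *\<^sub>v v = k \<cdot>\<^sub>v v"
    using assms by (auto simp: spectrum_def eigenvalue_def eigenvector_def)
  moreover from this have "v \<bullet> v > 0" using sprod_self_nonneg[of v] sprod_self_eq_0_iff[of v d] by simp
  ultimately show ?thesis using that[of v] by (simp add: scalar_prod_smult_distrib[of _ d])
qed

text \<open>The minimal Rayleigh eigenvalue of \<open>- M\<close> is the negative of an eigenvalue
  of \<open>M\<close>, to which the bound \<open>s\<close> applies.\<close>

lemma quad_le_spectrum_bound:
  assumes M: "M \<in> carrier_mat d d" "transpose_mat M = M" and d: "d \<ge> 1"
    and s: "\<And>k. k \<in> spectrum M \<Longrightarrow> k \<le> s" and v: "v \<in> carrier_vec d"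
  shows "v \<bullet> (M *\<^sub>v v) \<le> s * (v \<bullet> (v :: real vec))"
proof -
  have neg: "(- M) *\<^sub>v x = - (M *\<^sub>v x)" if "x \<in> carrier_vec d" for x
    using M that by (intro eq_vecI) auto
  have "transpose_mat (- M) = - M"
    using M(2) by (metis transpose_uminus)
  then obtain k where k: "eigenvalue (- M) k" "\<And>v. v \<in> carrier_vec d \<Longrightarrow> k * (v \<bullet> v) \<le> v \<bullet> ((- M) *\<^sub>v v)"
    using Rayleigh_min_eigenvalue[of "- M" d] M d by auto
  then obtain u where u: "u \<in> carrier_vec d" "u \<noteq> 0\<^sub>v d" "(- M) *\<^sub>v u = k \<cdot>\<^sub>v u"
    using M by (auto simp: eigenvalue_def eigenvector_def)
  have "M *\<^sub>v u = (- k) \<cdot>\<^sub>v u"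
  proof (rule eq_vecI)
    fix i assume "i < dim_vec ((- k) \<cdot>\<^sub>v u)"
    then have "i < d" using u by simp
    moreover have "(- (M *\<^sub>v u)) $ i = (k \<cdot>\<^sub>v u) $ i" using u neg[of u] by simp
    ultimately show "(M *\<^sub>v u) $ i = ((- k) \<cdot>\<^sub>v u) $ i" using M u by simp
  qed (use M u in auto)
  then have "- k \<in> spectrum M"
    unfolding spectrum_def eigenvalue_def eigenvector_def using M u by auto
  then have "- k \<le> s" by (rule s)
  moreover have "k * (v \<bullet> v) \<le> - (v \<bullet> (M *\<^sub>v v))"
    using k(2)[OF v] neg[OF v] v M by (simp add: scalar_prod_uminus_right)
  ultimately show ?thesis
    using mult_right_mono[of "- k" s "v \<bullet> v"] sprod_self_nonneg[of v] by simp
qed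

subsection \<open>Norms, spectra and the normal cone\<close>

lemma vnorm_eq_L2_set: "v \<in> carrier_vec d \<Longrightarrow> vnorm v = L2_set (($) v) {..<d}"
  by (simp add: vnorm_def L2_set_def scalar_prod_lessThan power2_eq_square)

text \<open>A crude bound that only serves to show that the suprema in \<open>spectral_norm\<close>
  and \<open>sigmaTheta_max\<close> range over bounded sets. It does not enter the final
  constant.\<close>

lemma vnorm_mult_le_entries:
  assumes M: "M \<in> carrier_mat n m" and K: "\<And>i j. i < n \<Longrightarrow> j < m \<Longrightarrow> \<bar>M $$ (i, j)\<bar> \<le> K"
    and v: "v \<in> carrier_vec m" "vnorm v \<le> 1"
  shows "vnorm (M *\<^sub>v v) \<le> real n * (real m * K)"
proof -
  have v1: "\<bar>v $ j\<bar> \<le> 1" if "j < m" for j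
  proof -
    have "\<bar>v $ j\<bar> = L2_set (($) v) {j}" by simp
    also have "\<dots> \<le> L2_set (($) v) {..<m}"
      unfolding L2_set_def using that by (intro real_sqrt_le_mono sum_mono2) auto
    also have "\<dots> \<le> 1" using v vnorm_eq_L2_set[OF v(1)] by simp
    finally show ?thesis .
  qed
  have "vnorm (M *\<^sub>v v) \<le> (\<Sum>i<n. \<bar>(M *\<^sub>v v) $ i\<bar>)"
    unfolding vnorm_eq_L2_set[OF mult_mat_vec_carrier[OF M v(1)]] by (rule L2_set_le_sum_abs)
  also have "\<dots> \<le> (\<Sum>i<n. real m * K)"
  proof (rule sum_mono)
    fix i assume "i \<in> {..<n}"
    then have i: "i < n" by simp
    have "\<bar>(M *\<^sub>v v) $ i\<bar> \<le> (\<Sum>j<m. \<bar>M $$ (i, j) * v $ j\<bar>)"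
      unfolding mult_mat_vec_index_lessThan[OF M v(1) i] by (rule sum_abs)
    also have "\<dots> \<le> (\<Sum>j<m. K)"
    proof (rule sum_mono)
      fix j assume "j \<in> {..<m}"
      then show "\<bar>M $$ (i, j) * v $ j\<bar> \<le> K"
        using K[of i j] v1[of j] i mult_mono[of "\<bar>M $$ (i, j)\<bar>" K "\<bar>v $ j\<bar>" 1] by (auto simp: abs_mult)
    qed
    finally show "\<bar>(M *\<^sub>v v) $ i\<bar> \<le> real m * K" by simp
  qed
  finally show ?thesis by simp
qed

lemma vnorm_mult_bdd_above:
  "bdd_above ((\<lambda>v. vnorm (M *\<^sub>v v)) ` {v \<in> carrier_vec (dim_col M). vnorm v \<le> 1})"
proof (rule bdd_aboveI2)
  define K where "K = (\<Sum>i<dim_row M. \<Sum>j<dim_col M. \<bar>M $$ (i, j)\<bar>)"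
  have K: "\<bar>M $$ (i, j)\<bar> \<le> K" if "i < dim_row M" "j < dim_col M" for i j
  proof -
    have "\<bar>M $$ (i, j)\<bar> \<le> (\<Sum>j<dim_col M. \<bar>M $$ (i, j)\<bar>)"
      using that by (intro member_le_sum) auto
    also have "\<dots> \<le> K"
      unfolding K_def using that by (intro member_le_sum) (auto intro: sum_nonneg)
    finally show ?thesis .
  qed
  fix v assume "v \<in> {v \<in> carrier_vec (dim_col M). vnorm v \<le> 1}"
  then show "vnorm (M *\<^sub>v v) \<le> real (dim_row M) * (real (dim_col M) * K)"
    using K by (intro vnorm_mult_le_entries) auto
qed

lemma spectral_norm_le_entries:
  assumes M: "M \<in> carrier_mat n m" and K: "\<And>i j. i < n \<Longrightarrow> j < m \<Longrightarrow> \<bar>M $$ (i, j)\<bar> \<le> K"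
  shows "spectral_norm M \<le> real n * (real m * K)"
  unfolding spectral_norm_def
proof (rule cSUP_least)
  have "0\<^sub>v m \<in> {v \<in> carrier_vec (dim_col M). vnorm v \<le> 1}" using M by (simp add: vnorm_def)
  then show "{v \<in> carrier_vec (dim_col M). vnorm v \<le> 1} \<noteq> {}" by blast
qed (use M in \<open>auto intro!: vnorm_mult_le_entries K\<close>)

lemma spectral_norm_nonneg: "spectral_norm M \<ge> 0"
proof -
  have "0 \<le> vnorm (M *\<^sub>v 0\<^sub>v (dim_col M))" by (rule vnorm_nonneg)
  also have "\<dots> \<le> spectral_norm M"
    unfolding spectral_norm_def by (rule cSUP_upper[OF _ vnorm_mult_bdd_above]) (simp add: vnorm_def)
  finally show ?thesis .
qed

text \<open>Scaling to unit length reduces this to the definition of the norm. The squared form is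
  the one that can be integrated later.\<close>

lemma sprod_mult_le_spectral_norm:
  assumes M: "M \<in> carrier_mat n m" and v: "v \<in> carrier_vec m"
  shows "(M *\<^sub>v v) \<bullet> (M *\<^sub>v v) \<le> (spectral_norm M)\<^sup>2 * (v \<bullet> v)"
proof (cases "v \<bullet> v = 0")
  case True
  then have "v = 0\<^sub>v m" using v sprod_self_eq_0_iff by blast
  then have "M *\<^sub>v v = 0\<^sub>v n" using M by (intro eq_vecI) auto
  then show ?thesis using True by simp
next
  case False
  define r where "r = vnorm v"
  have r: "r > 0" "r\<^sup>2 = v \<bullet> v"
    using False sprod_self_nonneg[of v] by (auto simp: r_def vnorm_square) (simp add: vnorm_def)
  define u where "u = (1 / r) \<cdot>\<^sub>v v"
  have u: "u \<in> carrier_vec m" using v by (simp add: u_def)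
  have uu: "u \<bullet> u = (1 / r)\<^sup>2 * (v \<bullet> v)"
    using quad_smult[of "1\<^sub>m m" m v "1 / r"] v u by (simp add: u_def)
  then have "vnorm u \<le> 1" using r False by (simp add: vnorm_def power_divide)
  then have "vnorm (M *\<^sub>v u) \<le> spectral_norm M"
    unfolding spectral_norm_def by (intro cSUP_upper[OF _ vnorm_mult_bdd_above]) (use M u in auto)
  then have "(M *\<^sub>v u) \<bullet> (M *\<^sub>v u) \<le> (spectral_norm M)\<^sup>2"
    unfolding vnorm_square[symmetric] using vnorm_nonneg by (intro power_mono) auto
  moreover have "(M *\<^sub>v u) \<bullet> (M *\<^sub>v u) = (1 / r)\<^sup>2 * ((M *\<^sub>v v) \<bullet> (M *\<^sub>v v))"
  proof -
    have "M *\<^sub>v u = (1 / r) \<cdot>\<^sub>v (M *\<^sub>v v)" using mult_mat_vec[OF M v] by (simp add: u_def)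
    moreover have "M *\<^sub>v v \<in> carrier_vec n" using M v by simp
    ultimately show ?thesis using quad_smult[of "1\<^sub>m n" n "M *\<^sub>v v" "1 / r"] by simp
  qed
  ultimately show ?thesis using r(1) unfolding r(2)[symmetric] by (simp add: power_divide pos_divide_le_eq)
qed

section \<open>Spectra of positive definite matrices and the spectral radius\<close>

lemma pos_def_imp_pos_semidef: "pos_def d M \<Longrightarrow> pos_semidef d M"
  unfolding pos_def_def pos_semidef_def
  by (metis less_eq_real_def mult_mat_vec_carrier scalar_prod_left_zero)

lemma pos_def_spectrum_pos:
  assumes "pos_def d M" "k \<in> spectrum M" shows "k > 0"
proof -
  have "M \<in> carrier_mat d d" using assms by (simp add: pos_def_def)
  from spectrum_Rayleigh[OF this assms(2)]
  obtain v where v: "v \<in> carrier_vec d" "v \<bullet> v > 0" "v \<bullet> (M *\<^sub>v v) = k * (v \<bullet> v)"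
    by metis
  moreover have "v \<bullet> (M *\<^sub>v v) > 0" using assms v by (auto simp: pos_def_def)
  ultimately show ?thesis by (simp add: zero_less_mult_iff)
qed

text \<open>If \<open>k\<close> is the least eigenvalue of \<open>M\<close>, then evaluating the
  form of the Gram matrix \<open>N\<close> at an eigenvector for \<open>k\<close> gives
  \<open>min_eigenvalue N \<le> k\<^sup>2\<close>. Hence the least singular value is at most
  \<open>k\<close>, and the Rayleigh bound for \<open>k\<close> carries over to it.\<close>

lemma pos_def_min_singular_value:
  assumes M: "pos_def d M" and d: "d \<ge> 1"
  shows "min_singular_value M > 0"
    and "v \<in> carrier_vec d \<Longrightarrow> min_singular_value M * (v \<bullet> v) \<le> v \<bullet> (M *\<^sub>v v)"
proof -
  have M': "M \<in> carrier_mat d d" "transpose_mat M = M" using M by (auto simp: pos_def_def)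
  define N where "N = transpose_mat M * M"
  have N: "N \<in> carrier_mat d d" "transpose_mat N = N"
    using M' by (auto simp: N_def transpose_mult[of M d d M d])
  have Nv: "N *\<^sub>v x = M *\<^sub>v (M *\<^sub>v x)" if "x \<in> carrier_vec d" for x using M' that by (simp add: N_def)
  define k where "k = min_eigenvalue M"
  have k: "k \<in> spectrum M" "k > 0"
    using min_eigenvalue_le_quad(1)[OF M' d] pos_def_spectrum_pos[OF M] by (auto simp: k_def)
  have "pos_def d N"
    unfolding pos_def_def
  proof (intro conjI ballI impI N)
    fix v :: "real vec" assume v: "v \<in> carrier_vec d" "v \<noteq> 0\<^sub>v d"
    have Mv: "M *\<^sub>v v \<in> carrier_vec d" using M' v by simp
    have "v \<bullet> (M *\<^sub>v v) > 0" using M v by (auto simp: pos_def_def)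
    then have "M *\<^sub>v v \<noteq> 0\<^sub>v d" using v by auto
    then have "(M *\<^sub>v v) \<bullet> (M *\<^sub>v v) > 0"
      using sprod_self_nonneg[of "M *\<^sub>v v"] sprod_self_eq_0_iff[OF Mv] by simp
    then show "v \<bullet> (N *\<^sub>v v) > 0"
      using Nv[OF v(1)] sym_sprod[OF M' v(1) Mv] by simp
  qed
  then have "min_eigenvalue N > 0"
    using min_eigenvalue_le_quad(1)[OF N d] pos_def_spectrum_pos by blast
  then show "min_singular_value M > 0" by (simp add: min_singular_value_def N_def)
  obtain u where u: "u \<in> carrier_vec d" "M *\<^sub>v u = k \<cdot>\<^sub>v u" "u \<bullet> u > 0"
    using spectrum_Rayleigh[OF M'(1) k(1)] by metis
  have "N *\<^sub>v u = k\<^sup>2 \<cdot>\<^sub>v u"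
    using Nv[OF u(1)] u mult_mat_vec[OF M'(1) u(1), of k] by (simp add: power2_eq_square smult_smult_assoc)
  then have "min_eigenvalue N * (u \<bullet> u) \<le> k\<^sup>2 * (u \<bullet> u)"
    using min_eigenvalue_le_quad(2)[OF N d u(1)] u by (simp add: scalar_prod_smult_distrib[of _ d])
  then have "min_eigenvalue N \<le> k\<^sup>2" using u(3) by simp
  then have "sqrt (min_eigenvalue N) \<le> sqrt (k\<^sup>2)" by (rule real_sqrt_le_mono)
  then have le: "min_singular_value M \<le> k" using k by (simp add: min_singular_value_def N_def)
  assume v: "v \<in> carrier_vec d"
  show "min_singular_value M * (v \<bullet> v) \<le> v \<bullet> (M *\<^sub>v v)"
    using min_eigenvalue_le_quad(2)[OF M' d v] mult_right_mono[OF le sprod_self_nonneg[of v]]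
    by (simp add: k_def)
qed

text \<open>A real eigenvector is also a complex one, and the spectral radius is a maximum over
  complex eigenvalues. Needed for the terminal weight, which is bounded through its spectral
  radius.\<close>

lemma spectrum_le_spectral_radius:
  assumes M: "M \<in> carrier_mat d d" and d: "d \<ge> 1" and k: "k \<in> spectrum (M :: real mat)"
  shows "\<bar>k\<bar> \<le> spectral_radius (map_mat complex_of_real M)"
proof -
  obtain v where v: "v \<in> carrier_vec d" "v \<noteq> 0\<^sub>v d" "M *\<^sub>v v = k \<cdot>\<^sub>v v"
    using k M by (auto simp: spectrum_def eigenvalue_def eigenvector_def)
  let ?v = "map_vec complex_of_real v"
  have "?v \<noteq> 0\<^sub>v d"
  proof
    assume eq: "?v = 0\<^sub>v d"
    have "v $ i = 0" if "i < d" for i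
      using arg_cong[OF eq, of "\<lambda>x. x $ i"] that v(1) by simp
    then show False using v by (auto intro!: eq_vecI)
  qed
  moreover have "map_mat complex_of_real M *\<^sub>v ?v = complex_of_real k \<cdot>\<^sub>v ?v"
    using of_real_hom.mult_mat_vec_hom[OF M v(1)] v(3) of_real_hom.vec_hom_smult[of k v] by metis
  ultimately have "eigenvalue (map_mat complex_of_real M) (complex_of_real k)"
    unfolding eigenvalue_def eigenvector_def using M v(1) by (intro exI[of _ ?v]) auto
  then have "norm (complex_of_real k) \<in> norm ` spectrum (map_mat complex_of_real M)"
    unfolding spectrum_def by (intro imageI) simp
  then have "norm (complex_of_real k) \<le> spectral_radius (map_mat complex_of_real M)"
    using spectral_radius_mem_max(2)[of "map_mat complex_of_real M" d] M d by simp
  then show ?thesis by simp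
qed

section \<open>Frobenius geometry and the minimum over the normal cone\<close>

lemma frob_inner_le:
  assumes "M \<in> carrier_mat n m" "N \<in> carrier_mat n m"
  shows "frob_inner M N \<le> frob_norm M * frob_norm N"
proof -
  have sum: "frob_inner X Y = (\<Sum>p\<in>{..<n} \<times> {..<m}. X $$ p * Y $$ p)"
    if "X \<in> carrier_mat n m" for X Y
    using that by (simp add: frob_inner_def sum.cartesian_product split_def)
  have "frob_inner M N \<le> (\<Sum>p\<in>{..<n} \<times> {..<m}. \<bar>M $$ p\<bar> * \<bar>N $$ p\<bar>)"
    unfolding sum[OF assms(1)] by (intro sum_mono) (metis abs_ge_self abs_mult)
  also have "\<dots> \<le> frob_norm M * frob_norm N"
    using L2_set_mult_ineq[of "($$) M" "($$) N" "{..<n} \<times> {..<m}"]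
    by (simp add: frob_norm_def sum assms L2_set_def power2_eq_square)
  finally show ?thesis .
qed

lemma frob_norm_square: "(frob_norm M)\<^sup>2 = (\<Sum>i<dim_row M. \<Sum>j<dim_col M. (M $$ (i, j))\<^sup>2)"
  unfolding frob_norm_def frob_inner_def by (simp add: sum_nonneg power2_eq_square)

text \<open>The cone is closed and contains zero, and the residual is a squared distance. Elements
  that do no worse than zero lie in a box, so a minimum over the compact part of the cone inside the
  box is a minimum over the cone.\<close>

lemma normal_cone_attains_min:
  "\<exists>g. is_arg_min (residual L \<theta>) (\<lambda>g. g \<in> normal_cone L \<theta>) g"
proof -
  define T n m where "T = horizon L" and "n = dimA L" and "m = dimS L"
  define I where "I = {..<T} \<times> {..<n} \<times> {..<m}"
  define H where "H p = grad L \<theta> (fst p) $$ snd p" for p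
  \<comment> \<open>Matrix families are coded as real functions on \<open>I\<close>, where
    compactness and continuity can be expressed. On the cone, \<open>dec\<close> undoes
    \<open>enc\<close>.\<close>
  define dec where "dec c = (\<lambda>t\<in>{..<T}. mat n m (\<lambda>(i, j). c (t, i, j)))" for c :: "nat \<times> nat \<times> nat \<Rightarrow> real"
  define enc where "enc g = (\<lambda>p\<in>I. g (fst p) $$ snd p)" for g :: "nat \<Rightarrow> real mat"
  have gr: "grad L \<theta> t \<in> carrier_mat n m" for t by (simp add: grad_def n_def m_def)
  have dec_enc: "dec (enc g) = g" if "g \<in> normal_cone L \<theta>" for g
  proof
    fix t
    show "dec (enc g) t = g t"
    proof (cases "t < T")
      case True
      then have "g t \<in> carrier_mat n m" using that by (auto simp: normal_cone_def T_def n_def m_def PiE_iff)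
      then show ?thesis using True by (intro eq_matI) (auto simp: dec_def enc_def I_def)
    next
      case False
      then show ?thesis using that by (auto simp: dec_def normal_cone_def T_def PiE_iff extensional_def)
    qed
  qed
  have res: "residual L \<theta> (dec c) = (\<Sum>p\<in>I. (H p + c p)\<^sup>2)" for c
  proof -
    have "(frob_norm (grad L \<theta> t + dec c t))\<^sup>2 = (\<Sum>i<n. \<Sum>j<m. (H (t, i, j) + c (t, i, j))\<^sup>2)" if "t < T" for t
      unfolding frob_norm_square using gr[of t] that by (simp add: dec_def H_def)
    then show ?thesis
      unfolding residual_def I_def T_def[symmetric]
      by (simp add: sum.cartesian_product split_def)
  qed
  have cone: "dec c \<in> normal_cone L \<theta> \<longleftrightarrow>
      (\<forall>\<theta>'\<in>Theta L. (\<Sum>t<T. \<Sum>i<n. \<Sum>j<m. c (t, i, j) * (\<theta>' t - \<theta> t) $$ (i, j)) \<le> 0)" for c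
  proof -
    have "(\<Sum>t<T. frob_inner (dec c t) (\<theta>' t - \<theta> t)) =
        (\<Sum>t<T. \<Sum>i<n. \<Sum>j<m. c (t, i, j) * (\<theta>' t - \<theta> t) $$ (i, j))" for \<theta>'
      by (intro sum.cong) (auto simp: frob_inner_def dec_def)
    then show ?thesis
      by (auto simp: normal_cone_def T_def[symmetric] n_def[symmetric] m_def[symmetric] dec_def PiE_iff)
  qed
  \<comment> \<open>Twice the Euclidean norm of the gradient: if \<open>g\<close> has a residual no
    larger than that of zero, each coordinate of the gradient plus \<open>g\<close> is at most this
    norm, and so is each coordinate of the gradient, hence each coordinate of \<open>g\<close> is at
    most \<open>K\<close> in absolute value.\<close>
  define K where "K = 2 * sqrt (\<Sum>p\<in>I. (H p)\<^sup>2)"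
  have K0: "K \<ge> 0" by (simp add: K_def sum_nonneg)
  have finI: "finite I" by (simp add: I_def)
  define S where "S = Pi\<^sub>E I (\<lambda>_. {-K..K}) \<inter> {c. dec c \<in> normal_cone L \<theta>}"
  have "closed {c. dec c \<in> normal_cone L \<theta>}"
    unfolding cone Ball_def
    by (intro closed_Collect_all closed_Collect_imp closed_Collect_le continuous_intros) auto
  then have "compact S" unfolding S_def using compact_box[of I K] by (rule compact_Int_closed[rotated])
  moreover have z: "(\<lambda>p\<in>I. 0) \<in> S"
  proof -
    have "(\<Sum>t<T. \<Sum>i<n. \<Sum>j<m. (\<lambda>p\<in>I. 0) (t, i, j) * (\<theta>' t - \<theta> t) $$ (i, j)) = 0" for \<theta>'
      by (intro sum.neutral ballI) (auto simp: I_def)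
    then show ?thesis using K0 by (auto simp: S_def cone)
  qed
  moreover have "continuous_on S (\<lambda>c. residual L \<theta> (dec c))"
    unfolding res by (intro continuous_intros)
  ultimately obtain c where c: "c \<in> S" "\<And>c'. c' \<in> S \<Longrightarrow> residual L \<theta> (dec c) \<le> residual L \<theta> (dec c')"
    using continuous_attains_inf[of S "\<lambda>c. residual L \<theta> (dec c)"] by blast
  have "residual L \<theta> (dec c) \<le> residual L \<theta> g" if g: "g \<in> normal_cone L \<theta>" for g
  proof (cases "residual L \<theta> g \<le> (\<Sum>p\<in>I. (H p)\<^sup>2)")
    case True
    have "enc g p \<in> {-K..K}" if p: "p \<in> I" for p
    proof -
      have "(H p + enc g p)\<^sup>2 \<le> (\<Sum>p\<in>I. (H p + enc g p)\<^sup>2)"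
        using finI p by (intro member_le_sum) auto
      also have "\<dots> = residual L \<theta> g" using res[of "enc g"] dec_enc[OF g] by simp
      finally have "(H p + enc g p)\<^sup>2 \<le> (\<Sum>p\<in>I. (H p)\<^sup>2)" using True by simp
      then have "\<bar>H p + enc g p\<bar> \<le> sqrt (\<Sum>p\<in>I. (H p)\<^sup>2)" by (metis real_sqrt_abs real_sqrt_le_iff)
      moreover have "(H p)\<^sup>2 \<le> (\<Sum>p\<in>I. (H p)\<^sup>2)"
        using finI p by (intro member_le_sum) auto
      then have "\<bar>H p\<bar> \<le> sqrt (\<Sum>p\<in>I. (H p)\<^sup>2)" by (metis real_sqrt_abs real_sqrt_le_iff)
      ultimately show ?thesis by (auto simp: K_def abs_le_iff)
    qed
    then have "enc g \<in> S" using g dec_enc[OF g] by (auto simp: S_def enc_def)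
    from c(2)[OF this] show ?thesis using dec_enc[OF g] by simp
  next
    case False
    have "residual L \<theta> (dec c) \<le> residual L \<theta> (dec (\<lambda>p\<in>I. 0))" using c(2)[OF z] .
    also have "\<dots> = (\<Sum>p\<in>I. (H p)\<^sup>2)" unfolding res by (intro sum.cong) auto
    finally show ?thesis using False by simp
  qed
  moreover have "dec c \<in> normal_cone L \<theta>" using c(1) by (simp add: S_def)
  ultimately show ?thesis by (auto simp: is_arg_min_linorder)
qed

subsection \<open>Square-integrable random vectors and the state process\<close>

text \<open>The dimension is required at every sample point, so that vector algebra under the
  integral needs no almost-everywhere argument.\<close>

definition L2vec :: "'w measure \<Rightarrow> nat \<Rightarrow> ('w \<Rightarrow> real vec) \<Rightarrow> bool" where
  "L2vec M d Y \<longleftrightarrow> (\<forall>\<omega>. Y \<omega> \<in> carrier_vec d) \<and>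
     (\<forall>i<d. (\<lambda>\<omega>. Y \<omega> $ i) \<in> borel_measurable M \<and> integrable M (\<lambda>\<omega>. (Y \<omega> $ i)\<^sup>2))"

lemma L2vec_carrier: "L2vec M d Y \<Longrightarrow> Y \<omega> \<in> carrier_vec d"
  by (simp add: L2vec_def)

lemma integrable_mult_of_squares:
  fixes f g :: "'w \<Rightarrow> real"
  assumes [measurable]: "f \<in> borel_measurable M" "g \<in> borel_measurable M"
    and "integrable M (\<lambda>x. (f x)\<^sup>2)" "integrable M (\<lambda>x. (g x)\<^sup>2)"
  shows "integrable M (\<lambda>x. f x * g x)"
proof (rule Bochner_Integration.integrable_bound)
  show "integrable M (\<lambda>x. (f x)\<^sup>2 + (g x)\<^sup>2)" using assms by simp
  have "\<bar>a * b\<bar> \<le> a\<^sup>2 + b\<^sup>2" for a b :: real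
  proof -
    have "0 \<le> \<bar>a\<bar> * \<bar>b\<bar>" by simp
    moreover have "2 * \<bar>a\<bar> * \<bar>b\<bar> \<le> a\<^sup>2 + b\<^sup>2" using sum_squares_bound[of "\<bar>a\<bar>" "\<bar>b\<bar>"] by simp
    ultimately show ?thesis unfolding abs_mult by linarith
  qed
  then show "AE x in M. norm (f x * g x) \<le> norm ((f x)\<^sup>2 + (g x)\<^sup>2)" by simp
qed simp

lemma L2vec_prod:
  assumes "L2vec M d Y" "L2vec M e Z" "i < d" "j < e"
  shows "integrable M (\<lambda>\<omega>. Y \<omega> $ i * Z \<omega> $ j)"
  using assms by (intro integrable_mult_of_squares) (auto simp: L2vec_def)

lemma L2vec_add:
  assumes Y: "L2vec M d Y" and Z: "L2vec M d Z"
  shows "L2vec M d (\<lambda>\<omega>. Y \<omega> + Z \<omega>)"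
proof -
  have c: "Y \<omega> \<in> carrier_vec d" "Z \<omega> \<in> carrier_vec d" for \<omega> using Y Z by (auto simp: L2vec_def)
  have "(\<lambda>\<omega>. (Y \<omega> + Z \<omega>) $ i) = (\<lambda>\<omega>. Y \<omega> $ i + Z \<omega> $ i)" if "i < d" for i
    using that by (intro ext) (simp add: carrier_vecD[OF c(2)])
  moreover have "(\<lambda>\<omega>. ((Y \<omega> + Z \<omega>) $ i)\<^sup>2) = (\<lambda>\<omega>. (Y \<omega> $ i)\<^sup>2 + 2 * (Y \<omega> $ i * Z \<omega> $ i) + (Z \<omega> $ i)\<^sup>2)"
    if "i < d" for i
    using that by (intro ext) (simp add: carrier_vecD[OF c(2)] power2_sum algebra_simps)
  ultimately show ?thesis
    using c Y Z L2vec_prod[OF Y Z] by (auto simp: L2vec_def intro!: borel_measurable_add)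
qed

lemma L2vec_sum_integrable:
  assumes Y: "L2vec M d Y" and Z: "L2vec M e Z"
  shows "integrable M (\<lambda>\<omega>. (\<Sum>i<d. a i * Y \<omega> $ i) * (\<Sum>j<e. b j * Z \<omega> $ j))"
proof -
  have "integrable M (\<lambda>\<omega>. \<Sum>i<d. \<Sum>j<e. (a i * b j) * (Y \<omega> $ i * Z \<omega> $ j))"
    by (intro Bochner_Integration.integrable_sum integrable_mult_right L2vec_prod[OF Y Z]) auto
  then show ?thesis by (simp add: sum_product mult_ac)
qed

lemma L2vec_mult_mat:
  assumes Y: "L2vec M d Y" and N: "N \<in> carrier_mat n d"
  shows "L2vec M n (\<lambda>\<omega>. N *\<^sub>v Y \<omega>)"
proof -
  have c: "Y \<omega> \<in> carrier_vec d" for \<omega> using Y by (auto simp: L2vec_def)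
  have eq: "(N *\<^sub>v Y \<omega>) $ i = (\<Sum>j<d. N $$ (i, j) * Y \<omega> $ j)" if "i < n" for i \<omega>
    using mult_mat_vec_index_lessThan[OF N c that] .
  show ?thesis
    unfolding L2vec_def
  proof (intro conjI allI impI)
    fix i assume i: "i < n"
    show "(\<lambda>\<omega>. (N *\<^sub>v Y \<omega>) $ i) \<in> borel_measurable M"
      unfolding eq[OF i] using Y by (intro borel_measurable_sum borel_measurable_times) (auto simp: L2vec_def)
    show "integrable M (\<lambda>\<omega>. ((N *\<^sub>v Y \<omega>) $ i)\<^sup>2)"
      unfolding eq[OF i] power2_eq_square by (rule L2vec_sum_integrable[OF Y Y])
  qed (use N c in auto)
qed

lemma L2vec_sprod:
  assumes Y: "L2vec M d Y" and Z: "L2vec M d Z"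
  shows "integrable M (\<lambda>\<omega>. Y \<omega> \<bullet> Z \<omega>)"
  and "(\<integral>\<omega>. Y \<omega> \<bullet> Z \<omega> \<partial>M) = (\<Sum>i<d. \<integral>\<omega>. Y \<omega> $ i * Z \<omega> $ i \<partial>M)"
proof -
  have eq: "Y \<omega> \<bullet> Z \<omega> = (\<Sum>i<d. Y \<omega> $ i * Z \<omega> $ i)" for \<omega>
    using Z by (intro scalar_prod_lessThan) (auto simp: L2vec_def)
  show "integrable M (\<lambda>\<omega>. Y \<omega> \<bullet> Z \<omega>)"
    unfolding eq using L2vec_prod[OF Y Z] by auto
  show "(\<integral>\<omega>. Y \<omega> \<bullet> Z \<omega> \<partial>M) = (\<Sum>i<d. \<integral>\<omega>. Y \<omega> $ i * Z \<omega> $ i \<partial>M)"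
    unfolding eq using L2vec_prod[OF Y Z] by (subst Bochner_Integration.integral_sum) auto
qed

text \<open>This identity turns eigenvalue bounds on second moments into bounds on expected squares
  of linear forms.\<close>

lemma L2vec_sprod_const:
  assumes Y: "L2vec M d Y" and u: "u \<in> carrier_vec d"
  shows "integrable M (\<lambda>\<omega>. (u \<bullet> Y \<omega>)\<^sup>2)"
    and "(\<integral>\<omega>. (u \<bullet> Y \<omega>)\<^sup>2 \<partial>M) = u \<bullet> (second_moment d M Y *\<^sub>v u)"
proof -
  have c: "Y \<omega> \<in> carrier_vec d" for \<omega> using Y by (auto simp: L2vec_def)
  have eq: "(u \<bullet> Y \<omega>)\<^sup>2 = (\<Sum>i<d. \<Sum>j<d. (u $ i * u $ j) * (Y \<omega> $ i * Y \<omega> $ j))" for \<omega>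
    by (simp add: scalar_prod_lessThan[OF c] power2_eq_square sum_product mult_ac)
  have int: "integrable M (\<lambda>\<omega>. (u $ i * u $ j) * (Y \<omega> $ i * Y \<omega> $ j))" if "i < d" "j < d" for i j
    by (intro integrable_mult_right L2vec_prod[OF Y Y] that)
  show "integrable M (\<lambda>\<omega>. (u \<bullet> Y \<omega>)\<^sup>2)"
    unfolding eq by (intro Bochner_Integration.integrable_sum int) auto
  have "(\<integral>\<omega>. (u \<bullet> Y \<omega>)\<^sup>2 \<partial>M) = (\<Sum>i<d. \<integral>\<omega>. (\<Sum>j<d. (u $ i * u $ j) * (Y \<omega> $ i * Y \<omega> $ j)) \<partial>M)"
    unfolding eq by (intro Bochner_Integration.integral_sum Bochner_Integration.integrable_sum int) auto
  also have "\<dots> = (\<Sum>i<d. \<Sum>j<d. \<integral>\<omega>. (u $ i * u $ j) * (Y \<omega> $ i * Y \<omega> $ j) \<partial>M)"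
    by (intro sum.cong refl Bochner_Integration.integral_sum int) auto
  also have "\<dots> = (\<Sum>i<d. u $ i * (\<Sum>j<d. second_moment d M Y $$ (i, j) * u $ j))"
    by (simp add: second_moment_def sum_distrib_left mult_ac)
  also have "\<dots> = u \<bullet> (second_moment d M Y *\<^sub>v u)"
    using u mult_mat_vec_index_lessThan[of "second_moment d M Y" d d u]
    by (subst scalar_prod_lessThan[of _ d]) (auto simp: second_moment_def intro: carrier_vecI)
  finally show "(\<integral>\<omega>. (u \<bullet> Y \<omega>)\<^sup>2 \<partial>M) = u \<bullet> (second_moment d M Y *\<^sub>v u)" .
qed

lemma second_moment_sym:
  "second_moment d M Y \<in> carrier_mat d d" "transpose_mat (second_moment d M Y) = second_moment d M Y"
  by (auto simp: second_moment_def mult.commute intro!: eq_matI)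

lemma uncorrelated_sprod_mult:
  assumes X: "L2vec M d X" and W: "L2vec M e W" and N: "N \<in> carrier_mat e d"
    and 0: "\<And>i j. i < d \<Longrightarrow> j < e \<Longrightarrow> (\<integral>\<omega>. X \<omega> $ i * W \<omega> $ j \<partial>M) = 0" and j: "j < e" "k < e"
  shows "(\<integral>\<omega>. (N *\<^sub>v X \<omega>) $ k * W \<omega> $ j \<partial>M) = 0"
proof -
  have c: "X \<omega> \<in> carrier_vec d" for \<omega> using X by (auto simp: L2vec_def)
  have "(\<integral>\<omega>. (N *\<^sub>v X \<omega>) $ k * W \<omega> $ j \<partial>M) = (\<integral>\<omega>. (\<Sum>i<d. N $$ (k, i) * (X \<omega> $ i * W \<omega> $ j)) \<partial>M)"
    by (simp add: mult_mat_vec_index_lessThan[OF N c j(2)] sum_distrib_left sum_distrib_right mult_ac)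
  also have "\<dots> = (\<Sum>i<d. \<integral>\<omega>. N $$ (k, i) * (X \<omega> $ i * W \<omega> $ j) \<partial>M)"
    by (intro Bochner_Integration.integral_sum integrable_mult_right L2vec_prod[OF X W] j) auto
  also have "\<dots> = 0" using 0 j by (intro sum.neutral) auto
  finally show ?thesis .
qed

text \<open>The expectation of a quadratic form sees the law only through second moments, so
  vanishing correlations remove the cross term.\<close>

lemma uncorrelated_quad:
  assumes X: "L2vec M d X" and W: "L2vec M d W" and P: "P \<in> carrier_mat d d" "transpose_mat P = P"
    and 0: "\<And>i j. i < d \<Longrightarrow> j < d \<Longrightarrow> (\<integral>\<omega>. X \<omega> $ i * W \<omega> $ j \<partial>M) = 0"
  shows "(\<integral>\<omega>. (X \<omega> + W \<omega>) \<bullet> (P *\<^sub>v (X \<omega> + W \<omega>)) \<partial>M) =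
    (\<integral>\<omega>. X \<omega> \<bullet> (P *\<^sub>v X \<omega>) \<partial>M) + (\<integral>\<omega>. W \<omega> \<bullet> (P *\<^sub>v W \<omega>) \<partial>M)"
proof -
  have c: "X \<omega> \<in> carrier_vec d" "W \<omega> \<in> carrier_vec d" for \<omega> using X W by (auto simp: L2vec_def)
  note PX = L2vec_mult_mat[OF X P(1)] and PW = L2vec_mult_mat[OF W P(1)]
  have cross: "(\<integral>\<omega>. W \<omega> \<bullet> (P *\<^sub>v X \<omega>) \<partial>M) = 0"
    unfolding L2vec_sprod(2)[OF W PX]
    using uncorrelated_sprod_mult[OF X W P(1) 0] by (intro sum.neutral) (auto simp: mult.commute)
  show ?thesis
    unfolding quad_add[OF P c]
    using L2vec_sprod(1)[OF X PX] L2vec_sprod(1)[OF W PX] L2vec_sprod(1)[OF W PW] cross by simp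
qed

section \<open>Integrals over product measures\<close>

lemma (in pair_sigma_finite) integral_mult_fst_snd:
  fixes f g :: "_ \<Rightarrow> real"
  assumes f: "integrable M1 f" and g: "integrable M2 g"
  shows "integrable (M1 \<Otimes>\<^sub>M M2) (\<lambda>z. f (fst z) * g (snd z))"
    and "(\<integral>z. f (fst z) * g (snd z) \<partial>(M1 \<Otimes>\<^sub>M M2)) = integral\<^sup>L M1 f * integral\<^sup>L M2 g"
proof -
  have [measurable]: "f \<in> borel_measurable M1" "g \<in> borel_measurable M2" using f g by auto
  show int: "integrable (M1 \<Otimes>\<^sub>M M2) (\<lambda>z. f (fst z) * g (snd z))"
  proof (rule Fubini_integrable)
    show "integrable M1 (\<lambda>x. \<integral>y. norm (f (fst (x, y)) * g (snd (x, y))) \<partial>M2)"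
      using f by (simp add: abs_mult)
  qed (use g in auto)
  show "(\<integral>z. f (fst z) * g (snd z) \<partial>(M1 \<Otimes>\<^sub>M M2)) = integral\<^sup>L M1 f * integral\<^sup>L M2 g"
    using integral_fst'[OF int] by simp
qed

text \<open>The integrand is a product over all of \<open>I\<close> whose factors are constantly 1
  except at \<open>t\<close> and \<open>k\<close>, which brings it under the product formula for
  integrals.\<close>

lemma integral_PiM_two_components:
  fixes a b :: "'a \<Rightarrow> real" and I :: "'i set"
  assumes N: "prob_space N" and I: "finite I" "t \<in> I" "k \<in> I" "t \<noteq> k"
    and a: "integrable N a" and b: "integrable N b"
  shows "integrable (Pi\<^sub>M I (\<lambda>_. N)) (\<lambda>x. a (x t) * b (x k))"
    and "(\<integral>x. a (x t) * b (x k) \<partial>Pi\<^sub>M I (\<lambda>_. N)) = integral\<^sup>L N a * integral\<^sup>L N b"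
proof -
  interpret prob_space N by fact
  interpret product_sigma_finite "\<lambda>_. N" by standard
  define f where "f i = (if i = t then a else if i = k then b else (\<lambda>_. 1))" for i
  have f: "integrable N (f i)" for i using a b by (auto simp: f_def)
  \<comment> \<open>Stated for a general \<open>h\<close> because it is used twice: with evaluation
    at a point for the integrand and with integration for the value.\<close>
  have prod: "(\<Prod>i\<in>I. h (f i) i) = h a t * h b k" if "\<And>i. h (\<lambda>_. 1) i = 1" for h :: "('a \<Rightarrow> real) \<Rightarrow> 'i \<Rightarrow> real"
  proof -
    have "(\<Prod>i\<in>I. h (f i) i) = h (f t) t * (h (f k) k * (\<Prod>i\<in>I - {t} - {k}. h (f i) i))"
      using I prod.remove[of I t "\<lambda>i. h (f i) i"] prod.remove[of "I - {t}" k "\<lambda>i. h (f i) i"] by simp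
    moreover have "(\<Prod>i\<in>I - {t} - {k}. h (f i) i) = 1"
      using that by (intro prod.neutral) (auto simp: f_def)
    ultimately show ?thesis using I by (simp add: f_def)
  qed
  have eq: "(\<lambda>x. \<Prod>i\<in>I. f i (x i)) = (\<lambda>x. a (x t) * b (x k))"
  proof
    fix x
    show "(\<Prod>i\<in>I. f i (x i)) = a (x t) * b (x k)" by (rule prod[of "\<lambda>g i. g (x i)"]) simp
  qed
  show "integrable (Pi\<^sub>M I (\<lambda>_. N)) (\<lambda>x. a (x t) * b (x k))"
    using product_integrable_prod[OF I(1), of f, OF f] unfolding eq .
  show "(\<integral>x. a (x t) * b (x k) \<partial>Pi\<^sub>M I (\<lambda>_. N)) = integral\<^sup>L N a * integral\<^sup>L N b"
    using product_integral_prod[OF I(1), of f, OF f] unfolding eq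
    using prod[of "\<lambda>g i. integral\<^sup>L N g"] by (simp add: prob_space)
qed

lemma integral_PiM_component:
  fixes a :: "'a \<Rightarrow> real"
  assumes N: "prob_space N" and t: "t \<in> I" and a: "integrable N a"
  shows "integrable (Pi\<^sub>M I (\<lambda>_. N)) (\<lambda>x. a (x t))"
    and "(\<integral>x. a (x t) \<partial>Pi\<^sub>M I (\<lambda>_. N)) = integral\<^sup>L N a"
proof -
  have d: "distr (Pi\<^sub>M I (\<lambda>_. N)) N (\<lambda>\<omega>. \<omega> t) = N"
    using distr_PiM_component[of I "\<lambda>_. N" t] N t by simp
  have m: "(\<lambda>\<omega>. \<omega> t) \<in> measurable (Pi\<^sub>M I (\<lambda>_. N)) N" using t by simp
  show "integrable (Pi\<^sub>M I (\<lambda>_. N)) (\<lambda>x. a (x t))"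
    using integrable_distr[OF m, of a] a d by simp
  show "(\<integral>x. a (x t) \<partial>Pi\<^sub>M I (\<lambda>_. N)) = integral\<^sup>L N a"
    using integral_distr[OF m, of a] a d by simp
qed

lemma random_vector_law_L2vec:
  assumes "random_vector_law d N"
  shows "prob_space N" "L2vec N d (vec d)" "i < d \<Longrightarrow> integrable N (\<lambda>x. x i)"
    "i < d \<Longrightarrow> j < d \<Longrightarrow> integrable N (\<lambda>x. x i * x j)"
proof -
  show N: "prob_space N" using assms by (simp add: random_vector_law_def)
  interpret prob_space N by fact
  have meas: "(\<lambda>x. x i) \<in> borel_measurable N" if "i < d" for i
  proof -
    have "(\<lambda>x. x i) \<in> borel_measurable (Pi\<^sub>M {..<d} (\<lambda>_. borel :: real measure))"
      using that by (intro measurable_component_singleton) auto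
    moreover have "sets N = sets (Pi\<^sub>M {..<d} (\<lambda>_. borel))" using assms by (simp add: random_vector_law_def)
    ultimately show ?thesis using measurable_cong_sets by blast
  qed
  show L2: "L2vec N d (vec d)"
    using assms meas by (auto simp: L2vec_def random_vector_law_def)
  show "integrable N (\<lambda>x. x i)" if "i < d"
    using integrable_mult_of_squares[of "\<lambda>x. x i" N "\<lambda>_. 1"] meas[OF that] assms that
    by (simp add: random_vector_law_def)
  show "integrable N (\<lambda>x. x i * x j)" if "i < d" "j < d"
    using L2vec_prod[OF L2 L2 that] that by simp
qed

section \<open>The state process under a linear policy\<close>

locale lqr_problem =
  fixes L :: lqr_data
  assumes lqr: "lqr L"
begin

abbreviation "T \<equiv> horizon L"
abbreviation "n \<equiv> dimA L"
abbreviation "m \<equiv> dimS L"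
abbreviation "A \<equiv> matA L"
abbreviation "B \<equiv> matB L"
abbreviation "Q \<equiv> costQ L"
abbreviation "R \<equiv> costR L"
abbreviation "\<Omega> \<equiv> sample_space L"
abbreviation "w t \<equiv> (\<lambda>\<omega>. noise L \<omega> t)"
abbreviation "s \<theta> t \<equiv> (\<lambda>\<omega>. state L (lin_policy \<theta>) \<omega> t)"

definition params :: "(nat \<Rightarrow> real mat) \<Rightarrow> bool" where
  "params \<theta> \<longleftrightarrow> (\<forall>t<T. \<theta> t \<in> carrier_mat n m)"

definition F :: "(nat \<Rightarrow> real mat) \<Rightarrow> nat \<Rightarrow> real mat" where
  "F \<theta> t = A + B * \<theta> t"

lemma AB: "A \<in> carrier_mat m m" "B \<in> carrier_mat m n"
  using lqr by (auto simp: lqr_def)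

lemma dims: "m \<ge> 1" "n \<ge> 1" "T \<ge> 1"
  using lqr by (auto simp: lqr_def)

lemma params_carrier: "params \<theta> \<Longrightarrow> t < T \<Longrightarrow> \<theta> t \<in> carrier_mat n m"
  by (simp add: params_def)

lemma F_carrier: "params \<theta> \<Longrightarrow> t < T \<Longrightarrow> F \<theta> t \<in> carrier_mat m m"
  using AB by (auto simp: F_def params_def)

lemma F_mult:
  "params \<theta> \<Longrightarrow> t < T \<Longrightarrow> v \<in> carrier_vec m \<Longrightarrow> F \<theta> t *\<^sub>v v = A *\<^sub>v v + B *\<^sub>v (\<theta> t *\<^sub>v v)"
  using AB add_mult_distrib_mat_vec[of A m m "B * \<theta> t" v]
    assoc_mult_mat_vec[of B m n "\<theta> t" m v] by (auto simp: F_def params_def)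

lemma laws: "random_vector_law m (init_law L)" "random_vector_law m (noise_law L)"
  using lqr by (auto simp: lqr_def)

lemma prob_noise: "prob_space (Pi\<^sub>M {..<T} (\<lambda>_. noise_law L))"
  by (intro prob_space_PiM random_vector_law_L2vec(1)[OF laws(2)])

sublocale noise: prob_space "Pi\<^sub>M {..<T} (\<lambda>_. noise_law L)"
  by (rule prob_noise)

sublocale init: prob_space "init_law L"
  by (rule random_vector_law_L2vec(1)[OF laws(1)])

sublocale init_noise: pair_prob_space "init_law L" "Pi\<^sub>M {..<T} (\<lambda>_. noise_law L)"
  ..

sublocale prob_space \<Omega>
  unfolding sample_space_def by (rule init_noise.prob_space_axioms)

lemma integral_init:
  assumes "integrable (init_law L) f"
  shows "integrable \<Omega> (\<lambda>\<omega>. f (fst \<omega>) :: real)" "(\<integral>\<omega>. f (fst \<omega>) \<partial>\<Omega>) = integral\<^sup>L (init_law L) f"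
  using init_noise.integral_mult_fst_snd[OF assms, of "\<lambda>_. 1"]
  by (simp_all add: sample_space_def noise.prob_space)

lemma integral_noise_path:
  assumes "integrable (Pi\<^sub>M {..<T} (\<lambda>_. noise_law L)) f"
  shows "integrable \<Omega> (\<lambda>\<omega>. f (snd \<omega>) :: real)"
    "(\<integral>\<omega>. f (snd \<omega>) \<partial>\<Omega>) = integral\<^sup>L (Pi\<^sub>M {..<T} (\<lambda>_. noise_law L)) f"
  using init_noise.integral_mult_fst_snd[of "\<lambda>_. 1" f] assms
  by (simp_all add: sample_space_def init.prob_space)

lemma integral_noise:
  assumes "t < T" "integrable (noise_law L) f"
  shows "integrable \<Omega> (\<lambda>\<omega>. f (snd \<omega> t) :: real)" "(\<integral>\<omega>. f (snd \<omega> t) \<partial>\<Omega>) = integral\<^sup>L (noise_law L) f"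
  using integral_PiM_component[OF random_vector_law_L2vec(1)[OF laws(2)], of t "{..<T}" f] assms
    integral_noise_path[of "\<lambda>x. f (x t)"] by auto

lemma state0_L2: "L2vec \<Omega> m (s \<theta> 0)"
  unfolding L2vec_def
proof (intro conjI allI impI)
  fix i assume i: "i < m"
  show "(\<lambda>\<omega>. state L (lin_policy \<theta>) \<omega> 0 $ i) \<in> borel_measurable \<Omega>"
    using integral_init(1)[OF random_vector_law_L2vec(3)[OF laws(1) i]] i by (auto simp: state0_def)
  show "integrable \<Omega> (\<lambda>\<omega>. (state L (lin_policy \<theta>) \<omega> 0 $ i)\<^sup>2)"
    using integral_init(1)[OF random_vector_law_L2vec(4)[OF laws(1) i i]] i
    by (simp add: state0_def power2_eq_square)
qed (simp add: state0_def)

lemma noise_L2: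
  assumes t: "t < T" shows "L2vec \<Omega> m (w t)"
  unfolding L2vec_def
proof (intro conjI allI impI)
  fix i assume i: "i < m"
  show "(\<lambda>\<omega>. noise L \<omega> t $ i) \<in> borel_measurable \<Omega>"
    using integral_noise(1)[OF t random_vector_law_L2vec(3)[OF laws(2) i]] i by (auto simp: noise_def)
  show "integrable \<Omega> (\<lambda>\<omega>. (noise L \<omega> t $ i)\<^sup>2)"
    using integral_noise(1)[OF t random_vector_law_L2vec(4)[OF laws(2) i i]] i
    by (simp add: noise_def power2_eq_square)
qed (simp add: noise_def)

lemma second_moment_state0:
  "second_moment m \<Omega> (s \<theta> 0) = second_moment m (init_law L) (vec m)"
proof (intro eq_matI)
  fix i j assume "i < dim_row (second_moment m (init_law L) (vec m))"
    "j < dim_col (second_moment m (init_law L) (vec m))"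
  then have "i < m" "j < m" by (auto simp: second_moment_def)
  then show "second_moment m \<Omega> (s \<theta> 0) $$ (i, j) = second_moment m (init_law L) (vec m) $$ (i, j)"
    using integral_init(2)[OF random_vector_law_L2vec(4)[OF laws(1), of i j]]
    by (simp add: second_moment_def state0_def)
qed (auto simp: second_moment_def)

lemma second_moment_noise:
  assumes t: "t < T"
  shows "second_moment m \<Omega> (w t) = second_moment m (noise_law L) (vec m)"
proof (intro eq_matI)
  fix i j assume "i < dim_row (second_moment m (noise_law L) (vec m))"
    "j < dim_col (second_moment m (noise_law L) (vec m))"
  then have "i < m" "j < m" by (auto simp: second_moment_def)
  then show "second_moment m \<Omega> (w t) $$ (i, j) = second_moment m (noise_law L) (vec m) $$ (i, j)"
    using integral_noise(2)[OF t random_vector_law_L2vec(4)[OF laws(2), of i j]]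
    by (simp add: second_moment_def noise_def)
qed (auto simp: second_moment_def)

lemma noise_mean_0: "i < m \<Longrightarrow> (\<integral>x. x i \<partial>noise_law L) = 0"
  using lqr by (auto simp: lqr_def)

lemma state0_noise_uncorrelated:
  assumes "t < T" "i < m" "j < m"
  shows "(\<integral>\<omega>. s \<theta> 0 \<omega> $ i * w t \<omega> $ j \<partial>\<Omega>) = 0"
proof -
  have N: "prob_space (noise_law L)" "integrable (noise_law L) (\<lambda>x. x j)"
    using random_vector_law_L2vec(1,3)[OF laws(2)] assms by auto
  have t: "t \<in> {..<T}" using assms by simp
  note c = integral_PiM_component[OF N(1) t N(2)]
  show ?thesis
    using init_noise.integral_mult_fst_snd(2)[OF random_vector_law_L2vec(3)[OF laws(1) assms(2)] c(1)] c(2)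
      noise_mean_0[OF assms(3)] assms
    by (simp add: sample_space_def state0_def noise_def)
qed

lemma noise_uncorrelated:
  assumes "t < T" "k < T" "t \<noteq> k" "i < m" "j < m"
  shows "(\<integral>\<omega>. w t \<omega> $ i * w k \<omega> $ j \<partial>\<Omega>) = 0"
proof -
  have N: "prob_space (noise_law L)" "integrable (noise_law L) (\<lambda>x. x i)" "integrable (noise_law L) (\<lambda>x. x j)"
    using random_vector_law_L2vec(1,3)[OF laws(2)] assms by auto
  note c = integral_PiM_two_components[OF N(1), of "{..<T}" t k, OF _ _ _ assms(3) N(2,3)]
  show ?thesis
    using integral_noise_path(2)[of "\<lambda>x. x t i * x k j"] c noise_mean_0[OF assms(4)] assms
    by (simp add: noise_def)
qed

lemma state_carrier: "params \<theta> \<Longrightarrow> t \<le> T \<Longrightarrow> s \<theta> t \<omega> \<in> carrier_vec m"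
proof (induction t)
  case (Suc t)
  then have "\<theta> t \<in> carrier_mat n m" by (simp add: params_def)
  then show ?case using Suc AB by (auto simp: lin_policy_def noise_def)
qed (simp add: state0_def)

lemma state_Suc:
  assumes "params \<theta>" "t < T"
  shows "s \<theta> (Suc t) \<omega> = F \<theta> t *\<^sub>v s \<theta> t \<omega> + w t \<omega>"
  using F_mult[OF assms state_carrier] assms by (simp add: lin_policy_def)

lemma state_L2: "params \<theta> \<Longrightarrow> t \<le> T \<Longrightarrow> L2vec \<Omega> m (s \<theta> t)"
proof (induction t)
  case (Suc t)
  then have "L2vec \<Omega> m (\<lambda>\<omega>. F \<theta> t *\<^sub>v s \<theta> t \<omega> + w t \<omega>)"
    by (intro L2vec_add L2vec_mult_mat[of _ m] noise_L2 F_carrier) auto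
  then show ?case using state_Suc[of \<theta> t] Suc.prems by simp
qed (rule state0_L2)

text \<open>The state at stage \<open>t\<close> contains only noise from stages before
  \<open>t\<close>. The hypothesis \<open>t \<le> k\<close> keeps the noise of stage
  \<open>k\<close> out of it; the induction adds one earlier noise vector at a time.\<close>

lemma state_noise_uncorrelated:
  "params \<theta> \<Longrightarrow> t \<le> k \<Longrightarrow> k < T \<Longrightarrow> i < m \<Longrightarrow> j < m \<Longrightarrow> (\<integral>\<omega>. s \<theta> t \<omega> $ i * w k \<omega> $ j \<partial>\<Omega>) = 0"
proof (induction t arbitrary: i j)
  case 0
  then show ?case using state0_noise_uncorrelated by simp
next
  case (Suc t)
  have t: "t < T" using Suc by simp
  note X = state_L2[OF Suc.prems(1), of t] and W = noise_L2[OF Suc.prems(3)]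
  have FX: "L2vec \<Omega> m (\<lambda>\<omega>. F \<theta> t *\<^sub>v s \<theta> t \<omega>)"
    using X t by (intro L2vec_mult_mat[of _ m] F_carrier Suc.prems) auto
  have "(\<integral>\<omega>. s \<theta> (Suc t) \<omega> $ i * w k \<omega> $ j \<partial>\<Omega>)
      = (\<integral>\<omega>. (F \<theta> t *\<^sub>v s \<theta> t \<omega>) $ i * w k \<omega> $ j + w t \<omega> $ i * w k \<omega> $ j \<partial>\<Omega>)"
    unfolding state_Suc[OF Suc.prems(1) t] using Suc.prems(4) F_carrier[OF Suc.prems(1) t]
      L2vec_carrier[OF noise_L2[OF t]] by (simp add: distrib_right carrier_vecD[OF L2vec_carrier[OF noise_L2[OF t]]])
  also have "\<dots> = (\<integral>\<omega>. (F \<theta> t *\<^sub>v s \<theta> t \<omega>) $ i * w k \<omega> $ j \<partial>\<Omega>) + (\<integral>\<omega>. w t \<omega> $ i * w k \<omega> $ j \<partial>\<Omega>)"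
    by (intro Bochner_Integration.integral_add L2vec_prod[OF FX W] L2vec_prod[OF noise_L2[OF t] W] Suc.prems)
  also have "(\<integral>\<omega>. (F \<theta> t *\<^sub>v s \<theta> t \<omega>) $ i * w k \<omega> $ j \<partial>\<Omega>) = 0"
    using t Suc by (intro uncorrelated_sprod_mult[OF X W F_carrier]) auto
  also have "(\<integral>\<omega>. w t \<omega> $ i * w k \<omega> $ j \<partial>\<Omega>) = 0"
    using Suc by (intro noise_uncorrelated) auto
  finally show ?case by simp
qed

text \<open>Going one stage forward splits off a noise term that depends on \<open>P\<close> but not
  on the policy. All recursions for expected costs and moments rest on this identity.\<close>

lemma expect_quad_Suc:
  assumes "params \<theta>" "t < T" and P: "P \<in> carrier_mat m m" "transpose_mat P = P"
  shows "(\<integral>\<omega>. s \<theta> (Suc t) \<omega> \<bullet> (P *\<^sub>v s \<theta> (Suc t) \<omega>) \<partial>\<Omega>) =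
    (\<integral>\<omega>. (F \<theta> t *\<^sub>v s \<theta> t \<omega>) \<bullet> (P *\<^sub>v (F \<theta> t *\<^sub>v s \<theta> t \<omega>)) \<partial>\<Omega>) + (\<integral>\<omega>. w t \<omega> \<bullet> (P *\<^sub>v w t \<omega>) \<partial>\<Omega>)"
  unfolding state_Suc[OF assms(1,2)]
proof (rule uncorrelated_quad[OF _ noise_L2[OF assms(2)] P])
  show "L2vec \<Omega> m (\<lambda>\<omega>. F \<theta> t *\<^sub>v s \<theta> t \<omega>)"
    using assms by (intro L2vec_mult_mat[of _ m] F_carrier state_L2) auto
  show "(\<integral>\<omega>. (F \<theta> t *\<^sub>v s \<theta> t \<omega>) $ i * w t \<omega> $ j \<partial>\<Omega>) = 0" if "i < m" "j < m" for i j
    using assms that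
    by (intro uncorrelated_sprod_mult[OF state_L2 noise_L2 F_carrier] state_noise_uncorrelated) auto
qed

end

subsection \<open>Value matrices, performance difference and gradient\<close>

lemma congruence_mat:
  fixes X M :: "real mat"
  assumes X: "X \<in> carrier_mat d e" and M: "M \<in> carrier_mat d d" "transpose_mat M = M"
  shows "transpose_mat X * M * X \<in> carrier_mat e e"
    and "transpose_mat (transpose_mat X * M * X) = transpose_mat X * M * X"
    and "u \<in> carrier_vec e \<Longrightarrow> v \<in> carrier_vec e \<Longrightarrow>
      u \<bullet> ((transpose_mat X * M * X) *\<^sub>v v) = (X *\<^sub>v u) \<bullet> (M *\<^sub>v (X *\<^sub>v v))"
proof -
  have c: "transpose_mat X \<in> carrier_mat e d" "transpose_mat X * M \<in> carrier_mat e d" using X M by auto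
  show "transpose_mat X * M * X \<in> carrier_mat e e" using X c by auto
  show "transpose_mat (transpose_mat X * M * X) = transpose_mat X * M * X"
    using transpose_mult[OF c(2) X] transpose_mult[OF c(1) M(1)] assoc_mult_mat[OF c(1) M(1) X] M(2) by simp
  assume uv: "u \<in> carrier_vec e" "v \<in> carrier_vec e"
  have Xv: "X *\<^sub>v v \<in> carrier_vec d" "M *\<^sub>v (X *\<^sub>v v) \<in> carrier_vec d" using X M uv by auto
  have "(transpose_mat X * M * X) *\<^sub>v v = transpose_mat X *\<^sub>v (M *\<^sub>v (X *\<^sub>v v))"
    using assoc_mult_mat_vec[OF c(2) X uv(2)] assoc_mult_mat_vec[OF c(1) M(1) Xv(1)] by simp
  moreover have "u \<bullet> (transpose_mat X *\<^sub>v (M *\<^sub>v (X *\<^sub>v v))) = (transpose_mat X *\<^sub>v (M *\<^sub>v (X *\<^sub>v v))) \<bullet> u"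
    using uv c Xv by (intro comm_scalar_prod[of _ e]) auto
  moreover have "\<dots> = (M *\<^sub>v (X *\<^sub>v v)) \<bullet> (X *\<^sub>v u)"
    by (rule transpose_vec_mult_scalar[OF X uv(1) Xv(2)])
  moreover have "\<dots> = (X *\<^sub>v u) \<bullet> (M *\<^sub>v (X *\<^sub>v v))"
    using X uv Xv by (intro comm_scalar_prod[of _ d]) auto
  ultimately show "u \<bullet> ((transpose_mat X * M * X) *\<^sub>v v) = (X *\<^sub>v u) \<bullet> (M *\<^sub>v (X *\<^sub>v v))" by simp
qed

text \<open>Each coordinate of \<open>N *\<^sub>v Y \<omega>\<close> is the linear form given by a
  row of \<open>N\<close>, and the squared lengths of the rows add up to the squared Frobenius
  norm.\<close>

lemma L2vec_expect_norm_mult: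
  assumes Y: "L2vec M d Y" and N: "N \<in> carrier_mat n d"
    and c: "\<And>u. u \<in> carrier_vec d \<Longrightarrow> c * (u \<bullet> u) \<le> u \<bullet> (second_moment d M Y *\<^sub>v u)"
  shows "c * (frob_norm N)\<^sup>2 \<le> (\<integral>\<omega>. (N *\<^sub>v Y \<omega>) \<bullet> (N *\<^sub>v Y \<omega>) \<partial>M)"
proof -
  have row: "row N i \<in> carrier_vec d" for i using N by auto
  note NY = L2vec_mult_mat[OF Y N]
  have "(\<integral>\<omega>. (N *\<^sub>v Y \<omega>) \<bullet> (N *\<^sub>v Y \<omega>) \<partial>M) = (\<Sum>i<n. row N i \<bullet> (second_moment d M Y *\<^sub>v row N i))"
    unfolding L2vec_sprod(2)[OF NY NY]
  proof (rule sum.cong[OF refl])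
    fix i assume "i \<in> {..<n}"
    then have "(N *\<^sub>v Y \<omega>) $ i = row N i \<bullet> Y \<omega>" for \<omega> using N by simp
    then show "(\<integral>\<omega>. (N *\<^sub>v Y \<omega>) $ i * (N *\<^sub>v Y \<omega>) $ i \<partial>M) = row N i \<bullet> (second_moment d M Y *\<^sub>v row N i)"
      using L2vec_sprod_const(2)[OF Y row, of i] by (simp add: power2_eq_square)
  qed
  also have "\<dots> \<ge> (\<Sum>i<n. c * (row N i \<bullet> row N i))"
    by (intro sum_mono c row)
  also have "(\<Sum>i<n. c * (row N i \<bullet> row N i)) = c * (frob_norm N)\<^sup>2"
    unfolding frob_norm_square
    using N by (simp add: scalar_prod_lessThan[OF row] sum_distrib_left power2_eq_square)
  finally show ?thesis .
qed

context lqr_problem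
begin

text \<open>The Lyapunov recursion for the cost of a fixed linear policy runs backward in time, so
  it is indexed by the number of remaining stages; \<open>P\<close> converts this to the stage
  index.\<close>

primrec value_to_go :: "(nat \<Rightarrow> real mat) \<Rightarrow> nat \<Rightarrow> real mat" where
  "value_to_go \<theta> 0 = Q T"
| "value_to_go \<theta> (Suc k) =
    Q (T - Suc k) + transpose_mat (\<theta> (T - Suc k)) * R (T - Suc k) * \<theta> (T - Suc k)
    + transpose_mat (F \<theta> (T - Suc k)) * value_to_go \<theta> k * F \<theta> (T - Suc k)"

definition P :: "(nat \<Rightarrow> real mat) \<Rightarrow> nat \<Rightarrow> real mat" where
  "P \<theta> t = value_to_go \<theta> (T - t)"

lemma P_T: "P \<theta> T = Q T"
  by (simp add: P_def)

lemma P_rec: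
  assumes "t < T"
  shows "P \<theta> t = Q t + transpose_mat (\<theta> t) * R t * \<theta> t + transpose_mat (F \<theta> t) * P \<theta> (Suc t) * F \<theta> t"
proof -
  have "T - t = Suc (T - Suc t)" "T - Suc (T - Suc t) = t" using assms by auto
  then show ?thesis by (simp add: P_def)
qed

lemma Q_psd: "t \<le> T \<Longrightarrow> pos_semidef m (Q t)"
  using lqr pos_def_imp_pos_semidef by (cases "t = T") (auto simp: lqr_def)

lemma R_pd: "t < T \<Longrightarrow> pos_def n (R t)"
  using lqr by (auto simp: lqr_def)

lemma Q_sym: "t \<le> T \<Longrightarrow> Q t \<in> carrier_mat m m" "t \<le> T \<Longrightarrow> transpose_mat (Q t) = Q t"
  using Q_psd by (auto simp: pos_semidef_def)

lemma R_sym: "t < T \<Longrightarrow> R t \<in> carrier_mat n n" "t < T \<Longrightarrow> transpose_mat (R t) = R t"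
  using R_pd by (auto simp: pos_def_def)

lemma P_sym:
  assumes \<theta>: "params \<theta>" and t: "t \<le> T"
  shows "P \<theta> t \<in> carrier_mat m m" "transpose_mat (P \<theta> t) = P \<theta> t"
proof -
  have "P \<theta> t \<in> carrier_mat m m \<and> transpose_mat (P \<theta> t) = P \<theta> t"
    using t
  proof (induction t rule: inc_induct)
    case base
    then show ?case using Q_sym[of T] by (simp add: P_T)
  next
    case (step t)
    then have t: "t < T" "t \<le> T" by auto
    note c = congruence_mat[OF params_carrier[OF \<theta> t(1)] R_sym[OF t(1)]]
      congruence_mat[OF F_carrier[OF \<theta> t(1)], of "P \<theta> (Suc t)"]
    show ?case
      using c step.IH Q_sym[OF t(2)]
      by (simp add: P_rec[OF t(1)] transpose_add[of _ m m])
  qed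
  then show "P \<theta> t \<in> carrier_mat m m" "transpose_mat (P \<theta> t) = P \<theta> t" by auto
qed

text \<open>The Bellman equation of a fixed linear policy, with the contribution of the noise left
  out.\<close>

lemma P_quad_rec:
  assumes \<theta>: "params \<theta>" and t: "t < T" and v: "v \<in> carrier_vec m"
  shows "v \<bullet> (P \<theta> t *\<^sub>v v) = v \<bullet> (Q t *\<^sub>v v) + (\<theta> t *\<^sub>v v) \<bullet> (R t *\<^sub>v (\<theta> t *\<^sub>v v))
    + (F \<theta> t *\<^sub>v v) \<bullet> (P \<theta> (Suc t) *\<^sub>v (F \<theta> t *\<^sub>v v))"
proof -
  note P = P_sym[OF \<theta>, of "Suc t"]
  note c = congruence_mat[OF params_carrier[OF \<theta> t] R_sym[OF t]]
      congruence_mat[OF F_carrier[OF \<theta> t] P]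
  let ?X = "transpose_mat (\<theta> t) * R t * \<theta> t" and ?Y = "transpose_mat (F \<theta> t) * P \<theta> (Suc t) * F \<theta> t"
  have Q: "Q t \<in> carrier_mat m m" using Q_sym t by simp
  have Y: "?Y \<in> carrier_mat m m" using c t by simp
  have "P \<theta> t *\<^sub>v v = Q t *\<^sub>v v + ?X *\<^sub>v v + ?Y *\<^sub>v v"
    using c(1) Q Y v add_mult_distrib_mat_vec[of "Q t + ?X" m m ?Y v] add_mult_distrib_mat_vec[of "Q t" m m ?X v]
    by (simp add: P_rec[OF t])
  moreover have "Q t *\<^sub>v v \<in> carrier_vec m" "?X *\<^sub>v v \<in> carrier_vec m" "?Y *\<^sub>v v \<in> carrier_vec m"
    using mult_mat_vec_carrier[OF _ v] Q Y c(1) by blast+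
  ultimately have "v \<bullet> (P \<theta> t *\<^sub>v v) = v \<bullet> (Q t *\<^sub>v v) + v \<bullet> (?X *\<^sub>v v) + v \<bullet> (?Y *\<^sub>v v)"
    using v by (simp add: scalar_prod_add_distrib[of _ m])
  then show ?thesis using c(3)[OF v v] c(6)[OF _ _ v v] t by simp
qed

lemma P_psd:
  assumes \<theta>: "params \<theta>" and t: "t \<le> T"
  shows "pos_semidef m (P \<theta> t)"
  using t
proof (induction t rule: inc_induct)
  case base
  then show ?case using Q_psd[of T] by (simp add: P_T)
next
  case (step t)
  then have t: "t < T" by simp
  have "v \<bullet> (P \<theta> t *\<^sub>v v) \<ge> 0" if v: "v \<in> carrier_vec m" for v
  proof -
    have c: "\<theta> t *\<^sub>v v \<in> carrier_vec n" "F \<theta> t *\<^sub>v v \<in> carrier_vec m"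
      using params_carrier[OF \<theta> t] F_carrier[OF \<theta> t] v by auto
    show ?thesis
      unfolding P_quad_rec[OF \<theta> t v]
      using step.IH Q_psd[of t] pos_def_imp_pos_semidef[OF R_pd[OF t]] t c v
      by (auto simp: pos_semidef_def)
  qed
  then show ?case using P_sym[OF \<theta>, of t] t by (simp add: pos_semidef_def)
qed

text \<open>The state-action value at the state \<open>v\<close> and the action \<open>\<theta> t v\<close> has the gradient \<open>2 E \<theta> t v\<close> in
  the action.\<close>

definition E :: "(nat \<Rightarrow> real mat) \<Rightarrow> nat \<Rightarrow> real mat" where
  "E \<theta> t = R t * \<theta> t + transpose_mat B * P \<theta> (Suc t) * F \<theta> t"

lemma E_carrier: "params \<theta> \<Longrightarrow> t < T \<Longrightarrow> E \<theta> t \<in> carrier_mat n m"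
  using params_carrier[of \<theta> t] R_sym(1)[of t] AB(2) F_carrier[of \<theta> t] P_sym(1)[of \<theta> "Suc t"]
  by (auto simp: E_def)

lemma E_sprod:
  assumes \<theta>: "params \<theta>" and t: "t < T" and v: "v \<in> carrier_vec m" and d: "d \<in> carrier_vec n"
  shows "d \<bullet> (E \<theta> t *\<^sub>v v) = d \<bullet> (R t *\<^sub>v (\<theta> t *\<^sub>v v)) + (B *\<^sub>v d) \<bullet> (P \<theta> (Suc t) *\<^sub>v (F \<theta> t *\<^sub>v v))"
proof -
  note c = params_carrier[OF \<theta> t] R_sym(1)[OF t] AB(2) F_carrier[OF \<theta> t]
  have P: "P \<theta> (Suc t) \<in> carrier_mat m m" using P_sym \<theta> t by simp
  define y where "y = P \<theta> (Suc t) *\<^sub>v (F \<theta> t *\<^sub>v v)"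
  have y: "y \<in> carrier_vec m" using P c v by (auto simp: y_def)
  have BP: "transpose_mat B * P \<theta> (Suc t) \<in> carrier_mat n m" "transpose_mat B \<in> carrier_mat n m"
    using c P by auto
  have Fv: "F \<theta> t *\<^sub>v v \<in> carrier_vec m" using c v by auto
  have "(transpose_mat B * P \<theta> (Suc t) * F \<theta> t) *\<^sub>v v = transpose_mat B *\<^sub>v y"
    using assoc_mult_mat_vec[OF BP(1) c(4) v] assoc_mult_mat_vec[OF BP(2) P Fv] by (simp add: y_def)
  moreover have "(R t * \<theta> t) *\<^sub>v v = R t *\<^sub>v (\<theta> t *\<^sub>v v)"
    using assoc_mult_mat_vec[OF c(2,1) v] .
  ultimately have "E \<theta> t *\<^sub>v v = R t *\<^sub>v (\<theta> t *\<^sub>v v) + transpose_mat B *\<^sub>v y"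
    unfolding E_def using add_mult_distrib_mat_vec[of "R t * \<theta> t" n m _ v] c BP v by simp
  moreover have "d \<bullet> (transpose_mat B *\<^sub>v y) = (B *\<^sub>v d) \<bullet> y"
  proof -
    have "d \<bullet> (transpose_mat B *\<^sub>v y) = (transpose_mat B *\<^sub>v y) \<bullet> d"
      using d y BP by (intro comm_scalar_prod[of _ n]) auto
    also have "\<dots> = y \<bullet> (B *\<^sub>v d)" by (rule transpose_vec_mult_scalar[OF c(3) d y])
    also have "\<dots> = (B *\<^sub>v d) \<bullet> y" using c d y by (intro comm_scalar_prod[of _ m]) auto
    finally show ?thesis .
  qed
  moreover have "R t *\<^sub>v (\<theta> t *\<^sub>v v) \<in> carrier_vec n" "transpose_mat B *\<^sub>v y \<in> carrier_vec n"
    using c BP y v by auto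
  ultimately show ?thesis using d by (simp add: scalar_prod_add_distrib[of _ n] y_def)
qed

lemma closed_loop_change:
  assumes \<theta>: "params \<theta>" "params \<theta>'" and t: "t < T" and v: "v \<in> carrier_vec m"
  shows "\<theta>' t *\<^sub>v v = \<theta> t *\<^sub>v v + (\<theta>' t - \<theta> t) *\<^sub>v v"
    and "F \<theta>' t *\<^sub>v v = F \<theta> t *\<^sub>v v + B *\<^sub>v ((\<theta>' t - \<theta> t) *\<^sub>v v)"
proof -
  note c = params_carrier[OF \<theta>(1) t] params_carrier[OF \<theta>(2) t]
  have "\<theta>' t = \<theta> t + (\<theta>' t - \<theta> t)" using c by (intro eq_matI) auto
  then show 1: "\<theta>' t *\<^sub>v v = \<theta> t *\<^sub>v v + (\<theta>' t - \<theta> t) *\<^sub>v v"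
    using add_mult_distrib_mat_vec[of "\<theta> t" n m "\<theta>' t - \<theta> t" v] c v
    by (metis minus_carrier_mat)
  have "\<theta>' t - \<theta> t \<in> carrier_mat n m" using c by auto
  then have "\<theta> t *\<^sub>v v \<in> carrier_vec n" "(\<theta>' t - \<theta> t) *\<^sub>v v \<in> carrier_vec n" using c v by auto
  moreover have "A *\<^sub>v v \<in> carrier_vec m" using AB v by auto
  ultimately show "F \<theta>' t *\<^sub>v v = F \<theta> t *\<^sub>v v + B *\<^sub>v ((\<theta>' t - \<theta> t) *\<^sub>v v)"
    using AB v F_mult[OF \<theta>(1) t v] F_mult[OF \<theta>(2) t v]
    by (simp add: 1 mult_add_distrib_mat_vec[OF AB(2)] assoc_add_vec[of _ m])
qed

text \<open>The state-action value of \<open>\<theta>\<close> is expanded around its own action,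
  \<open>d\<close> being the deviation of the action of \<theta>'. The linear part is given by
  \<open>E\<close>, the quadratic part by \<open>R\<close> and the next value matrix, and the last
  bracket is the same difference one stage later, at the successor under \<theta>'.\<close>

lemma P_quad_diff:
  assumes \<theta>: "params \<theta>" "params \<theta>'" and t: "t < T" and v: "v \<in> carrier_vec m"
    and d_def: "d = (\<theta>' t - \<theta> t) *\<^sub>v v"
  shows "v \<bullet> (P \<theta>' t *\<^sub>v v) - v \<bullet> (P \<theta> t *\<^sub>v v) =
    2 * (d \<bullet> (E \<theta> t *\<^sub>v v)) + (d \<bullet> (R t *\<^sub>v d) + (B *\<^sub>v d) \<bullet> (P \<theta> (Suc t) *\<^sub>v (B *\<^sub>v d)))
    + ((F \<theta>' t *\<^sub>v v) \<bullet> (P \<theta>' (Suc t) *\<^sub>v (F \<theta>' t *\<^sub>v v)) - (F \<theta>' t *\<^sub>v v) \<bullet> (P \<theta> (Suc t) *\<^sub>v (F \<theta>' t *\<^sub>v v)))"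
proof -
  note c = params_carrier[OF \<theta>(1) t] params_carrier[OF \<theta>(2) t]
  have "\<theta>' t - \<theta> t \<in> carrier_mat n m" using c by auto
  then have d: "d \<in> carrier_vec n" using v by (auto simp: d_def)
  have a: "\<theta> t *\<^sub>v v \<in> carrier_vec n" and f: "F \<theta> t *\<^sub>v v \<in> carrier_vec m" and b: "B *\<^sub>v d \<in> carrier_vec m"
    using c v d F_carrier[OF \<theta>(1) t] AB by auto
  note ch = closed_loop_change[OF \<theta> t v, folded d_def]
  have P: "P \<theta> (Suc t) \<in> carrier_mat m m" "transpose_mat (P \<theta> (Suc t)) = P \<theta> (Suc t)"
    using P_sym \<theta> t by auto
  have "(\<theta>' t *\<^sub>v v) \<bullet> (R t *\<^sub>v (\<theta>' t *\<^sub>v v)) = (\<theta> t *\<^sub>v v) \<bullet> (R t *\<^sub>v (\<theta> t *\<^sub>v v))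
      + 2 * (d \<bullet> (R t *\<^sub>v (\<theta> t *\<^sub>v v))) + d \<bullet> (R t *\<^sub>v d)"
    unfolding ch by (rule quad_add[OF R_sym(1)[OF t] R_sym(2)[OF t] a d])
  moreover have "(F \<theta>' t *\<^sub>v v) \<bullet> (P \<theta> (Suc t) *\<^sub>v (F \<theta>' t *\<^sub>v v)) = (F \<theta> t *\<^sub>v v) \<bullet> (P \<theta> (Suc t) *\<^sub>v (F \<theta> t *\<^sub>v v))
      + 2 * ((B *\<^sub>v d) \<bullet> (P \<theta> (Suc t) *\<^sub>v (F \<theta> t *\<^sub>v v))) + (B *\<^sub>v d) \<bullet> (P \<theta> (Suc t) *\<^sub>v (B *\<^sub>v d))"
    unfolding ch by (rule quad_add[OF P f b])
  ultimately show ?thesis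
    using P_quad_rec[OF \<theta>(1) t v] P_quad_rec[OF \<theta>(2) t v] E_sprod[OF \<theta>(1) t v d] by simp
qed

section \<open>One-stage changes and the performance difference\<close>

text \<open>Here \<theta> supplies the values and \<theta>' the states. The matrix \<open>N\<close>
  is left free: it is the parameter difference in \<open>performance_difference\<close> and a
  perturbation direction in the computation of the gradient.\<close>

definition stage_lin :: "(nat \<Rightarrow> real mat) \<Rightarrow> (nat \<Rightarrow> real mat) \<Rightarrow> nat \<Rightarrow> real mat \<Rightarrow> real" where
  "stage_lin \<theta> \<theta>' t N = (\<integral>\<omega>. (N *\<^sub>v s \<theta>' t \<omega>) \<bullet> (E \<theta> t *\<^sub>v s \<theta>' t \<omega>) \<partial>\<Omega>)"

definition stage_quad :: "(nat \<Rightarrow> real mat) \<Rightarrow> (nat \<Rightarrow> real mat) \<Rightarrow> nat \<Rightarrow> real mat \<Rightarrow> real" where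
  "stage_quad \<theta> \<theta>' t N = (\<integral>\<omega>. (N *\<^sub>v s \<theta>' t \<omega>) \<bullet> (R t *\<^sub>v (N *\<^sub>v s \<theta>' t \<omega>))
    + (B *\<^sub>v (N *\<^sub>v s \<theta>' t \<omega>)) \<bullet> (P \<theta> (Suc t) *\<^sub>v (B *\<^sub>v (N *\<^sub>v s \<theta>' t \<omega>))) \<partial>\<Omega>)"

lemma stage_integrable:
  assumes \<theta>: "params \<theta>" "params \<theta>'" and t: "t < T" and N: "N \<in> carrier_mat n m"
  shows "integrable \<Omega> (\<lambda>\<omega>. (N *\<^sub>v s \<theta>' t \<omega>) \<bullet> (E \<theta> t *\<^sub>v s \<theta>' t \<omega>))"
    and "integrable \<Omega> (\<lambda>\<omega>. (N *\<^sub>v s \<theta>' t \<omega>) \<bullet> (R t *\<^sub>v (N *\<^sub>v s \<theta>' t \<omega>)))"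
    and "integrable \<Omega> (\<lambda>\<omega>. (B *\<^sub>v (N *\<^sub>v s \<theta>' t \<omega>)) \<bullet> (P \<theta> (Suc t) *\<^sub>v (B *\<^sub>v (N *\<^sub>v s \<theta>' t \<omega>))))"
proof -
  have P: "P \<theta> (Suc t) \<in> carrier_mat m m" using P_sym \<theta> t by simp
  have X: "L2vec \<Omega> m (s \<theta>' t)" using state_L2 \<theta> t by simp
  note c = X N P AB E_carrier[OF \<theta>(1) t] R_sym(1)[OF t]
  show "integrable \<Omega> (\<lambda>\<omega>. (N *\<^sub>v s \<theta>' t \<omega>) \<bullet> (E \<theta> t *\<^sub>v s \<theta>' t \<omega>))"
    "integrable \<Omega> (\<lambda>\<omega>. (N *\<^sub>v s \<theta>' t \<omega>) \<bullet> (R t *\<^sub>v (N *\<^sub>v s \<theta>' t \<omega>)))"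
    "integrable \<Omega> (\<lambda>\<omega>. (B *\<^sub>v (N *\<^sub>v s \<theta>' t \<omega>)) \<bullet> (P \<theta> (Suc t) *\<^sub>v (B *\<^sub>v (N *\<^sub>v s \<theta>' t \<omega>))))"
    by (rule c L2vec_sprod(1) L2vec_mult_mat)+
qed

lemma quad_integrable:
  assumes "L2vec \<Omega> d Y" "M \<in> carrier_mat d d"
  shows "integrable \<Omega> (\<lambda>\<omega>. Y \<omega> \<bullet> (M *\<^sub>v Y \<omega>))"
  by (rule assms L2vec_sprod(1) L2vec_mult_mat)+

lemma cost_integrable:
  assumes \<theta>: "params \<theta>"
  shows "t \<le> T \<Longrightarrow> integrable \<Omega> (\<lambda>\<omega>. s \<theta> t \<omega> \<bullet> (Q t *\<^sub>v s \<theta> t \<omega>))"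
    and "t < T \<Longrightarrow> integrable \<Omega> (\<lambda>\<omega>. (\<theta> t *\<^sub>v s \<theta> t \<omega>) \<bullet> (R t *\<^sub>v (\<theta> t *\<^sub>v s \<theta> t \<omega>)))"
  using quad_integrable[OF state_L2[OF \<theta>] Q_sym(1)] less_imp_le
    quad_integrable[OF L2vec_mult_mat[OF state_L2[OF \<theta>] params_carrier[OF \<theta>]] R_sym(1)] by auto

lemma total_cost_lin:
  "total_cost L (lin_policy \<theta>) \<omega> =
    (\<Sum>t<T. s \<theta> t \<omega> \<bullet> (Q t *\<^sub>v s \<theta> t \<omega>) + (\<theta> t *\<^sub>v s \<theta> t \<omega>) \<bullet> (R t *\<^sub>v (\<theta> t *\<^sub>v s \<theta> t \<omega>)))
    + s \<theta> T \<omega> \<bullet> (Q T *\<^sub>v s \<theta> T \<omega>)"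
  by (simp add: total_cost_def Let_def lin_policy_def)

lemma total_cost_integrable:
  assumes \<theta>: "params \<theta>"
  shows "integrable \<Omega> (\<lambda>\<omega>. total_cost L (lin_policy \<theta>) \<omega>)"
  unfolding total_cost_lin
  by (intro Bochner_Integration.integrable_add Bochner_Integration.integrable_sum cost_integrable[OF \<theta>]) auto

lemma total_cost_nonneg:
  assumes \<theta>: "params \<theta>"
  shows "total_cost L (lin_policy \<theta>) \<omega> \<ge> 0"
  unfolding total_cost_lin
proof (intro add_nonneg_nonneg sum_nonneg)
  show "0 \<le> s \<theta> T \<omega> \<bullet> (Q T *\<^sub>v s \<theta> T \<omega>)"
    using Q_psd[of T] state_carrier[OF \<theta>, of T] by (auto simp: pos_semidef_def)
  fix t assume "t \<in> {..<T}"
  then have t: "t < T" "t \<le> T" by auto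
  show "0 \<le> s \<theta> t \<omega> \<bullet> (Q t *\<^sub>v s \<theta> t \<omega>)"
    using Q_psd[OF t(2)] state_carrier[OF \<theta> t(2)] by (auto simp: pos_semidef_def)
  have "\<theta> t *\<^sub>v s \<theta> t \<omega> \<in> carrier_vec n"
    using params_carrier[OF \<theta> t(1)] state_carrier[OF \<theta> t(2)] by auto
  then show "0 \<le> (\<theta> t *\<^sub>v s \<theta> t \<omega>) \<bullet> (R t *\<^sub>v (\<theta> t *\<^sub>v s \<theta> t \<omega>))"
    using pos_def_imp_pos_semidef[OF R_pd[OF t(1)]] by (auto simp: pos_semidef_def)
qed

lemma objective_eq:
  assumes \<theta>: "params \<theta>"
  shows "objective L \<theta> =
    (\<Sum>t<T. (\<integral>\<omega>. s \<theta> t \<omega> \<bullet> (Q t *\<^sub>v s \<theta> t \<omega>) \<partial>\<Omega>)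
       + (\<integral>\<omega>. (\<theta> t *\<^sub>v s \<theta> t \<omega>) \<bullet> (R t *\<^sub>v (\<theta> t *\<^sub>v s \<theta> t \<omega>)) \<partial>\<Omega>))
    + (\<integral>\<omega>. s \<theta> T \<omega> \<bullet> (Q T *\<^sub>v s \<theta> T \<omega>) \<partial>\<Omega>)"
proof -
  note c = cost_integrable[OF \<theta>]
  have "objective L \<theta> = (\<integral>\<omega>. (\<Sum>t<T. s \<theta> t \<omega> \<bullet> (Q t *\<^sub>v s \<theta> t \<omega>) + (\<theta> t *\<^sub>v s \<theta> t \<omega>) \<bullet> (R t *\<^sub>v (\<theta> t *\<^sub>v s \<theta> t \<omega>))) \<partial>\<Omega>)
    + (\<integral>\<omega>. s \<theta> T \<omega> \<bullet> (Q T *\<^sub>v s \<theta> T \<omega>) \<partial>\<Omega>)"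
    unfolding objective_def total_cost_lin
    by (intro Bochner_Integration.integral_add Bochner_Integration.integrable_add Bochner_Integration.integrable_sum c) auto
  also have "(\<integral>\<omega>. (\<Sum>t<T. s \<theta> t \<omega> \<bullet> (Q t *\<^sub>v s \<theta> t \<omega>) + (\<theta> t *\<^sub>v s \<theta> t \<omega>) \<bullet> (R t *\<^sub>v (\<theta> t *\<^sub>v s \<theta> t \<omega>))) \<partial>\<Omega>) =
     (\<Sum>t<T. \<integral>\<omega>. s \<theta> t \<omega> \<bullet> (Q t *\<^sub>v s \<theta> t \<omega>) + (\<theta> t *\<^sub>v s \<theta> t \<omega>) \<bullet> (R t *\<^sub>v (\<theta> t *\<^sub>v s \<theta> t \<omega>)) \<partial>\<Omega>)"
    by (intro Bochner_Integration.integral_sum Bochner_Integration.integrable_add c) auto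
  also have "\<dots> = (\<Sum>t<T. (\<integral>\<omega>. s \<theta> t \<omega> \<bullet> (Q t *\<^sub>v s \<theta> t \<omega>) \<partial>\<Omega>)
       + (\<integral>\<omega>. (\<theta> t *\<^sub>v s \<theta> t \<omega>) \<bullet> (R t *\<^sub>v (\<theta> t *\<^sub>v s \<theta> t \<omega>)) \<partial>\<Omega>))"
    by (intro sum.cong refl Bochner_Integration.integral_add c) auto
  finally show ?thesis .
qed

text \<open>Values of one policy averaged over the states of another. For equal arguments it is the
  expected cost from stage \<open>t\<close> on, short of the contribution of the noise from stage
  \<open>t\<close> on.\<close>

definition V :: "(nat \<Rightarrow> real mat) \<Rightarrow> (nat \<Rightarrow> real mat) \<Rightarrow> nat \<Rightarrow> real" where
  "V \<theta> \<theta>' t = (\<integral>\<omega>. s \<theta>' t \<omega> \<bullet> (P \<theta> t *\<^sub>v s \<theta>' t \<omega>) \<partial>\<Omega>)"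

definition noise_cost :: "(nat \<Rightarrow> real mat) \<Rightarrow> nat \<Rightarrow> real" where
  "noise_cost \<theta> t = (\<integral>\<omega>. w t \<omega> \<bullet> (P \<theta> (Suc t) *\<^sub>v w t \<omega>) \<partial>\<Omega>)"

lemma V_Suc:
  assumes \<theta>: "params \<theta>" "params \<theta>'" and t: "t < T"
  shows "V \<theta> \<theta>' (Suc t) = (\<integral>\<omega>. (F \<theta>' t *\<^sub>v s \<theta>' t \<omega>) \<bullet> (P \<theta> (Suc t) *\<^sub>v (F \<theta>' t *\<^sub>v s \<theta>' t \<omega>)) \<partial>\<Omega>)
     + noise_cost \<theta> t"
  unfolding V_def noise_cost_def using assms by (intro expect_quad_Suc P_sym) auto

lemma closed_loop_integrable:
  assumes \<theta>: "params \<theta>" "params \<theta>'" and t: "t < T"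
  shows "integrable \<Omega> (\<lambda>\<omega>. (F \<theta>' t *\<^sub>v s \<theta>' t \<omega>) \<bullet> (P \<theta> (Suc t) *\<^sub>v (F \<theta>' t *\<^sub>v s \<theta>' t \<omega>)))"
  using assms by (intro quad_integrable[of m] L2vec_mult_mat[of _ m] state_L2 F_carrier P_sym) auto

text \<open>The expected stage costs telescope by the Bellman equation, except that each transition
  leaves a \<open>noise_cost\<close>.\<close>

lemma objective_value:
  assumes \<theta>: "params \<theta>"
  shows "objective L \<theta> = V \<theta> \<theta> 0 + (\<Sum>t<T. noise_cost \<theta> t)"
proof -
  let ?c = "\<lambda>t. (\<integral>\<omega>. s \<theta> t \<omega> \<bullet> (Q t *\<^sub>v s \<theta> t \<omega>) \<partial>\<Omega>)
       + (\<integral>\<omega>. (\<theta> t *\<^sub>v s \<theta> t \<omega>) \<bullet> (R t *\<^sub>v (\<theta> t *\<^sub>v s \<theta> t \<omega>)) \<partial>\<Omega>)"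
  have "?c t = (V \<theta> \<theta> t - V \<theta> \<theta> (Suc t)) + noise_cost \<theta> t" if t: "t < T" for t
  proof -
    have "V \<theta> \<theta> t = ?c t + (\<integral>\<omega>. (F \<theta> t *\<^sub>v s \<theta> t \<omega>) \<bullet> (P \<theta> (Suc t) *\<^sub>v (F \<theta> t *\<^sub>v s \<theta> t \<omega>)) \<partial>\<Omega>)"
      unfolding V_def
      using P_quad_rec[OF \<theta> t state_carrier[OF \<theta>]] cost_integrable[OF \<theta>, of t] closed_loop_integrable[OF \<theta> \<theta> t] t
      by simp
    then show ?thesis using V_Suc[OF \<theta> \<theta> t] by simp
  qed
  then have "(\<Sum>t<T. ?c t) = (\<Sum>t<T. V \<theta> \<theta> t - V \<theta> \<theta> (Suc t)) + (\<Sum>t<T. noise_cost \<theta> t)"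
    by (simp add: sum.distrib)
  also have "(\<Sum>t<T. V \<theta> \<theta> t - V \<theta> \<theta> (Suc t)) = V \<theta> \<theta> 0 - V \<theta> \<theta> T"
    by (rule sum_lessThan_telescope')
  finally show ?thesis unfolding objective_eq[OF \<theta>] by (simp add: V_def P_T)
qed

lemma V_diff_step:
  assumes \<theta>: "params \<theta>" "params \<theta>'" and t: "t < T"
  shows "V \<theta>' \<theta>' t - V \<theta> \<theta>' t = 2 * stage_lin \<theta> \<theta>' t (\<theta>' t - \<theta> t) + stage_quad \<theta> \<theta>' t (\<theta>' t - \<theta> t)
    + ((\<integral>\<omega>. (F \<theta>' t *\<^sub>v s \<theta>' t \<omega>) \<bullet> (P \<theta>' (Suc t) *\<^sub>v (F \<theta>' t *\<^sub>v s \<theta>' t \<omega>)) \<partial>\<Omega>)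
     - (\<integral>\<omega>. (F \<theta>' t *\<^sub>v s \<theta>' t \<omega>) \<bullet> (P \<theta> (Suc t) *\<^sub>v (F \<theta>' t *\<^sub>v s \<theta>' t \<omega>)) \<partial>\<Omega>))"
proof -
  have D: "\<theta>' t - \<theta> t \<in> carrier_mat n m"
    using params_carrier[OF \<theta>(1) t] params_carrier[OF \<theta>(2) t] by auto
  note i = stage_integrable[OF \<theta> t D] closed_loop_integrable[OF \<theta>(1,2) t] closed_loop_integrable[OF \<theta>(2,2) t]
  have X: "s \<theta>' t \<omega> \<in> carrier_vec m" for \<omega> using state_carrier \<theta> t by simp
  have iV: "integrable \<Omega> (\<lambda>\<omega>. s \<theta>' t \<omega> \<bullet> (P \<theta>' t *\<^sub>v s \<theta>' t \<omega>))" "integrable \<Omega> (\<lambda>\<omega>. s \<theta>' t \<omega> \<bullet> (P \<theta> t *\<^sub>v s \<theta>' t \<omega>))"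
    using \<theta> t by (auto intro!: quad_integrable[of m] state_L2 P_sym)
  have "V \<theta>' \<theta>' t - V \<theta> \<theta>' t = (\<integral>\<omega>. s \<theta>' t \<omega> \<bullet> (P \<theta>' t *\<^sub>v s \<theta>' t \<omega>) - s \<theta>' t \<omega> \<bullet> (P \<theta> t *\<^sub>v s \<theta>' t \<omega>) \<partial>\<Omega>)"
    using iV by (simp add: V_def)
  then show ?thesis
    unfolding P_quad_diff[OF \<theta> t X refl] stage_lin_def stage_quad_def using i by simp
qed

text \<open>The differences \<open>U t\<close> telescope and end at zero, because both policies
  share the terminal matrix \<open>Q T\<close>. The noise costs correct for the noiseless successor
  in \<open>V_diff_step\<close>. The identity is exact, with all states generated by
  \<theta>'.\<close>

lemma performance_difference:
  assumes \<theta>: "params \<theta>" "params \<theta>'"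
  shows "objective L \<theta>' - objective L \<theta> =
    (\<Sum>t<T. 2 * stage_lin \<theta> \<theta>' t (\<theta>' t - \<theta> t) + stage_quad \<theta> \<theta>' t (\<theta>' t - \<theta> t))"
proof -
  define U where "U t = V \<theta>' \<theta>' t - V \<theta> \<theta>' t" for t
  have "2 * stage_lin \<theta> \<theta>' t (\<theta>' t - \<theta> t) + stage_quad \<theta> \<theta>' t (\<theta>' t - \<theta> t)
      = (U t - U (Suc t)) + (noise_cost \<theta>' t - noise_cost \<theta> t)" if "t < T" for t
    using V_diff_step[OF \<theta> that] V_Suc[OF \<theta>(1,2) that] V_Suc[OF \<theta>(2,2) that] by (simp add: U_def)
  then have "(\<Sum>t<T. 2 * stage_lin \<theta> \<theta>' t (\<theta>' t - \<theta> t) + stage_quad \<theta> \<theta>' t (\<theta>' t - \<theta> t))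
     = (\<Sum>t<T. U t - U (Suc t)) + (\<Sum>t<T. noise_cost \<theta>' t - noise_cost \<theta> t)"
    by (simp add: sum.distrib)
  also have "(\<Sum>t<T. U t - U (Suc t)) = U 0 - U T"
    by (rule sum_lessThan_telescope')
  also have "U T = 0" by (simp add: U_def V_def P_T)
  finally show ?thesis
    by (simp add: objective_value \<theta> U_def V_def sum_subtractf)
qed

section \<open>Perturbation of a single stage and the gradient\<close>

lemma state_cong: "(\<And>k. k < t \<Longrightarrow> \<theta> k = \<theta>' k) \<Longrightarrow> s \<theta> t \<omega> = s \<theta>' t \<omega>"
  by (induction t) (auto simp: lin_policy_def)

lemma stage_zero:
  assumes \<theta>: "params \<theta>" "params \<theta>'" and t: "t < T"
  shows "stage_lin \<theta> \<theta>' t (0\<^sub>m n m) = 0" "stage_quad \<theta> \<theta>' t (0\<^sub>m n m) = 0"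
proof -
  have X: "s \<theta>' t \<omega> \<in> carrier_vec m" for \<omega> using state_carrier \<theta> t by simp
  have 0: "0\<^sub>m n m *\<^sub>v s \<theta>' t \<omega> = 0\<^sub>v n" for \<omega> using X[of \<omega>] by (intro eq_vecI) auto
  have B0: "B *\<^sub>v 0\<^sub>v n = 0\<^sub>v m" using AB by (intro eq_vecI) auto
  have "E \<theta> t *\<^sub>v s \<theta>' t \<omega> \<in> carrier_vec n" for \<omega> using E_carrier[OF \<theta>(1) t] X by auto
  then show "stage_lin \<theta> \<theta>' t (0\<^sub>m n m) = 0" by (simp add: stage_lin_def 0)
  have "R t *\<^sub>v 0\<^sub>v n \<in> carrier_vec n" "P \<theta> (Suc t) *\<^sub>v 0\<^sub>v m \<in> carrier_vec m"
    using R_sym(1)[OF t] P_sym(1)[OF \<theta>(1), of "Suc t"] t by auto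
  then show "stage_quad \<theta> \<theta>' t (0\<^sub>m n m) = 0" by (simp add: stage_quad_def 0 B0)
qed

text \<open>Changing one stage leaves the states up to that stage unchanged and makes every other
  term of the performance difference vanish. Hence the objective is exactly quadratic in a
  perturbation of one stage.\<close>

lemma objective_perturb:
  assumes \<theta>: "params \<theta>" and t: "t < T" and N: "N \<in> carrier_mat n m"
  shows "objective L (\<theta>(t := \<theta> t + N)) = objective L \<theta> + 2 * stage_lin \<theta> \<theta> t N + stage_quad \<theta> \<theta> t N"
proof -
  define \<theta>' where "\<theta>' = \<theta>(t := \<theta> t + N)"
  have \<theta>': "params \<theta>'" using \<theta> N by (auto simp: params_def \<theta>'_def)
  have eq: "s \<theta>' t \<omega> = s \<theta> t \<omega>" for \<omega> by (rule state_cong) (simp add: \<theta>'_def)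
  have D: "\<theta>' t - \<theta> t = N" using N params_carrier[OF \<theta> t] by (auto simp: \<theta>'_def intro!: eq_matI)
  have "objective L \<theta>' - objective L \<theta> = (\<Sum>k<T. if k = t then 2 * stage_lin \<theta> \<theta>' t N + stage_quad \<theta> \<theta>' t N else 0)"
    unfolding performance_difference[OF \<theta> \<theta>']
  proof (rule sum.cong[OF refl])
    fix k assume "k \<in> {..<T}"
    then have k: "k < T" by simp
    have "\<theta>' k - \<theta> k = 0\<^sub>m n m" if "k \<noteq> t"
      using that params_carrier[OF \<theta> k] by (auto simp: \<theta>'_def)
    then show "2 * stage_lin \<theta> \<theta>' k (\<theta>' k - \<theta> k) + stage_quad \<theta> \<theta>' k (\<theta>' k - \<theta> k) =
      (if k = t then 2 * stage_lin \<theta> \<theta>' t N + stage_quad \<theta> \<theta>' t N else 0)"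
      using stage_zero[OF \<theta> \<theta>' k] D by auto
  qed
  then show ?thesis using t by (simp add: \<theta>'_def[symmetric] stage_lin_def stage_quad_def eq)
qed

lemma stage_smult:
  assumes \<theta>: "params \<theta>" "params \<theta>'" and t: "t < T" and N: "N \<in> carrier_mat n m"
  shows "stage_lin \<theta> \<theta>' t (x \<cdot>\<^sub>m N) = x * stage_lin \<theta> \<theta>' t N"
    "stage_quad \<theta> \<theta>' t (x \<cdot>\<^sub>m N) = x\<^sup>2 * stage_quad \<theta> \<theta>' t N"
proof -
  have X: "s \<theta>' t \<omega> \<in> carrier_vec m" for \<omega> using state_carrier \<theta> t by simp
  have NX: "N *\<^sub>v s \<theta>' t \<omega> \<in> carrier_vec n" for \<omega> using N X by auto
  have BNX: "B *\<^sub>v (N *\<^sub>v s \<theta>' t \<omega>) \<in> carrier_vec m" for \<omega> using NX AB by auto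
  have EX: "E \<theta> t *\<^sub>v s \<theta>' t \<omega> \<in> carrier_vec n" for \<omega> using E_carrier[OF \<theta>(1) t] X by auto
  have 1: "(x \<cdot>\<^sub>m N) *\<^sub>v s \<theta>' t \<omega> = x \<cdot>\<^sub>v (N *\<^sub>v s \<theta>' t \<omega>)" for \<omega>
    using N X[of \<omega>] by (intro eq_vecI) auto
  have P: "P \<theta> (Suc t) \<in> carrier_mat m m" using P_sym \<theta> t by simp
  show "stage_lin \<theta> \<theta>' t (x \<cdot>\<^sub>m N) = x * stage_lin \<theta> \<theta>' t N"
    unfolding stage_lin_def 1 using smult_scalar_prod_distrib[OF NX EX] by simp
  show "stage_quad \<theta> \<theta>' t (x \<cdot>\<^sub>m N) = x\<^sup>2 * stage_quad \<theta> \<theta>' t N"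
    unfolding stage_quad_def 1 mult_mat_vec[OF AB(2) NX] quad_smult[OF P BNX] quad_smult[OF R_sym(1)[OF t] NX]
    by (simp flip: distrib_left)
qed

lemma stage_lin_entries:
  assumes \<theta>: "params \<theta>" "params \<theta>'" and t: "t < T" and N: "N \<in> carrier_mat n m"
  shows "stage_lin \<theta> \<theta>' t N =
    (\<Sum>i<n. \<Sum>j<m. N $$ (i, j) * (\<integral>\<omega>. s \<theta>' t \<omega> $ j * (E \<theta> t *\<^sub>v s \<theta>' t \<omega>) $ i \<partial>\<Omega>))"
proof -
  have X: "L2vec \<Omega> m (s \<theta>' t)" using state_L2 \<theta> t by simp
  note NX = L2vec_mult_mat[OF X N] and EX = L2vec_mult_mat[OF X E_carrier[OF \<theta>(1) t]]
  show ?thesis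
    unfolding stage_lin_def L2vec_sprod(2)[OF NX EX]
  proof (rule sum.cong[OF refl])
    fix i assume "i \<in> {..<n}"
    then have i: "i < n" by simp
    have "(\<integral>\<omega>. (N *\<^sub>v s \<theta>' t \<omega>) $ i * (E \<theta> t *\<^sub>v s \<theta>' t \<omega>) $ i \<partial>\<Omega>) =
      (\<integral>\<omega>. (\<Sum>j<m. N $$ (i, j) * (s \<theta>' t \<omega> $ j * (E \<theta> t *\<^sub>v s \<theta>' t \<omega>) $ i)) \<partial>\<Omega>)"
      unfolding mult_mat_vec_index_lessThan[OF N L2vec_carrier[OF X] i] sum_distrib_right
      by (simp only: mult.assoc)
    also have "\<dots> = (\<Sum>j<m. \<integral>\<omega>. N $$ (i, j) * (s \<theta>' t \<omega> $ j * (E \<theta> t *\<^sub>v s \<theta>' t \<omega>) $ i) \<partial>\<Omega>)"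
      by (intro Bochner_Integration.integral_sum integrable_mult_right L2vec_prod[OF X EX] i) auto
    finally show "(\<integral>\<omega>. (N *\<^sub>v s \<theta>' t \<omega>) $ i * (E \<theta> t *\<^sub>v s \<theta>' t \<omega>) $ i \<partial>\<Omega>) =
      (\<Sum>j<m. N $$ (i, j) * (\<integral>\<omega>. s \<theta>' t \<omega> $ j * (E \<theta> t *\<^sub>v s \<theta>' t \<omega>) $ i \<partial>\<Omega>))" by simp
  qed
qed

text \<open>Along a coordinate direction the objective is a quadratic polynomial in the step
  \<open>x\<close>, so the derivative exists and is its linear coefficient.\<close>

lemma grad_entry:
  assumes \<theta>: "params \<theta>" and t: "t < T" and ij: "i < n" "j < m"
  shows "grad L \<theta> t $$ (i, j) = 2 * (\<integral>\<omega>. s \<theta> t \<omega> $ j * (E \<theta> t *\<^sub>v s \<theta> t \<omega>) $ i \<partial>\<Omega>)"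
proof -
  define N where "N = mat n m (\<lambda>p. if p = (i, j) then 1 else (0::real))"
  have N: "N \<in> carrier_mat n m" by (simp add: N_def)
  have eq: "mat n m (\<lambda>p. if p = (i, j) then x else 0) = x \<cdot>\<^sub>m N" for x
    by (intro eq_matI) (auto simp: N_def)
  have "stage_lin \<theta> \<theta> t N =
    (\<Sum>a<n. \<Sum>b<m. if b = j then if a = i then (\<integral>\<omega>. s \<theta> t \<omega> $ b * (E \<theta> t *\<^sub>v s \<theta> t \<omega>) $ a \<partial>\<Omega>) else 0 else 0)"
    unfolding stage_lin_entries[OF \<theta> \<theta> t N] by (intro sum.cong refl) (auto simp: N_def)
  also have "\<dots> = (\<integral>\<omega>. s \<theta> t \<omega> $ j * (E \<theta> t *\<^sub>v s \<theta> t \<omega>) $ i \<partial>\<Omega>)"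
    using ij by simp
  finally have lin: "stage_lin \<theta> \<theta> t N = (\<integral>\<omega>. s \<theta> t \<omega> $ j * (E \<theta> t *\<^sub>v s \<theta> t \<omega>) $ i \<partial>\<Omega>)" .
  have obj: "objective L (\<theta>(t := \<theta> t + x \<cdot>\<^sub>m N)) =
      objective L \<theta> + 2 * (x * stage_lin \<theta> \<theta> t N) + x\<^sup>2 * stage_quad \<theta> \<theta> t N" for x
    using objective_perturb[OF \<theta> t, of "x \<cdot>\<^sub>m N"] N stage_smult[OF \<theta> \<theta> t N] by simp
  have "((\<lambda>x. objective L (\<theta>(t := \<theta> t + x \<cdot>\<^sub>m N))) has_real_derivative 2 * stage_lin \<theta> \<theta> t N) (at 0)"
    unfolding obj by (auto intro!: derivative_eq_intros)
  then show ?thesis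
    using ij lin by (simp add: grad_def eq DERIV_imp_deriv)
qed

lemma frob_inner_grad:
  assumes \<theta>: "params \<theta>" and t: "t < T" and N: "N \<in> carrier_mat n m"
  shows "frob_inner (grad L \<theta> t) N = 2 * stage_lin \<theta> \<theta> t N"
proof -
  have dims: "dim_row (grad L \<theta> t) = n" "dim_col (grad L \<theta> t) = m" by (auto simp: grad_def)
  show ?thesis
    unfolding stage_lin_entries[OF \<theta> \<theta> t N] frob_inner_def dims sum_distrib_left
    by (intro sum.cong refl) (simp add: grad_entry[OF \<theta> t])
qed

end

subsection \<open>Bounds on moments and costs; stationarity of the optimal policy\<close>

text \<open>The expected squared length is the trace of the second moment, and unit vectors bound
  its diagonal entries. The factor \<open>m\<close> in the final constant comes from here.\<close>

lemma L2vec_expect_norm_le: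
  assumes Y: "L2vec M d Y"
    and c: "\<And>u. u \<in> carrier_vec d \<Longrightarrow> u \<bullet> (second_moment d M Y *\<^sub>v u) \<le> c * (u \<bullet> u)"
  shows "(\<integral>\<omega>. Y \<omega> \<bullet> Y \<omega> \<partial>M) \<le> real d * c"
proof -
  have "(\<integral>\<omega>. Y \<omega> $ i * Y \<omega> $ i \<partial>M) \<le> c" if i: "i < d" for i
  proof -
    have "(\<integral>\<omega>. Y \<omega> $ i * Y \<omega> $ i \<partial>M) = (\<integral>\<omega>. (unit_vec d i \<bullet> Y \<omega>)\<^sup>2 \<partial>M)"
      using scalar_prod_left_unit[OF L2vec_carrier[OF Y] i] by (simp add: power2_eq_square)
    also have "\<dots> \<le> c * (unit_vec d i \<bullet> unit_vec d i :: real)"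
      unfolding L2vec_sprod_const(2)[OF Y unit_vec_carrier] by (rule c) simp
    finally show ?thesis using i by simp
  qed
  then have "(\<Sum>i<d. \<integral>\<omega>. Y \<omega> $ i * Y \<omega> $ i \<partial>M) \<le> (\<Sum>i<d. c)" by (intro sum_mono) auto
  then show ?thesis unfolding L2vec_sprod(2)[OF Y Y] by simp
qed

text \<open>Writes the square of a linear form as a quadratic form, so that
  \<open>expect_quad_Suc\<close> applies to it.\<close>

lemma quad_rank_one:
  assumes u: "u \<in> carrier_vec d" and v: "v \<in> carrier_vec d"
  shows "v \<bullet> (mat d d (\<lambda>(i, j). u $ i * u $ j) *\<^sub>v v) = (u \<bullet> (v :: real vec))\<^sup>2"
proof -
  let ?M = "mat d d (\<lambda>(i, j). u $ i * u $ j)"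
  have "?M *\<^sub>v v = (u \<bullet> v) \<cdot>\<^sub>v u"
    using u v by (intro eq_vecI) (auto simp: scalar_prod_def sum_distrib_left sum_distrib_right mult_ac)
  then show ?thesis using comm_scalar_prod[OF u v] u v by (simp add: scalar_prod_smult_distrib[of _ d] power2_eq_square)
qed

section \<open>Scalar inequalities behind the recursion for the gap\<close>

lemma le_sum_of_sq_le_mult:
  fixes z x y :: real
  assumes "z\<^sup>2 \<le> 4 * x * y" "x \<ge> 0" "y \<ge> 0"
  shows "z \<le> x + y"
proof (rule power2_le_imp_le)
  have "0 \<le> (x - y)\<^sup>2" by simp
  then show "z\<^sup>2 \<le> (x + y)\<^sup>2" using assms(1) by (simp add: power2_eq_square algebra_simps)
qed (use assms in simp)

text \<open>Young's inequality is applied to \<open>r * f\<close> and to \<open>- 2 * z\<close>.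
  Each use costs half of \<delta>, so of the \<open>2 * \<delta>\<close> on the left one \<delta>
  remains. In the application, \<open>r\<close> is the residual norm of the stage, \<open>f\<close>
  the parameter distance and \<open>z\<close> the cross term.\<close>

lemma stage_bound:
  fixes \<delta> r f z k y :: real
  assumes \<delta>: "\<delta> \<ge> 0" and k: "k \<ge> 0" and f: "f\<^sup>2 \<le> k * \<delta>" and z: "z\<^sup>2 \<le> k * y\<^sup>2 * \<delta>"
    and le: "2 * \<delta> + 2 * z \<le> r * f"
  shows "\<delta> \<le> k / 2 * r\<^sup>2 + 2 * k * y\<^sup>2"
proof -
  have "r * f \<le> k * r\<^sup>2 / 2 + \<delta> / 2"
  proof (rule le_sum_of_sq_le_mult)
    show "(r * f)\<^sup>2 \<le> 4 * (k * r\<^sup>2 / 2) * (\<delta> / 2)"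
      using mult_left_mono[OF f, of "r\<^sup>2"] by (simp add: power_mult_distrib mult_ac)
  qed (use \<delta> k in auto)
  moreover have "- 2 * z \<le> 2 * k * y\<^sup>2 + \<delta> / 2"
    by (rule le_sum_of_sq_le_mult) (use \<delta> k z in \<open>auto simp: power_mult_distrib mult_ac\<close>)
  ultimately show ?thesis using le by simp
qed

text \<open>The induction runs backward with the factor \<open>1 + real (T - t) / real T\<close>,
  which may grow by \<open>1 / T\<close> per stage and never exceeds 2. The smallness condition
  makes the quadratic term at most a fraction \<open>1 / (2 T)\<close> of \<open>G (Suc t)\<close>,
  which fits into this growth.\<close>

lemma quadratic_recursion_bound:
  fixes G r :: "nat \<Rightarrow> real" and a c :: real
  assumes G0: "\<And>t. t \<le> T \<Longrightarrow> G t \<ge> 0" and GT: "G T = 0"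
    and rec: "\<And>t. t < T \<Longrightarrow> G t \<le> G (Suc t) + a * r t + c * (G (Suc t))\<^sup>2"
    and r: "\<And>t. r t \<ge> 0" and a: "a \<ge> 0" and c: "c \<ge> 0" and T: "T \<ge> 1"
    and small: "4 * a * c * real T * (\<Sum>t<T. r t) \<le> 1"
  shows "G 0 \<le> 2 * a * (\<Sum>t<T. r t)"
proof -
  define S where "S t = (\<Sum>k\<in>{t..<T}. r k)" for t
  have S0: "S t \<ge> 0" for t unfolding S_def by (intro sum_nonneg r)
  have S_le: "S t \<le> S 0" for t unfolding S_def by (intro sum_mono2) (auto intro: r)
  have eq0: "S 0 = (\<Sum>t<T. r t)" by (simp add: S_def lessThan_atLeast0)
  have "G t \<le> a * (1 + real (T - t) / real T) * S t" if "t \<le> T" for t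
    using that
  proof (induction t rule: inc_induct)
    case base
    then show ?case using GT by (simp add: S_def)
  next
    case (step t)
    then have t: "t < T" by simp
    \<comment> \<open>Here \<open>1 + j\<close> is the factor reached at the later stage and
      \<open>e\<close> is the growth allowed in one stage.\<close>
    define g where "g = G (Suc t)"
    define j where "j = real (T - Suc t) / real T"
    define e where "e = 1 / real T"
    have j: "0 \<le> j" "j \<le> 1" using T by (auto simp: j_def)
    have e: "0 < e" using T by (simp add: e_def)
    have je: "real (T - t) / real T = j + e"
      using t T by (simp add: j_def e_def of_nat_diff field_simps)
    have IH: "g \<le> a * (1 + j) * S (Suc t)" using step.IH by (simp add: g_def j_def)
    have g0: "g \<ge> 0" using G0 t by (simp add: g_def)
    \<comment> \<open>This coarse form of the induction hypothesis linearizes the quadratic term: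
      with the smallness condition, \<open>c * g\<close> is at most \<open>e / 2\<close>.\<close>
    have "g \<le> a * 2 * S 0"
    proof -
      have "a * (1 + j) * S (Suc t) \<le> a * 2 * S 0"
        using a j S_le S0 by (intro mult_mono) auto
      with IH show ?thesis by simp
    qed
    then have "c * g \<le> c * (a * 2 * S 0)" using c by (rule mult_left_mono)
    also have "\<dots> \<le> e / 2"
      using small T by (simp add: e_def eq0 field_simps)
    finally have "(c * g) * g \<le> (e / 2) * g" using g0 by (rule mult_right_mono)
    then have "c * g\<^sup>2 \<le> (e / 2) * g" by (simp only: power2_eq_square mult.assoc)
    then have "G t \<le> a * r t + g * (1 + e / 2)"
      using rec[OF t] by (simp add: g_def[symmetric] algebra_simps)
    also have "g * (1 + e / 2) \<le> (a * (1 + j) * S (Suc t)) * (1 + e / 2)"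
      using IH e by (intro mult_right_mono) auto
    also have "\<dots> = a * S (Suc t) * ((1 + j) * (1 + e / 2))" by simp
    also have "\<dots> \<le> a * S (Suc t) * (1 + (j + e))"
    proof (intro mult_left_mono mult_nonneg_nonneg a S0)
      have "j * e \<le> 1 * e" using j e by (intro mult_right_mono) auto
      then show "(1 + j) * (1 + e / 2) \<le> 1 + (j + e)" by (simp add: algebra_simps)
    qed
    also have "a * r t \<le> a * r t * (1 + (j + e))"
      using mult_left_mono[of 1 "1 + (j + e)" "a * r t"] a r[of t] j e by simp
    finally have "G t \<le> a * r t * (1 + (j + e)) + a * S (Suc t) * (1 + (j + e))" by simp
    also have "\<dots> = a * (1 + (j + e)) * S t"
      using t by (simp add: S_def sum.atLeast_Suc_lessThan algebra_simps)
    finally show ?case by (simp add: je)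
  qed
  from this[of 0] show ?thesis using T by (simp add: eq0)
qed

context lqr_problem
begin

section \<open>Bounds on moments, weights, parameters and costs\<close>

lemma param_sets_carrier: "t < T \<Longrightarrow> M \<in> param_sets L t \<Longrightarrow> M \<in> carrier_mat n m"
  using lqr unfolding lqr_def by blast

lemma Theta_params: "\<theta> \<in> Theta L \<Longrightarrow> params \<theta>"
  by (auto simp: Theta_def params_def PiE_iff intro: param_sets_carrier)

lemma init_moment_pd: "pos_def m (second_moment m (init_law L) (vec m))"
  and noise_moment_pd: "pos_def m (second_moment m (noise_law L) (vec m))"
  using lqr by (auto simp: lqr_def)

text \<open>At stage 0 the second moment is that of the initial law; at later stages the last noise
  vector alone contributes its own second moment, whatever the policy. The bound is therefore
  uniform over all linear policies.\<close>

lemma state_moment_lower: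
  obtains c where "c > 0"
    "\<And>\<theta> t u. params \<theta> \<Longrightarrow> t \<le> T \<Longrightarrow> u \<in> carrier_vec m \<Longrightarrow> c * (u \<bullet> u) \<le> u \<bullet> (second_moment m \<Omega> (s \<theta> t) *\<^sub>v u)"
proof
  define c0 where "c0 = min_eigenvalue (second_moment m (init_law L) (vec m))"
  define c1 where "c1 = min_eigenvalue (second_moment m (noise_law L) (vec m))"
  define c where "c = min c0 c1"
  have "c0 > 0"
    unfolding c0_def
    by (rule pos_def_spectrum_pos[OF init_moment_pd min_eigenvalue_le_quad(1)[OF second_moment_sym dims(1)]])
  moreover have "c1 > 0"
    unfolding c1_def
    by (rule pos_def_spectrum_pos[OF noise_moment_pd min_eigenvalue_le_quad(1)[OF second_moment_sym dims(1)]])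
  ultimately show "c > 0" by (simp add: c_def)
  fix \<theta> t and u :: "real vec"
  assume \<theta>: "params \<theta>" and t: "t \<le> T" and u: "u \<in> carrier_vec m"
  have cu: "c * (u \<bullet> u) \<le> c0 * (u \<bullet> u)" "c * (u \<bullet> u) \<le> c1 * (u \<bullet> u)"
    by (auto simp: c_def intro!: mult_right_mono sprod_self_nonneg)
  show "c * (u \<bullet> u) \<le> u \<bullet> (second_moment m \<Omega> (s \<theta> t) *\<^sub>v u)"
  proof (cases t)
    case 0
    have "c0 * (u \<bullet> u) \<le> u \<bullet> (second_moment m (init_law L) (vec m) *\<^sub>v u)"
      unfolding c0_def by (rule min_eigenvalue_le_quad(2)[OF second_moment_sym dims(1) u])
    then show ?thesis using cu by (simp only: 0 second_moment_state0)
  next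
    case (Suc k)
    then have k: "k < T" using t by simp
    \<comment> \<open>The quadratic form of this rank-one matrix is the squared linear form of
      \<open>u\<close>.\<close>
    define U where "U = mat m m (\<lambda>(i, j). u $ i * u $ j)"
    have U: "U \<in> carrier_mat m m" "transpose_mat U = U" by (auto simp: U_def intro!: eq_matI)
    have FX: "F \<theta> k *\<^sub>v s \<theta> k \<omega> \<in> carrier_vec m" for \<omega>
      using F_carrier[OF \<theta> k] state_carrier[OF \<theta>, of k] k by auto
    note sc = state_carrier[OF \<theta> t] and wc = L2vec_carrier[OF noise_L2[OF k]]
    have "c1 * (u \<bullet> u) \<le> u \<bullet> (second_moment m (noise_law L) (vec m) *\<^sub>v u)"
      unfolding c1_def by (rule min_eigenvalue_le_quad(2)[OF second_moment_sym dims(1) u])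
    also have "\<dots> = (\<integral>\<omega>. (u \<bullet> w k \<omega>)\<^sup>2 \<partial>\<Omega>)"
      using L2vec_sprod_const(2)[OF noise_L2[OF k] u] second_moment_noise[OF k] by simp
    also have "\<dots> \<le> (\<integral>\<omega>. (u \<bullet> (F \<theta> k *\<^sub>v s \<theta> k \<omega>))\<^sup>2 \<partial>\<Omega>) + (\<integral>\<omega>. (u \<bullet> w k \<omega>)\<^sup>2 \<partial>\<Omega>)"
      by simp
    also have "\<dots> = (\<integral>\<omega>. (u \<bullet> s \<theta> t \<omega>)\<^sup>2 \<partial>\<Omega>)"
      using expect_quad_Suc[OF \<theta> k U] quad_rank_one[OF u FX] quad_rank_one[OF u wc] quad_rank_one[OF u sc] Suc
      by (simp add: U_def)
    also have "\<dots> = u \<bullet> (second_moment m \<Omega> (s \<theta> t) *\<^sub>v u)"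
      by (rule L2vec_sprod_const(2)[OF state_L2[OF \<theta> t] u])
    finally show ?thesis using cu by simp
  qed
qed

lemma Theta_nonempty: "Theta L \<noteq> {}"
  using lqr by (auto simp: lqr_def)

text \<open>An infimum of positive numbers could be zero. The uniform bound from
  \<open>state_moment_lower\<close> excludes this and also makes the family bounded below, so that
  the infimum is at most each member.\<close>

lemma sigmaX_min_pos: "sigmaX_min L > 0"
  and sigmaX_min_le: "\<theta> \<in> Theta L \<Longrightarrow> t \<le> T \<Longrightarrow> u \<in> carrier_vec m \<Longrightarrow>
    sigmaX_min L * (u \<bullet> u) \<le> u \<bullet> (second_moment m \<Omega> (s \<theta> t) *\<^sub>v u)"
proof -
  obtain c where c: "c > 0"
    "\<And>\<theta> t u. params \<theta> \<Longrightarrow> t \<le> T \<Longrightarrow> u \<in> carrier_vec m \<Longrightarrow> c * (u \<bullet> u) \<le> u \<bullet> (second_moment m \<Omega> (s \<theta> t) *\<^sub>v u)"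
    using state_moment_lower by metis
  have ge: "c \<le> min_eigenvalue (second_moment m \<Omega> (s \<theta> t))" if "\<theta> \<in> Theta L" "t \<le> T" for \<theta> t
  proof -
    obtain v where v: "v \<in> carrier_vec m" "v \<bullet> v > 0"
      "v \<bullet> (second_moment m \<Omega> (s \<theta> t) *\<^sub>v v) = min_eigenvalue (second_moment m \<Omega> (s \<theta> t)) * (v \<bullet> v)"
      using spectrum_Rayleigh[OF second_moment_sym(1) min_eigenvalue_le_quad(1)[OF second_moment_sym dims(1)]] by metis
    show ?thesis using c(2)[OF Theta_params[OF that(1)] that(2) v(1)] v by simp
  qed
  let ?f = "\<lambda>(\<theta>, t). min_eigenvalue (second_moment m \<Omega> (s \<theta> t))"
  have "c \<le> sigmaX_min L"
    unfolding sigmaX_min_def using Theta_nonempty ge by (intro cINF_greatest) auto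
  then show "sigmaX_min L > 0" using c by simp
  assume \<theta>: "\<theta> \<in> Theta L" and t: "t \<le> T" and u: "u \<in> carrier_vec m"
  have "bdd_below (?f ` (Theta L \<times> {..T}))" using ge by (intro bdd_belowI2[of _ c]) auto
  then have "sigmaX_min L \<le> ?f (\<theta>, t)"
    unfolding sigmaX_min_def by (rule cINF_lower) (use \<theta> t in auto)
  then have "sigmaX_min L * (u \<bullet> u) \<le> min_eigenvalue (second_moment m \<Omega> (s \<theta> t)) * (u \<bullet> u)"
    by (intro mult_right_mono sprod_self_nonneg) auto
  also have "\<dots> \<le> u \<bullet> (second_moment m \<Omega> (s \<theta> t) *\<^sub>v u)"
    by (rule min_eigenvalue_le_quad(2)[OF second_moment_sym dims(1) u])
  finally show "sigmaX_min L * (u \<bullet> u) \<le> u \<bullet> (second_moment m \<Omega> (s \<theta> t) *\<^sub>v u)" .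
qed

lemma sigmaR_min_pos: "sigmaR_min L > 0"
  and sigmaR_min_le: "t < T \<Longrightarrow> v \<in> carrier_vec n \<Longrightarrow> sigmaR_min L * (v \<bullet> v) \<le> v \<bullet> (R t *\<^sub>v v)"
proof -
  have ne: "{..<T} \<noteq> {}" using dims by (auto simp: lessThan_empty_iff)
  have "sigmaR_min L \<in> (\<lambda>t. min_singular_value (R t)) ` {..<T}"
    unfolding sigmaR_min_def using ne by (intro Min_in) auto
  then show "sigmaR_min L > 0" using pos_def_min_singular_value(1)[OF R_pd dims(2)] by auto
  assume t: "t < T" and v: "v \<in> carrier_vec n"
  have "sigmaR_min L \<le> min_singular_value (R t)" unfolding sigmaR_min_def using t by (intro Min_le) auto
  then have "sigmaR_min L * (v \<bullet> v) \<le> min_singular_value (R t) * (v \<bullet> v)"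
    by (intro mult_right_mono sprod_self_nonneg)
  also have "\<dots> \<le> v \<bullet> (R t *\<^sub>v v)" by (rule pos_def_min_singular_value(2)[OF R_pd[OF t] dims(2) v])
  finally show "sigmaR_min L * (v \<bullet> v) \<le> v \<bullet> (R t *\<^sub>v v)" .
qed

lemma Theta_update: "\<theta> \<in> Theta L \<Longrightarrow> t < T \<Longrightarrow> M \<in> param_sets L t \<Longrightarrow> \<theta>(t := M) \<in> Theta L"
  by (auto simp: Theta_def PiE_iff extensional_def)

text \<open>The supremum is a bound only once the norms are known to be bounded. Compactness bounds
  the coordinates over \<Theta>, and each member of a single stage set occurs as a stage of some
  element of \<Theta>, obtained by updating a fixed one.\<close>

lemma spectral_norm_le_sigmaTheta_max:
  assumes "t < T" "M \<in> param_sets L t"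
  shows "spectral_norm M \<le> sigmaTheta_max L"
proof -
  define I where "I = {..<T} \<times> {..<n} \<times> {..<m}"
  define C where "C = (\<lambda>\<theta>. \<lambda>(t, i, j)\<in>I. \<theta> t $$ (i, j)) ` Theta L"
  have "compact C" using lqr by (simp add: lqr_def compact_params_def C_def I_def)
  then have "compact ((\<lambda>c. \<Sum>p\<in>I. \<bar>c p\<bar>) ` C)"
    by (intro compact_continuous_image continuous_intros)
  then obtain K where K: "\<And>c. c \<in> C \<Longrightarrow> (\<Sum>p\<in>I. \<bar>c p\<bar>) \<le> K"
    by (meson bdd_above.unfold bounded_imp_bdd_above compact_imp_bounded imageI)
  obtain \<theta> where \<theta>: "\<theta> \<in> Theta L" using Theta_nonempty by blast
  have "spectral_norm N \<le> real n * (real m * K)" if k: "k < T" and N: "N \<in> param_sets L k" for k N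
  proof (rule spectral_norm_le_entries)
    show "N \<in> carrier_mat n m" using k N by (rule param_sets_carrier)
    fix i j assume ij: "i < n" "j < m"
    define c where "c = (\<lambda>(t, i, j)\<in>I. (\<theta>(k := N)) t $$ (i, j))"
    have "c \<in> C" unfolding c_def C_def using Theta_update[OF \<theta> k N] by (rule imageI)
    have p: "(k, i, j) \<in> I" using k ij by (simp add: I_def)
    have "\<bar>c (k, i, j)\<bar> \<le> (\<Sum>p\<in>I. \<bar>c p\<bar>)"
      by (rule member_le_sum[OF p]) (auto simp: I_def)
    also have "\<dots> \<le> K" by (rule K[OF \<open>c \<in> C\<close>])
    finally show "\<bar>N $$ (i, j)\<bar> \<le> K" using p by (simp add: c_def)
  qed
  then have "bdd_above (spectral_norm ` (\<Union>t<T. param_sets L t))"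
    by (intro bdd_aboveI2[of _ _ "real n * (real m * K)"]) auto
  then show ?thesis
    unfolding sigmaTheta_max_def by (rule cSUP_upper[rotated]) (use assms in auto)
qed

lemma closed_loop_nonexpansive:
  assumes \<theta>: "\<theta> \<in> Theta L" and t: "t < T" and v: "v \<in> carrier_vec m"
  shows "(F \<theta> t *\<^sub>v v) \<bullet> (F \<theta> t *\<^sub>v v) \<le> v \<bullet> v"
proof -
  have "\<theta> t \<in> param_sets L t" using \<theta> t by (auto simp: Theta_def)
  then have "spectral_norm (F \<theta> t) \<le> 1" using lqr t by (auto simp: lqr_def F_def)
  then have "(spectral_norm (F \<theta> t))\<^sup>2 \<le> 1" using spectral_norm_nonneg by (simp add: power_le_one)
  then have "(spectral_norm (F \<theta> t))\<^sup>2 * (v \<bullet> v) \<le> 1 * (v \<bullet> v)"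
    by (intro mult_right_mono sprod_self_nonneg)
  then show ?thesis
    using sprod_mult_le_spectral_norm[OF F_carrier[OF Theta_params[OF \<theta>] t] v] by simp
qed

lemma upper_bounds_pos:
  assumes "upper_bounds L sQ sR sX sW"
  shows "sQ > 0" "sR > 0" "sX > 0" "sW > 0"
proof -
  have pos: "k > 0" if "pos_def d M" "d \<ge> 1" "\<forall>l\<in>spectrum M. l \<le> k" for d M k
    using pos_def_spectrum_pos[OF that(1)] min_eigenvalue_le_quad(1)[of M d] that
    by (force simp: pos_def_def)
  \<comment> \<open>Positivity of \<open>sQ\<close> is taken from stage 0, where the weight is
    definite; the terminal weight may be zero.\<close>
  have T: "0 < T" using dims by simp
  then have Q: "pos_def m (Q 0)" using lqr by (auto simp: lqr_def)
  show "sQ > 0" by (rule pos[OF Q dims(1)]) (use assms T in \<open>auto simp: upper_bounds_def\<close>)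
  show "sR > 0" by (rule pos[OF R_pd[OF T] dims(2)]) (use assms T in \<open>auto simp: upper_bounds_def\<close>)
  show "sX > 0" by (rule pos[OF init_moment_pd dims(1)]) (use assms in \<open>auto simp: upper_bounds_def\<close>)
  show "sW > 0" by (rule pos[OF noise_moment_pd dims(1)]) (use assms in \<open>auto simp: upper_bounds_def\<close>)
qed

text \<open>The closed loop is nonexpansive on \<Theta>, so the expected squared length grows only
  through the noise: linearly in \<open>t\<close> instead of exponentially.\<close>

lemma state_norm_bound:
  assumes ub: "upper_bounds L sQ sR sX sW" and \<theta>: "\<theta> \<in> Theta L" and t: "t \<le> T"
  shows "(\<integral>\<omega>. s \<theta> t \<omega> \<bullet> s \<theta> t \<omega> \<partial>\<Omega>) \<le> real m * (sX + real t * sW)"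
  using t
proof (induction t)
  case 0
  have "u \<bullet> (second_moment m (init_law L) (vec m) *\<^sub>v u) \<le> sX * (u \<bullet> u)" if "u \<in> carrier_vec m" for u
    using ub that by (intro quad_le_spectrum_bound[OF second_moment_sym dims(1)]) (auto simp: upper_bounds_def)
  then show ?case
    using L2vec_expect_norm_le[OF state0_L2, where c = sX] second_moment_state0[of \<theta>] by simp
next
  case (Suc t)
  then have t: "t < T" "t \<le> T" by auto
  note p = Theta_params[OF \<theta>]
  have "u \<bullet> (second_moment m (noise_law L) (vec m) *\<^sub>v u) \<le> sW * (u \<bullet> u)" if "u \<in> carrier_vec m" for u
    using ub that by (intro quad_le_spectrum_bound[OF second_moment_sym dims(1)]) (auto simp: upper_bounds_def)
  then have W: "(\<integral>\<omega>. w t \<omega> \<bullet> w t \<omega> \<partial>\<Omega>) \<le> real m * sW"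
    using second_moment_noise[OF t(1)] by (intro L2vec_expect_norm_le[OF noise_L2[OF t(1)]]) simp
  note X = state_L2[OF p t(2)]
  note FX = L2vec_mult_mat[OF X F_carrier[OF p t(1)]]
  have "(\<integral>\<omega>. (F \<theta> t *\<^sub>v s \<theta> t \<omega>) \<bullet> (F \<theta> t *\<^sub>v s \<theta> t \<omega>) \<partial>\<Omega>) \<le> (\<integral>\<omega>. s \<theta> t \<omega> \<bullet> s \<theta> t \<omega> \<partial>\<Omega>)"
    by (intro integral_mono L2vec_sprod(1)[OF FX FX] L2vec_sprod(1)[OF X X]
        closed_loop_nonexpansive[OF \<theta> t(1)] state_carrier[OF p t(2)])
  moreover have "(\<integral>\<omega>. s \<theta> (Suc t) \<omega> \<bullet> s \<theta> (Suc t) \<omega> \<partial>\<Omega>) =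
      (\<integral>\<omega>. (F \<theta> t *\<^sub>v s \<theta> t \<omega>) \<bullet> (F \<theta> t *\<^sub>v s \<theta> t \<omega>) \<partial>\<Omega>) + (\<integral>\<omega>. w t \<omega> \<bullet> w t \<omega> \<partial>\<Omega>)"
    using expect_quad_Suc[OF p t(1), of "1\<^sub>m m"] one_mult_mat_vec[OF L2vec_carrier[OF FX]]
      one_mult_mat_vec[OF L2vec_carrier[OF noise_L2[OF t(1)]]] one_mult_mat_vec[OF state_carrier[OF p Suc.prems]]
    by simp
  ultimately show ?case using W Suc.IH[OF t(2)] by (simp add: algebra_simps)
qed

text \<open>There are \<open>T + 1\<close> state costs and \<open>T\<close> action costs, each
  bounded through the expected squared length of the state. The bound settles the case of a large
  residual in \<open>gap_le_residual\<close>.\<close>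

lemma objective_upper:
  assumes ub: "upper_bounds L sQ sR sX sW" and \<theta>: "\<theta> \<in> Theta L"
  shows "objective L \<theta> \<le> ((real T + 1) * sQ + real T * sR * (sigmaTheta_max L)\<^sup>2) * (real m * (sX + real T * sW))"
proof -
  note p = Theta_params[OF \<theta>] and pos = upper_bounds_pos[OF ub]
  define K where "K = real m * (sX + real T * sW)"
  have K: "(\<integral>\<omega>. s \<theta> t \<omega> \<bullet> s \<theta> t \<omega> \<partial>\<Omega>) \<le> K" if "t \<le> T" for t
  proof -
    have "real m * (sX + real t * sW) \<le> K"
      unfolding K_def using that pos by (intro mult_left_mono add_left_mono mult_right_mono) auto
    with state_norm_bound[OF ub \<theta> that] show ?thesis by simp
  qed
  have Qle: "v \<bullet> (Q t *\<^sub>v v) \<le> sQ * (v \<bullet> v)" if "t \<le> T" "v \<in> carrier_vec m" for t v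
  proof (rule quad_le_spectrum_bound[OF Q_sym(1)[OF that(1)] Q_sym(2)[OF that(1)] dims(1) _ that(2)])
    fix k assume k: "k \<in> spectrum (Q t)"
    show "k \<le> sQ"
    \<comment> \<open>The bound is assumed for eigenvalues at the stages before \<open>T\<close> and
      for the spectral radius at \<open>T\<close>.\<close>
    proof (cases "t = T")
      case True
      then have "\<bar>k\<bar> \<le> spectral_radius (map_mat complex_of_real (Q T))"
        using spectrum_le_spectral_radius[OF Q_sym(1) dims(1)] k by auto
      then show ?thesis using ub by (auto simp: upper_bounds_def)
    next
      case False
      then have "t < T" using that by simp
      then show ?thesis using ub k by (auto simp: upper_bounds_def)
    qed
  qed
  have Qcost: "(\<integral>\<omega>. s \<theta> t \<omega> \<bullet> (Q t *\<^sub>v s \<theta> t \<omega>) \<partial>\<Omega>) \<le> sQ * K" if t: "t \<le> T" for t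
  proof -
    note X = state_L2[OF p t]
    have "(\<integral>\<omega>. s \<theta> t \<omega> \<bullet> (Q t *\<^sub>v s \<theta> t \<omega>) \<partial>\<Omega>) \<le> (\<integral>\<omega>. sQ * (s \<theta> t \<omega> \<bullet> s \<theta> t \<omega>) \<partial>\<Omega>)"
      using cost_integrable(1)[OF p t] L2vec_sprod(1)[OF X X] Qle[OF t state_carrier[OF p t]]
      by (intro integral_mono) auto
    also have "\<dots> \<le> sQ * K" using K[OF t] pos by simp
    finally show ?thesis .
  qed
  have Rcost: "(\<integral>\<omega>. (\<theta> t *\<^sub>v s \<theta> t \<omega>) \<bullet> (R t *\<^sub>v (\<theta> t *\<^sub>v s \<theta> t \<omega>)) \<partial>\<Omega>) \<le> sR * (sigmaTheta_max L)\<^sup>2 * K"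
    if t: "t < T" for t
  proof -
    have t': "t \<le> T" using t by simp
    note X = state_L2[OF p t']
    note c = params_carrier[OF p t]
    have pt: "\<theta> t \<in> param_sets L t" using \<theta> t by (auto simp: Theta_def)
    have "(\<theta> t *\<^sub>v v) \<bullet> (R t *\<^sub>v (\<theta> t *\<^sub>v v)) \<le> sR * (sigmaTheta_max L)\<^sup>2 * (v \<bullet> v)" if v: "v \<in> carrier_vec m" for v
    proof -
      have "(\<theta> t *\<^sub>v v) \<bullet> (R t *\<^sub>v (\<theta> t *\<^sub>v v)) \<le> sR * ((\<theta> t *\<^sub>v v) \<bullet> (\<theta> t *\<^sub>v v))"
        using ub t c v by (intro quad_le_spectrum_bound[OF R_sym(1)[OF t] R_sym(2)[OF t] dims(2)]) (auto simp: upper_bounds_def)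
      also have "\<dots> \<le> sR * ((sigmaTheta_max L)\<^sup>2 * (v \<bullet> v))"
      proof (rule mult_left_mono)
        have "(spectral_norm (\<theta> t))\<^sup>2 \<le> (sigmaTheta_max L)\<^sup>2"
          using spectral_norm_le_sigmaTheta_max[OF t pt] spectral_norm_nonneg by (intro power_mono)
        then have "(spectral_norm (\<theta> t))\<^sup>2 * (v \<bullet> v) \<le> (sigmaTheta_max L)\<^sup>2 * (v \<bullet> v)"
          by (intro mult_right_mono sprod_self_nonneg)
        with sprod_mult_le_spectral_norm[OF c v]
        show "(\<theta> t *\<^sub>v v) \<bullet> (\<theta> t *\<^sub>v v) \<le> (sigmaTheta_max L)\<^sup>2 * (v \<bullet> v)" by simp
      qed (use pos in simp)
      finally show ?thesis by simp
    qed
    then have "(\<integral>\<omega>. (\<theta> t *\<^sub>v s \<theta> t \<omega>) \<bullet> (R t *\<^sub>v (\<theta> t *\<^sub>v s \<theta> t \<omega>)) \<partial>\<Omega>)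
        \<le> (\<integral>\<omega>. sR * (sigmaTheta_max L)\<^sup>2 * (s \<theta> t \<omega> \<bullet> s \<theta> t \<omega>) \<partial>\<Omega>)"
      using cost_integrable(2)[OF p t] L2vec_sprod(1)[OF X X] state_carrier[OF p t']
      by (intro integral_mono) auto
    also have "\<dots> = sR * (sigmaTheta_max L)\<^sup>2 * (\<integral>\<omega>. s \<theta> t \<omega> \<bullet> s \<theta> t \<omega> \<partial>\<Omega>)" by simp
    also have "\<dots> \<le> sR * (sigmaTheta_max L)\<^sup>2 * K" using K[OF t'] pos by (intro mult_left_mono) auto
    finally show ?thesis .
  qed
  have "objective L \<theta> \<le> (\<Sum>t<T. sQ * K + sR * (sigmaTheta_max L)\<^sup>2 * K) + sQ * K"
    unfolding objective_eq[OF p] by (intro add_mono sum_mono Qcost Rcost) auto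
  also have "\<dots> = ((real T + 1) * sQ + real T * sR * (sigmaTheta_max L)\<^sup>2) * K"
    by (simp add: algebra_simps)
  finally show ?thesis by (simp add: K_def)
qed

section \<open>Optimality among all policies and its first-order consequence\<close>

lemma lin_policy_admissible:
  assumes \<theta>: "params \<theta>"
  shows "admissible_policy L (lin_policy \<theta>)"
  unfolding admissible_policy_def lin_policy_def
proof (intro allI impI conjI ballI)
  fix t assume t: "t < T"
  note c = params_carrier[OF \<theta> t]
  show "\<theta> t *\<^sub>v v \<in> carrier_vec n" if "v \<in> carrier_vec m" for v using c that by auto
  fix i assume i: "i < n"
  have "(\<lambda>x. (\<theta> t *\<^sub>v vec m x) $ i) = (\<lambda>x. \<Sum>j<m. \<theta> t $$ (i, j) * x j)"
    using mult_mat_vec_index_lessThan[OF c vec_carrier i] by auto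
  moreover have "(\<lambda>x. \<Sum>j<m. \<theta> t $$ (i, j) * x j) \<in> borel_measurable (Pi\<^sub>M {..<m} (\<lambda>_. borel))"
    by (intro borel_measurable_sum borel_measurable_times measurable_component_singleton) auto
  ultimately show "(\<lambda>x. (\<theta> t *\<^sub>v vec m x) $ i) \<in> borel_measurable (Pi\<^sub>M {..<m} (\<lambda>_. borel))" by simp
qed

text \<open>Optimality is stated with nonnegative integrals. Costs of linear policies are
  nonnegative and integrable, so there these integrals agree with \<open>objective\<close>.\<close>

lemma optimal_objective_le:
  assumes opt: "optimal_policy L (lin_policy \<theta>)" and \<theta>: "params \<theta>" "params \<theta>'"
  shows "objective L \<theta> \<le> objective L \<theta>'"
proof -
  have nn: "(\<integral>\<^sup>+\<omega>. ennreal (total_cost L (lin_policy \<phi>) \<omega>) \<partial>\<Omega>) = ennreal (objective L \<phi>)" if "params \<phi>" for \<phi>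
    unfolding objective_def using total_cost_integrable[OF that] total_cost_nonneg[OF that]
    by (intro nn_integral_eq_integral) auto
  have "objective L \<theta>' \<ge> 0"
    unfolding objective_def using total_cost_nonneg[OF \<theta>(2)] by (intro Bochner_Integration.integral_nonneg) auto
  moreover have "ennreal (objective L \<theta>) \<le> ennreal (objective L \<theta>')"
    using opt lin_policy_admissible[OF \<theta>(2)] unfolding optimal_policy_def nn[OF \<theta>(1), symmetric] nn[OF \<theta>(2), symmetric]
    by blast
  ultimately show ?thesis by simp
qed

text \<open>Optimality among all linear policies, not only those in \<open>\<Theta>\<close>, makes the gradient vanish, and
  the second moment of the state can be cancelled from it.\<close>

lemma optimal_stationary:
  assumes \<theta>: "\<theta> \<in> Theta L" and opt: "\<And>\<theta>'. params \<theta>' \<Longrightarrow> objective L \<theta> \<le> objective L \<theta>'" and t: "t < T"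
  shows "E \<theta> t = 0\<^sub>m n m"
proof -
  note p = Theta_params[OF \<theta>]
  have E: "E \<theta> t \<in> carrier_mat n m" by (rule E_carrier[OF p t])
  have t': "t \<le> T" using t by simp
  \<comment> \<open>Perturbing in the direction \<open>E \<theta> t\<close> itself makes the linear
    coefficient the expected squared length of \<open>E \<theta> t\<close> applied to the
    state.\<close>
  have "(stage_lin \<theta> \<theta> t (E \<theta> t))\<^sup>2 \<le> 0 * stage_quad \<theta> \<theta> t (E \<theta> t)"
  proof (rule discriminant_le)
    fix x
    let ?N = "x \<cdot>\<^sub>m E \<theta> t"
    have N: "?N \<in> carrier_mat n m" using E by simp
    have "params (\<theta>(t := \<theta> t + ?N))" using p N by (auto simp: params_def)
    from opt[OF this] show "0 \<le> 0 + 2 * stage_lin \<theta> \<theta> t (E \<theta> t) * x + stage_quad \<theta> \<theta> t (E \<theta> t) * x\<^sup>2"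
      unfolding objective_perturb[OF p t N] stage_smult[OF p p t E] by (simp add: mult_ac)
  qed
  then have "(\<integral>\<omega>. (E \<theta> t *\<^sub>v s \<theta> t \<omega>) \<bullet> (E \<theta> t *\<^sub>v s \<theta> t \<omega>) \<partial>\<Omega>) = 0" by (simp add: stage_lin_def)
  moreover have "sigmaX_min L * (frob_norm (E \<theta> t))\<^sup>2 \<le> (\<integral>\<omega>. (E \<theta> t *\<^sub>v s \<theta> t \<omega>) \<bullet> (E \<theta> t *\<^sub>v s \<theta> t \<omega>) \<partial>\<Omega>)"
    by (rule L2vec_expect_norm_mult[OF state_L2[OF p t'] E sigmaX_min_le[OF \<theta> t']])
  ultimately have "(frob_norm (E \<theta> t))\<^sup>2 \<le> 0"
    using sigmaX_min_pos by (simp add: mult_le_0_iff)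
  then have "(\<Sum>i<n. \<Sum>j<m. (E \<theta> t $$ (i, j))\<^sup>2) = 0"
    using E unfolding frob_norm_square by (intro antisym sum_nonneg) auto
  then have "\<forall>i<n. \<forall>j<m. E \<theta> t $$ (i, j) = 0" by (simp add: sum_nonneg_eq_0_iff sum_nonneg)
  then show ?thesis using E by (intro eq_matI) auto
qed

end

subsection \<open>Comparison with the optimal policy\<close>

text \<open>The assumption \<open>opt\<close> compares \<theta>o with all linear policies, while
  \<theta>o and \<theta> lie in \<Theta>. This makes \<theta>o stationary without a normal cone
  term.\<close>

locale lqr_comparison = lqr_problem +
  fixes \<theta>o \<theta> :: "nat \<Rightarrow> real mat"
  assumes \<theta>o: "\<theta>o \<in> Theta L" and \<theta>: "\<theta> \<in> Theta L"
    and opt: "\<And>\<theta>'. params \<theta>' \<Longrightarrow> objective L \<theta>o \<le> objective L \<theta>'"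
begin

lemma po: "params \<theta>o" and p: "params \<theta>"
  using Theta_params \<theta>o \<theta> by auto

abbreviation "\<Delta> t \<equiv> \<theta> t - \<theta>o t"

lemma \<Delta>_carrier: "t < T \<Longrightarrow> \<Delta> t \<in> carrier_mat n m"
  using params_carrier[OF po, of t] params_carrier[OF p, of t] by auto

definition \<delta> :: "nat \<Rightarrow> real" where
  "\<delta> t = stage_quad \<theta>o \<theta> t (\<Delta> t)"

definition G :: "nat \<Rightarrow> real" where
  "G t = (\<Sum>k\<in>{t..<T}. \<delta> k)"

definition D :: "nat \<Rightarrow> real mat" where
  "D t = P \<theta> t - P \<theta>o t"

lemma E_sprod_zero:
  assumes t: "t < T" and v: "v \<in> carrier_vec m" and d: "d \<in> carrier_vec n"
  shows "d \<bullet> (E \<theta>o t *\<^sub>v v) = 0"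
proof -
  have "0\<^sub>m n m *\<^sub>v v = 0\<^sub>v n" using v by (intro eq_vecI) auto
  then show ?thesis using optimal_stationary[OF \<theta>o opt t] d by simp
qed

lemma stage_lin_zero:
  assumes t: "t < T" and N: "N \<in> carrier_mat n m"
  shows "stage_lin \<theta>o \<theta> t N = 0"
proof -
  have "s \<theta> t \<omega> \<in> carrier_vec m" for \<omega> using state_carrier[OF p] t by simp
  then show ?thesis using E_sprod_zero[OF t] N by (simp add: stage_lin_def)
qed

text \<open>Stationarity of \<theta>o removes all linear parts from the performance
  difference.\<close>

lemma gap_eq: "objective L \<theta> - objective L \<theta>o = G 0"
  unfolding performance_difference[OF po p] G_def
  by (simp add: stage_lin_zero \<Delta>_carrier \<delta>_def lessThan_atLeast0 cong: sum.cong_simp)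

lemma stage_forms_nonneg:
  assumes t: "t < T" and d: "d \<in> carrier_vec n"
  shows "sigmaR_min L * (d \<bullet> d) \<le> d \<bullet> (R t *\<^sub>v d)" "0 \<le> d \<bullet> (R t *\<^sub>v d)"
    "0 \<le> (B *\<^sub>v d) \<bullet> (P \<theta>o (Suc t) *\<^sub>v (B *\<^sub>v d))"
proof -
  show 1: "sigmaR_min L * (d \<bullet> d) \<le> d \<bullet> (R t *\<^sub>v d)" by (rule sigmaR_min_le[OF t d])
  have "0 \<le> sigmaR_min L * (d \<bullet> d)" using sigmaR_min_pos sprod_self_nonneg[of d] by simp
  with 1 show "0 \<le> d \<bullet> (R t *\<^sub>v d)" by simp
  have "B *\<^sub>v d \<in> carrier_vec m" using AB d by auto
  then show "0 \<le> (B *\<^sub>v d) \<bullet> (P \<theta>o (Suc t) *\<^sub>v (B *\<^sub>v d))"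
    using P_psd[OF po, of "Suc t"] t by (auto simp: pos_semidef_def)
qed

lemma D_quad:
  assumes t: "t \<le> T" and u: "u \<in> carrier_vec m" and v: "v \<in> carrier_vec m"
  shows "u \<bullet> (D t *\<^sub>v v) = u \<bullet> (P \<theta> t *\<^sub>v v) - u \<bullet> (P \<theta>o t *\<^sub>v v)"
proof -
  have P: "P \<theta> t \<in> carrier_mat m m" "P \<theta>o t \<in> carrier_mat m m" using P_sym po p t by auto
  have Pv: "P \<theta> t *\<^sub>v v \<in> carrier_vec m" "P \<theta>o t *\<^sub>v v \<in> carrier_vec m" using P v by auto
  have "D t *\<^sub>v v = P \<theta> t *\<^sub>v v - P \<theta>o t *\<^sub>v v"
    using minus_mult_distrib_mat_vec[OF P v] by (simp add: D_def)
  then show ?thesis using scalar_prod_minus_distrib[OF u Pv] by simp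
qed

text \<open>Since \<open>E \<theta>o t\<close> vanishes, the one-stage difference consists of
  nonnegative quadratic forms plus the difference at the next stage. So \<theta>o has the smallest
  value at every state, not only on average.\<close>

lemma D_nonneg:
  assumes "t \<le> T" and "v \<in> carrier_vec m"
  shows "v \<bullet> (P \<theta>o t *\<^sub>v v) \<le> v \<bullet> (P \<theta> t *\<^sub>v v)"
  using assms
proof (induction t arbitrary: v rule: inc_induct)
  case base
  then show ?case by (simp add: P_T)
next
  case (step t)
  then have t: "t < T" by simp
  define d where "d = \<Delta> t *\<^sub>v v"
  have d: "d \<in> carrier_vec n" using \<Delta>_carrier[OF t] step.prems by (auto simp: d_def)
  have "F \<theta> t *\<^sub>v v \<in> carrier_vec m" using F_carrier[OF p t] step.prems by auto
  from step.IH[OF this] show ?case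
    using P_quad_diff[OF po p t step.prems d_def] E_sprod_zero[OF t step.prems d]
      stage_forms_nonneg[OF t d] by simp
qed

lemma D_psd: "t \<le> T \<Longrightarrow> pos_semidef m (D t)"
proof -
  assume t: "t \<le> T"
  have P: "P \<theta> t \<in> carrier_mat m m" "P \<theta>o t \<in> carrier_mat m m" using P_sym po p t by auto
  have "transpose_mat (D t) = transpose_mat (P \<theta> t) - transpose_mat (P \<theta>o t)"
    unfolding D_def using P by (intro eq_matI) auto
  then have "transpose_mat (D t) = D t" using P_sym po p t by (simp add: D_def)
  moreover have "D t \<in> carrier_mat m m" using P by (auto simp: D_def)
  ultimately show "pos_semidef m (D t)"
    using D_quad[OF t] D_nonneg[OF t] by (auto simp: pos_semidef_def)
qed

lemma D_sym: "t \<le> T \<Longrightarrow> D t \<in> carrier_mat m m" "t \<le> T \<Longrightarrow> transpose_mat (D t) = D t"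
  using D_psd by (auto simp: pos_semidef_def)

lemma noise_cost_mono: "t < T \<Longrightarrow> noise_cost \<theta>o t \<le> noise_cost \<theta> t"
  unfolding noise_cost_def
  using L2vec_carrier[OF noise_L2, of t] po p
  by (intro integral_mono quad_integrable[of m] noise_L2 P_sym D_nonneg) auto

text \<open>Both sides differ by the difference of the two noise costs, which is nonnegative by
  \<open>noise_cost_mono\<close>.\<close>

lemma closed_loop_gap_le:
  assumes t: "t < T"
  shows "(\<integral>\<omega>. (F \<theta> t *\<^sub>v s \<theta> t \<omega>) \<bullet> (D (Suc t) *\<^sub>v (F \<theta> t *\<^sub>v s \<theta> t \<omega>)) \<partial>\<Omega>)
    \<le> V \<theta> \<theta> (Suc t) - V \<theta>o \<theta> (Suc t)"
proof -
  have c: "F \<theta> t *\<^sub>v s \<theta> t \<omega> \<in> carrier_vec m" for \<omega>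
    using F_carrier[OF p t] state_carrier[OF p, of t] t by auto
  have "(\<integral>\<omega>. (F \<theta> t *\<^sub>v s \<theta> t \<omega>) \<bullet> (D (Suc t) *\<^sub>v (F \<theta> t *\<^sub>v s \<theta> t \<omega>)) \<partial>\<Omega>) =
     (\<integral>\<omega>. (F \<theta> t *\<^sub>v s \<theta> t \<omega>) \<bullet> (P \<theta> (Suc t) *\<^sub>v (F \<theta> t *\<^sub>v s \<theta> t \<omega>)) \<partial>\<Omega>)
     - (\<integral>\<omega>. (F \<theta> t *\<^sub>v s \<theta> t \<omega>) \<bullet> (P \<theta>o (Suc t) *\<^sub>v (F \<theta> t *\<^sub>v s \<theta> t \<omega>)) \<partial>\<Omega>)"
    using D_quad[OF _ c c, of "Suc t"] closed_loop_integrable[OF p p t] closed_loop_integrable[OF po p t] t by simp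
  then show ?thesis
    using V_Suc[OF p p t] V_Suc[OF po p t] noise_cost_mono[OF t] by simp
qed

text \<open>Backward induction on \<open>V_diff_step\<close>: stage \<open>t\<close> contributes
  \<open>\<delta> t\<close>, and the excess noise costs of \<theta> are dropped.\<close>

lemma value_gap_le: "t \<le> T \<Longrightarrow> V \<theta> \<theta> t - V \<theta>o \<theta> t \<le> G t"
proof (induction t rule: inc_induct)
  case base
  then show ?case by (simp add: V_def P_T G_def)
next
  case (step t)
  then have t: "t < T" by simp
  have "V \<theta> \<theta> t - V \<theta>o \<theta> t \<le> \<delta> t + (V \<theta> \<theta> (Suc t) - V \<theta>o \<theta> (Suc t))"
    using V_diff_step[OF po p t] stage_lin_zero[OF t \<Delta>_carrier[OF t]] V_Suc[OF p p t] V_Suc[OF po p t]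
      noise_cost_mono[OF t] by (simp add: \<delta>_def)
  also have "\<dots> \<le> G t" using step.IH t by (simp add: G_def sum.atLeast_Suc_lessThan)
  finally show ?case .
qed

text \<open>The part of \<open>\<delta> t\<close> that involves the value matrix of \<theta>o is
  nonnegative and is discarded, which leaves the part with \<open>R t\<close>.\<close>

lemma \<delta>_lower:
  assumes t: "t < T"
  shows "sigmaR_min L * (\<integral>\<omega>. (\<Delta> t *\<^sub>v s \<theta> t \<omega>) \<bullet> (\<Delta> t *\<^sub>v s \<theta> t \<omega>) \<partial>\<Omega>) \<le> \<delta> t"
    and "sigmaX_min L * (frob_norm (\<Delta> t))\<^sup>2 \<le> (\<integral>\<omega>. (\<Delta> t *\<^sub>v s \<theta> t \<omega>) \<bullet> (\<Delta> t *\<^sub>v s \<theta> t \<omega>) \<partial>\<Omega>)"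
    and "0 \<le> \<delta> t"
proof -
  have t': "t \<le> T" using t by simp
  note X = state_L2[OF p t'] and N = \<Delta>_carrier[OF t]
  note NX = L2vec_mult_mat[OF X N]
  have c: "\<Delta> t *\<^sub>v s \<theta> t \<omega> \<in> carrier_vec n" for \<omega> by (rule L2vec_carrier[OF NX])
  have "(\<integral>\<omega>. sigmaR_min L * ((\<Delta> t *\<^sub>v s \<theta> t \<omega>) \<bullet> (\<Delta> t *\<^sub>v s \<theta> t \<omega>)) \<partial>\<Omega>) \<le> \<delta> t"
    unfolding \<delta>_def stage_quad_def
  proof (rule integral_mono)
    show "integrable \<Omega> (\<lambda>\<omega>. sigmaR_min L * ((\<Delta> t *\<^sub>v s \<theta> t \<omega>) \<bullet> (\<Delta> t *\<^sub>v s \<theta> t \<omega>)))"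
      using L2vec_sprod(1)[OF NX NX] by simp
    fix \<omega>
    show "sigmaR_min L * ((\<Delta> t *\<^sub>v s \<theta> t \<omega>) \<bullet> (\<Delta> t *\<^sub>v s \<theta> t \<omega>)) \<le>
       (\<Delta> t *\<^sub>v s \<theta> t \<omega>) \<bullet> (R t *\<^sub>v (\<Delta> t *\<^sub>v s \<theta> t \<omega>)) +
       (B *\<^sub>v (\<Delta> t *\<^sub>v s \<theta> t \<omega>)) \<bullet> (P \<theta>o (Suc t) *\<^sub>v (B *\<^sub>v (\<Delta> t *\<^sub>v s \<theta> t \<omega>)))"
      using stage_forms_nonneg[OF t c, of \<omega>] by simp
  qed (use stage_integrable(2,3)[OF po p t N] in simp)
  then show "sigmaR_min L * (\<integral>\<omega>. (\<Delta> t *\<^sub>v s \<theta> t \<omega>) \<bullet> (\<Delta> t *\<^sub>v s \<theta> t \<omega>) \<partial>\<Omega>) \<le> \<delta> t" by simp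
  show "sigmaX_min L * (frob_norm (\<Delta> t))\<^sup>2 \<le> (\<integral>\<omega>. (\<Delta> t *\<^sub>v s \<theta> t \<omega>) \<bullet> (\<Delta> t *\<^sub>v s \<theta> t \<omega>) \<partial>\<Omega>)"
    by (rule L2vec_expect_norm_mult[OF X N sigmaX_min_le[OF \<theta> t']])
  show "0 \<le> \<delta> t"
    unfolding \<delta>_def stage_quad_def
    using stage_forms_nonneg[OF t c] by (intro Bochner_Integration.integral_nonneg add_nonneg_nonneg) auto
qed

lemma G_nonneg: "G t \<ge> 0"
  unfolding G_def using \<delta>_lower(3) by (intro sum_nonneg) auto

text \<open>The form of \<open>D t\<close> is controlled by its expectation at the state: by Cauchy--Schwarz it
  dominates the square of a linear form, and the second moment of the state is bounded below.\<close>

lemma D_le_gap: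
  assumes t: "t \<le> T" and v: "v \<in> carrier_vec m"
  shows "sigmaX_min L * (v \<bullet> (D t *\<^sub>v v)) \<le> G t * (v \<bullet> v)"
proof -
  define q where "q = v \<bullet> (D t *\<^sub>v v)"
  have q0: "q \<ge> 0" using D_psd[OF t] v by (auto simp: pos_semidef_def q_def)
  note X = state_L2[OF p t] and c = state_carrier[OF p t]
  have Dv: "D t *\<^sub>v v \<in> carrier_vec m" using D_sym[OF t] v by auto
  have P: "P \<theta> t \<in> carrier_mat m m" "P \<theta>o t \<in> carrier_mat m m" using P_sym po p t by auto
  have gap: "(\<integral>\<omega>. s \<theta> t \<omega> \<bullet> (D t *\<^sub>v s \<theta> t \<omega>) \<partial>\<Omega>) \<le> G t"
    using value_gap_le[OF t] D_quad[OF t c c] quad_integrable[OF X P(1)] quad_integrable[OF X P(2)]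
    by (simp add: V_def)
  have iD: "integrable \<Omega> (\<lambda>\<omega>. s \<theta> t \<omega> \<bullet> (D t *\<^sub>v s \<theta> t \<omega>))"
    by (rule quad_integrable[OF X D_sym(1)[OF t]])
  have "sigmaX_min L * ((D t *\<^sub>v v) \<bullet> (D t *\<^sub>v v)) \<le> (\<integral>\<omega>. ((D t *\<^sub>v v) \<bullet> s \<theta> t \<omega>)\<^sup>2 \<partial>\<Omega>)"
    unfolding L2vec_sprod_const(2)[OF X Dv] by (rule sigmaX_min_le[OF \<theta> t Dv])
  also have "\<dots> \<le> (\<integral>\<omega>. (s \<theta> t \<omega> \<bullet> (D t *\<^sub>v s \<theta> t \<omega>)) * q \<partial>\<Omega>)"
  proof (rule integral_mono)
    fix \<omega>
    show "((D t *\<^sub>v v) \<bullet> s \<theta> t \<omega>)\<^sup>2 \<le> (s \<theta> t \<omega> \<bullet> (D t *\<^sub>v s \<theta> t \<omega>)) * q"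
      using Cauchy_Schwarz_psd[OF D_psd[OF t] c v, of \<omega>] comm_scalar_prod[OF Dv c, of \<omega>] by (simp add: q_def)
  qed (use L2vec_sprod_const(1)[OF X Dv] iD in auto)
  also have "\<dots> \<le> G t * q" using gap q0 by (simp add: mult_right_mono)
  finally have 1: "sigmaX_min L * ((D t *\<^sub>v v) \<bullet> (D t *\<^sub>v v)) \<le> G t * q" .
  \<comment> \<open>The bound on the length of \<open>D t *\<^sub>v v\<close> is fed back into
    Cauchy-Schwarz for \<open>q\<close>; both sides then carry a factor \<open>q\<close>, which can
    be cancelled.\<close>
  have "q * (sigmaX_min L * q) \<le> sigmaX_min L * ((v \<bullet> v) * ((D t *\<^sub>v v) \<bullet> (D t *\<^sub>v v)))"
    using Cauchy_Schwarz_vec[OF v Dv] sigmaX_min_pos by (simp add: q_def power2_eq_square mult_ac)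
  also have "\<dots> = (v \<bullet> v) * (sigmaX_min L * ((D t *\<^sub>v v) \<bullet> (D t *\<^sub>v v)))" by (simp add: mult_ac)
  also have "\<dots> \<le> (v \<bullet> v) * (G t * q)" using 1 sprod_self_nonneg by (rule mult_left_mono)
  finally have 2: "q * (sigmaX_min L * q) \<le> q * (G t * (v \<bullet> v))" by (simp add: mult_ac)
  show ?thesis
  proof (cases "q = 0")
    case True
    then show ?thesis using G_nonneg[of t] sprod_self_nonneg[of v] by (simp add: q_def)
  next
    case False
    then show ?thesis using 2 q0 by (simp add: q_def)
  qed
qed

section \<open>The cross term and the gradient in the direction of the optimal policy\<close>

text \<open>The error made because the gradient at \<theta> uses the future values of \<theta>
  instead of those of \<theta>o.\<close>

definition cross :: "nat \<Rightarrow> real" where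
  "cross t = (\<integral>\<omega>. (B *\<^sub>v (\<Delta> t *\<^sub>v s \<theta> t \<omega>)) \<bullet> (D (Suc t) *\<^sub>v (F \<theta> t *\<^sub>v s \<theta> t \<omega>)) \<partial>\<Omega>)"

text \<open>Cauchy-Schwarz for the expected form of \<open>D (Suc t)\<close> gives the factors
  \<beta> and \<alpha>. The first is at most \<open>G (Suc t)\<close>; the second is bounded by
  \<open>D_le_gap\<close> and yields another \<open>G (Suc t)\<close> together with \<eta>, which
  \<open>\<delta> t\<close> controls.\<close>

lemma cross_bound:
  assumes t: "t < T"
  shows "sigmaX_min L * sigmaR_min L * (cross t)\<^sup>2 \<le> (spectral_norm B * G (Suc t))\<^sup>2 * \<delta> t"
proof -
  have t': "t \<le> T" "Suc t \<le> T" using t by auto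
  note X = state_L2[OF p t'(1)] and N = \<Delta>_carrier[OF t]
  note NX = L2vec_mult_mat[OF X N]
  note Y = L2vec_mult_mat[OF NX AB(2)] and Z = L2vec_mult_mat[OF X F_carrier[OF p t]]
  note DY = L2vec_mult_mat[OF Y D_sym(1)[OF t'(2)]] and DZ = L2vec_mult_mat[OF Z D_sym(1)[OF t'(2)]]
  note cY = L2vec_carrier[OF Y] and cZ = L2vec_carrier[OF Z] and cNX = L2vec_carrier[OF NX]
  note D' = D_sym(1)[OF t'(2)] D_sym(2)[OF t'(2)]
  define \<alpha> where "\<alpha> = (\<integral>\<omega>. (B *\<^sub>v (\<Delta> t *\<^sub>v s \<theta> t \<omega>)) \<bullet> (D (Suc t) *\<^sub>v (B *\<^sub>v (\<Delta> t *\<^sub>v s \<theta> t \<omega>))) \<partial>\<Omega>)"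
  define \<beta> where "\<beta> = (\<integral>\<omega>. (F \<theta> t *\<^sub>v s \<theta> t \<omega>) \<bullet> (D (Suc t) *\<^sub>v (F \<theta> t *\<^sub>v s \<theta> t \<omega>)) \<partial>\<Omega>)"
  define \<eta> where "\<eta> = (\<integral>\<omega>. (\<Delta> t *\<^sub>v s \<theta> t \<omega>) \<bullet> (\<Delta> t *\<^sub>v s \<theta> t \<omega>) \<partial>\<Omega>)"
  have \<alpha>0: "\<alpha> \<ge> 0"
    unfolding \<alpha>_def using D_psd[OF t'(2)] cY by (intro Bochner_Integration.integral_nonneg) (auto simp: pos_semidef_def)
  \<comment> \<open>The expected form at \<open>z + k y\<close> is nonnegative for all
    \<open>k\<close>, where \<open>z\<close> is the noiseless successor and \<open>y\<close> the
    deviation of the action seen through \<open>B\<close>.\<close>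
  have CS: "(cross t)\<^sup>2 \<le> \<beta> * \<alpha>"
  proof (rule discriminant_le)
    fix k :: real
    have "0 \<le> (\<integral>\<omega>. (F \<theta> t *\<^sub>v s \<theta> t \<omega>) \<bullet> (D (Suc t) *\<^sub>v (F \<theta> t *\<^sub>v s \<theta> t \<omega>))
       + 2 * k * ((B *\<^sub>v (\<Delta> t *\<^sub>v s \<theta> t \<omega>)) \<bullet> (D (Suc t) *\<^sub>v (F \<theta> t *\<^sub>v s \<theta> t \<omega>)))
       + k\<^sup>2 * ((B *\<^sub>v (\<Delta> t *\<^sub>v s \<theta> t \<omega>)) \<bullet> (D (Suc t) *\<^sub>v (B *\<^sub>v (\<Delta> t *\<^sub>v s \<theta> t \<omega>)))) \<partial>\<Omega>)"
    proof (rule Bochner_Integration.integral_nonneg)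
      fix \<omega>
      let ?y = "B *\<^sub>v (\<Delta> t *\<^sub>v s \<theta> t \<omega>)" and ?z = "F \<theta> t *\<^sub>v s \<theta> t \<omega>"
      have "0 \<le> (?z + k \<cdot>\<^sub>v ?y) \<bullet> (D (Suc t) *\<^sub>v (?z + k \<cdot>\<^sub>v ?y))"
        using D_psd[OF t'(2)] cY[of \<omega>] cZ[of \<omega>] by (auto simp: pos_semidef_def)
      also have "\<dots> = ?z \<bullet> (D (Suc t) *\<^sub>v ?z) + 2 * ((k \<cdot>\<^sub>v ?y) \<bullet> (D (Suc t) *\<^sub>v ?z))
          + (k \<cdot>\<^sub>v ?y) \<bullet> (D (Suc t) *\<^sub>v (k \<cdot>\<^sub>v ?y))"
        using cY[of \<omega>] cZ[of \<omega>] by (intro quad_add[OF D']) auto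
      also have "(k \<cdot>\<^sub>v ?y) \<bullet> (D (Suc t) *\<^sub>v (k \<cdot>\<^sub>v ?y)) = k\<^sup>2 * (?y \<bullet> (D (Suc t) *\<^sub>v ?y))"
        by (rule quad_smult[OF D'(1) cY])
      also have "(k \<cdot>\<^sub>v ?y) \<bullet> (D (Suc t) *\<^sub>v ?z) = k * (?y \<bullet> (D (Suc t) *\<^sub>v ?z))"
        by (rule smult_scalar_prod_distrib[OF cY L2vec_carrier[OF DZ]])
      finally show "0 \<le> ?z \<bullet> (D (Suc t) *\<^sub>v ?z) + 2 * k * (?y \<bullet> (D (Suc t) *\<^sub>v ?z))
        + k\<^sup>2 * (?y \<bullet> (D (Suc t) *\<^sub>v ?y))" by simp
    qed
    also have "\<dots> = \<beta> + 2 * k * cross t + k\<^sup>2 * \<alpha>"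
      unfolding \<alpha>_def \<beta>_def cross_def
      using L2vec_sprod(1)[OF Z DZ] L2vec_sprod(1)[OF Y DZ] L2vec_sprod(1)[OF Y DY] by simp
    finally show "0 \<le> \<beta> + 2 * cross t * k + \<alpha> * k\<^sup>2" by (simp add: mult_ac)
  qed
  have \<beta>: "\<beta> \<le> G (Suc t)"
    using closed_loop_gap_le[OF t] value_gap_le[OF t'(2)] by (simp add: \<beta>_def)
  have "sigmaX_min L * \<alpha> \<le> G (Suc t) * ((spectral_norm B)\<^sup>2 * \<eta>)"
  proof -
    have "sigmaX_min L * \<alpha> = (\<integral>\<omega>. sigmaX_min L * ((B *\<^sub>v (\<Delta> t *\<^sub>v s \<theta> t \<omega>)) \<bullet> (D (Suc t) *\<^sub>v (B *\<^sub>v (\<Delta> t *\<^sub>v s \<theta> t \<omega>)))) \<partial>\<Omega>)"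
      by (simp add: \<alpha>_def)
    also have "\<dots> \<le> (\<integral>\<omega>. G (Suc t) * ((spectral_norm B)\<^sup>2 * ((\<Delta> t *\<^sub>v s \<theta> t \<omega>) \<bullet> (\<Delta> t *\<^sub>v s \<theta> t \<omega>))) \<partial>\<Omega>)"
    proof (rule integral_mono)
      fix \<omega>
      show "sigmaX_min L * ((B *\<^sub>v (\<Delta> t *\<^sub>v s \<theta> t \<omega>)) \<bullet> (D (Suc t) *\<^sub>v (B *\<^sub>v (\<Delta> t *\<^sub>v s \<theta> t \<omega>)))) \<le>
        G (Suc t) * ((spectral_norm B)\<^sup>2 * ((\<Delta> t *\<^sub>v s \<theta> t \<omega>) \<bullet> (\<Delta> t *\<^sub>v s \<theta> t \<omega>)))"
        using D_le_gap[OF t'(2) cY, of \<omega>]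
          mult_left_mono[OF sprod_mult_le_spectral_norm[OF AB(2) cNX, of \<omega>] G_nonneg[of "Suc t"]] by simp
    qed (use L2vec_sprod(1)[OF Y DY] L2vec_sprod(1)[OF NX NX] in auto)
    also have "\<dots> = G (Suc t) * ((spectral_norm B)\<^sup>2 * \<eta>)" by (simp add: \<eta>_def)
    finally show ?thesis .
  qed
  note \<alpha> = this
  have "sigmaX_min L * sigmaR_min L * (cross t)\<^sup>2 \<le> sigmaX_min L * sigmaR_min L * (G (Suc t) * \<alpha>)"
    using CS mult_right_mono[OF \<beta> \<alpha>0] sigmaX_min_pos sigmaR_min_pos by (intro mult_left_mono) auto
  also have "\<dots> = (G (Suc t) * sigmaR_min L) * (sigmaX_min L * \<alpha>)" by (simp add: mult_ac)
  also have "\<dots> \<le> (G (Suc t) * sigmaR_min L) * (G (Suc t) * ((spectral_norm B)\<^sup>2 * \<eta>))"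
    using \<alpha> G_nonneg[of "Suc t"] sigmaR_min_pos by (intro mult_left_mono) auto
  also have "\<dots> = (spectral_norm B * G (Suc t))\<^sup>2 * (sigmaR_min L * \<eta>)"
    by (simp add: power_mult_distrib power2_eq_square mult_ac)
  also have "\<dots> \<le> (spectral_norm B * G (Suc t))\<^sup>2 * \<delta> t"
    using \<delta>_lower(1)[OF t] by (intro mult_left_mono) (auto simp: \<eta>_def)
  finally show ?thesis .
qed

text \<open>The matrix \<open>E \<theta> t\<close> is compared with \<open>E \<theta>o t\<close>,
  which vanishes. Changing the action produces the integrand of \<open>\<delta> t\<close>, and
  changing the value matrix from \<theta>o to \<theta> produces that of
  \<open>cross t\<close>.\<close>

lemma grad_inner_eq:
  assumes t: "t < T"
  shows "frob_inner (grad L \<theta> t) (\<Delta> t) = 2 * \<delta> t + 2 * cross t"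
proof -
  have t': "t \<le> T" "Suc t \<le> T" using t by auto
  note X = state_L2[OF p t'(1)] and N = \<Delta>_carrier[OF t]
  note NX = L2vec_mult_mat[OF X N]
  note Y = L2vec_mult_mat[OF NX AB(2)] and Z = L2vec_mult_mat[OF X F_carrier[OF p t]]
  note DZ = L2vec_mult_mat[OF Z D_sym(1)[OF t'(2)]]
  have "(\<Delta> t *\<^sub>v v) \<bullet> (E \<theta> t *\<^sub>v v) = ((\<Delta> t *\<^sub>v v) \<bullet> (R t *\<^sub>v (\<Delta> t *\<^sub>v v))
      + (B *\<^sub>v (\<Delta> t *\<^sub>v v)) \<bullet> (P \<theta>o (Suc t) *\<^sub>v (B *\<^sub>v (\<Delta> t *\<^sub>v v))))
      + (B *\<^sub>v (\<Delta> t *\<^sub>v v)) \<bullet> (D (Suc t) *\<^sub>v (F \<theta> t *\<^sub>v v))" if v: "v \<in> carrier_vec m" for v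
  proof -
    define d where "d = \<Delta> t *\<^sub>v v"
    have d: "d \<in> carrier_vec n" using N v by (auto simp: d_def)
    have c: "\<theta>o t *\<^sub>v v \<in> carrier_vec n" "F \<theta>o t *\<^sub>v v \<in> carrier_vec m" "F \<theta> t *\<^sub>v v \<in> carrier_vec m" "B *\<^sub>v d \<in> carrier_vec m"
      using params_carrier[OF po t] F_carrier[OF po t] F_carrier[OF p t] AB v d by auto
    note ch = closed_loop_change[OF po p t v, folded d_def]
    have P: "P \<theta>o (Suc t) \<in> carrier_mat m m" using P_sym[OF po t'(2)] by simp
    have "d \<bullet> (R t *\<^sub>v (\<theta> t *\<^sub>v v)) = d \<bullet> (R t *\<^sub>v (\<theta>o t *\<^sub>v v)) + d \<bullet> (R t *\<^sub>v d)"
      unfolding ch(1) mult_add_distrib_mat_vec[OF R_sym(1)[OF t] c(1) d]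
      using R_sym(1)[OF t] c d by (intro scalar_prod_add_distrib[of _ n]) auto
    moreover have "(B *\<^sub>v d) \<bullet> (P \<theta>o (Suc t) *\<^sub>v (F \<theta> t *\<^sub>v v)) =
        (B *\<^sub>v d) \<bullet> (P \<theta>o (Suc t) *\<^sub>v (F \<theta>o t *\<^sub>v v)) + (B *\<^sub>v d) \<bullet> (P \<theta>o (Suc t) *\<^sub>v (B *\<^sub>v d))"
      unfolding ch(2) mult_add_distrib_mat_vec[OF P c(2) c(4)]
      using P c by (intro scalar_prod_add_distrib[of _ m]) auto
    ultimately show ?thesis
      using E_sprod[OF p t v d] E_sprod[OF po t v d] E_sprod_zero[OF t v d] D_quad[OF t'(2) c(4) c(3)]
      by (simp add: d_def)
  qed
  then have "stage_lin \<theta> \<theta> t (\<Delta> t) = \<delta> t + cross t"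
    unfolding stage_lin_def \<delta>_def stage_quad_def cross_def
    using state_carrier[OF p t'(1)] stage_integrable(2,3)[OF po p t N] L2vec_sprod(1)[OF Y DZ] by simp
  then show ?thesis using frob_inner_grad[OF p t N] by simp
qed

section \<open>From the residual to the gap\<close>

text \<open>As \<Theta> is a product, a single stage of \<theta> may be replaced by that of
  \<theta>o, which isolates one summand of the normal cone inequality. The sign flips because
  \<open>\<Delta> t\<close> points from \<theta>o to \<theta>.\<close>

lemma normal_cone_stage:
  assumes g: "g \<in> normal_cone L \<theta>" and t: "t < T"
  shows "g t \<in> carrier_mat n m" "frob_inner (g t) (\<Delta> t) \<ge> 0"
proof -
  have gc: "\<And>k. k < T \<Longrightarrow> g k \<in> carrier_mat n m" using g by (auto simp: normal_cone_def PiE_iff)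
  show "g t \<in> carrier_mat n m" by (rule gc[OF t])
  define \<theta>' where "\<theta>' = \<theta>(t := \<theta>o t)"
  have "\<theta>o t \<in> param_sets L t" using \<theta>o t by (auto simp: Theta_def)
  then have "\<theta>' \<in> Theta L" unfolding \<theta>'_def using \<theta> t by (intro Theta_update)
  then have "(\<Sum>k<T. frob_inner (g k) (\<theta>' k - \<theta> k)) \<le> 0" using g by (auto simp: normal_cone_def)
  also have "(\<Sum>k<T. frob_inner (g k) (\<theta>' k - \<theta> k)) = (\<Sum>k<T. if k = t then - frob_inner (g t) (\<Delta> t) else 0)"
  proof (rule sum.cong[OF refl])
    fix k assume "k \<in> {..<T}"
    then have k: "k < T" by simp
    note c = gc[OF k] params_carrier[OF p k] params_carrier[OF po k]
    show "frob_inner (g k) (\<theta>' k - \<theta> k) = (if k = t then - frob_inner (g t) (\<Delta> t) else 0)"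
      using c by (auto simp: frob_inner_def \<theta>'_def sum_negf[symmetric] algebra_simps intro!: sum.cong sum.neutral)
  qed
  finally show "frob_inner (g t) (\<Delta> t) \<ge> 0" using t by simp
qed

text \<open>Adding \<open>g t\<close> to the gradient can only increase the inner product with
  \<open>\<Delta> t\<close>, so Cauchy-Schwarz bounds \<open>2 * \<delta> t + 2 * cross t\<close> by
  the residual norm times the parameter distance, and \<open>stage_bound\<close> applies.\<close>

lemma \<delta>_le_residual:
  assumes g: "g \<in> normal_cone L \<theta>" and t: "t < T"
  defines "\<kappa> \<equiv> 1 / sigmaR_min L * (1 / sigmaX_min L)"
  shows "\<delta> t \<le> \<kappa> / 2 * (frob_norm (grad L \<theta> t + g t))\<^sup>2 + 2 * \<kappa> * (spectral_norm B * G (Suc t))\<^sup>2"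
proof (rule stage_bound)
  note pos = sigmaR_min_pos sigmaX_min_pos
  show "0 \<le> \<delta> t" by (rule \<delta>_lower(3)[OF t])
  show "0 \<le> \<kappa>" using pos by (simp add: \<kappa>_def)
  have "sigmaR_min L * (sigmaX_min L * (frob_norm (\<Delta> t))\<^sup>2) \<le> \<delta> t"
    by (rule order_trans[OF mult_left_mono[OF \<delta>_lower(2)[OF t] less_imp_le[OF pos(1)]] \<delta>_lower(1)[OF t]])
  then show "(frob_norm (\<Delta> t))\<^sup>2 \<le> \<kappa> * \<delta> t" using pos by (simp add: \<kappa>_def field_simps)
  show "(cross t)\<^sup>2 \<le> \<kappa> * (spectral_norm B * G (Suc t))\<^sup>2 * \<delta> t"
    using cross_bound[OF t] pos by (simp add: \<kappa>_def field_simps)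
  have gr: "grad L \<theta> t \<in> carrier_mat n m" by (simp add: grad_def)
  note gc = normal_cone_stage[OF g t]
  have "frob_inner (grad L \<theta> t + g t) (\<Delta> t) = frob_inner (grad L \<theta> t) (\<Delta> t) + frob_inner (g t) (\<Delta> t)"
    using gr gc(1) by (simp add: frob_inner_def distrib_right sum.distrib)
  then have "2 * \<delta> t + 2 * cross t \<le> frob_inner (grad L \<theta> t + g t) (\<Delta> t)"
    using grad_inner_eq[OF t] gc(2) by simp
  also have "\<dots> \<le> frob_norm (grad L \<theta> t + g t) * frob_norm (\<Delta> t)"
    using gr gc(1) \<Delta>_carrier[OF t] by (intro frob_inner_le[of _ n m]) auto
  finally show "2 * \<delta> t + 2 * cross t \<le> frob_norm (grad L \<theta> t + g t) * frob_norm (\<Delta> t)" .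
qed

text \<open>For a small residual the recursion gives the term with \<kappa>. For a large one the a
  priori bound \<open>K\<close> is itself at most a multiple of the residual. The sum of the two
  constants covers both cases.\<close>

lemma gap_le_residual:
  assumes g: "g \<in> normal_cone L \<theta>" and K: "objective L \<theta> - objective L \<theta>o \<le> K"
  defines "\<kappa> \<equiv> 1 / sigmaR_min L * (1 / sigmaX_min L)"
  shows "objective L \<theta> - objective L \<theta>o \<le> (\<kappa> + 4 * \<kappa>\<^sup>2 * (spectral_norm B)\<^sup>2 * real T * K) * residual L \<theta> g"
proof -
  define r where "r t = (frob_norm (grad L \<theta> t + g t))\<^sup>2" for t
  have S: "residual L \<theta> g = (\<Sum>t<T. r t)" by (simp add: residual_def r_def)
  have S0: "residual L \<theta> g \<ge> 0" unfolding S r_def by (intro sum_nonneg) auto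
  have \<kappa>: "\<kappa> \<ge> 0" using sigmaR_min_pos sigmaX_min_pos by (simp add: \<kappa>_def)
  \<comment> \<open>Chosen so that \<open>c * residual L \<theta> g \<le> 1\<close> is exactly the
    smallness condition of \<open>quadratic_recursion_bound\<close> with the coefficients
    \<open>\<kappa> / 2\<close> and \<open>2 * \<kappa> * (spectral_norm B)\<^sup>2\<close>.\<close>
  define c where "c = 4 * \<kappa>\<^sup>2 * (spectral_norm B)\<^sup>2 * real T"
  have c0: "c \<ge> 0" by (simp add: c_def)
  have K0: "0 \<le> K" using K G_nonneg[of 0] gap_eq by simp
  have "G 0 \<le> (\<kappa> + c * K) * residual L \<theta> g"
  proof (cases "c * residual L \<theta> g \<le> 1")
    case True
    have "G 0 \<le> 2 * (\<kappa> / 2) * (\<Sum>t<T. r t)"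
    proof (rule quadratic_recursion_bound[where c = "2 * \<kappa> * (spectral_norm B)\<^sup>2"])
      show "4 * (\<kappa> / 2) * (2 * \<kappa> * (spectral_norm B)\<^sup>2) * real T * (\<Sum>t<T. r t) \<le> 1"
        using True by (simp add: c_def S power2_eq_square mult_ac)
      fix t assume t: "t < T"
      then show "G t \<le> G (Suc t) + \<kappa> / 2 * r t + 2 * \<kappa> * (spectral_norm B)\<^sup>2 * (G (Suc t))\<^sup>2"
        using \<delta>_le_residual[OF g t]
        by (simp add: G_def[of t] sum.atLeast_Suc_lessThan G_def[of "Suc t", symmetric] r_def \<kappa>_def power_mult_distrib mult_ac)
    qed (use \<kappa> dims in \<open>auto simp: G_nonneg r_def G_def[of T]\<close>)
    also have "\<dots> \<le> (\<kappa> + c * K) * residual L \<theta> g"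
      unfolding S[symmetric] using c0 K0 S0 by (intro mult_right_mono) auto
    finally show ?thesis .
  next
    case False
    have "G 0 \<le> K * 1" using K gap_eq by simp
    also have "\<dots> \<le> K * (c * residual L \<theta> g)" using False K0 by (intro mult_left_mono) auto
    also have "\<dots> \<le> (\<kappa> + c * K) * residual L \<theta> g" using \<kappa> S0 by (simp add: algebra_simps)
    finally show ?thesis .
  qed
  then show ?thesis by (simp add: gap_eq c_def)
qed

end

section \<open>The polynomial constant and the comparison with minimizers over \<Theta>\<close>

theorem theorem3:
  shows "\<exists>P :: real \<times> real \<times> real \<times> real \<times> real \<times> real \<times> real \<times> real \<times> real \<times> real \<times> real \<Rightarrow> real.
    real_polynomial_function P \<and>
    (\<forall>L sQ sR sX sW. lqr L \<and> upper_bounds L sQ sR sX sW \<longrightarrow>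
      (\<exists>\<mu>>0. PLK_condition L \<mu> \<and>
        1 / \<mu> = P (real (dimS L), real (dimA L), real (horizon L), sQ, sR, 1 / sigmaR_min L,
                    sigmaTheta_max L, sX, 1 / sigmaX_min L, sW, spectral_norm (matB L))))"
proof -
  \<comment> \<open>The arguments r' and x' stand for the reciprocals of \<open>sigmaR_min\<close>
    and \<open>sigmaX_min\<close>. The last product is the bound of \<open>objective_upper\<close>,
    and the factor 2 comes from taking the reciprocal of \<open>1 / (2 * C)\<close>.\<close>
  define rate :: "real \<times> real \<times> real \<times> real \<times> real \<times> real \<times> real \<times> real \<times> real \<times> real \<times> real \<Rightarrow> real"
    where "rate = (\<lambda>(m, n, T, q, r, r', th, x, x', w, b). 2 * (r' * x' + 4 * (r' * x')\<^sup>2 * b\<^sup>2 * T *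
      (((T + 1) * q + T * r * th\<^sup>2) * (m * (x + T * w)))))"
  have "real_polynomial_function rate"
    unfolding rate_def split_def power2_eq_square
    by (intro real_polynomial_function.intros(2-) real_polynomial_function.intros(1)
        bounded_linear_fst_comp bounded_linear_snd_comp bounded_linear_ident bounded_linear_fst bounded_linear_snd)
  moreover have "\<exists>\<mu>>0. PLK_condition L \<mu> \<and>
        1 / \<mu> = rate (real (dimS L), real (dimA L), real (horizon L), sQ, sR, 1 / sigmaR_min L,
                    sigmaTheta_max L, sX, 1 / sigmaX_min L, sW, spectral_norm (matB L))"
    if lqr: "lqr L" and ub: "upper_bounds L sQ sR sX sW" for L sQ sR sX sW
  proof -
    interpret lqr_problem L by standard (rule lqr)
    define \<kappa> where "\<kappa> = 1 / sigmaR_min L * (1 / sigmaX_min L)"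
    define K where "K = ((real T + 1) * sQ + real T * sR * (sigmaTheta_max L)\<^sup>2) * (real m * (sX + real T * sW))"
    define C where "C = \<kappa> + 4 * \<kappa>\<^sup>2 * (spectral_norm B)\<^sup>2 * real T * K"
    have \<kappa>: "\<kappa> > 0" using sigmaR_min_pos sigmaX_min_pos by (simp add: \<kappa>_def)
    have "K \<ge> 0"
      unfolding K_def using upper_bounds_pos[OF ub] by (intro mult_nonneg_nonneg add_nonneg_nonneg) auto
    then have C: "C > 0" unfolding C_def using \<kappa> by (intro add_pos_nonneg) auto
    obtain \<theta>o where \<theta>o: "\<theta>o \<in> Theta L" "optimal_policy L (lin_policy \<theta>o)"
      using lqr by (auto simp: lqr_def)
    have opt: "objective L \<theta>o \<le> objective L \<theta>'" if "params \<theta>'" for \<theta>'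
      by (rule optimal_objective_le[OF \<theta>o(2) Theta_params[OF \<theta>o(1)] that])
    have "objective L \<theta>o \<ge> 0"
      unfolding objective_def using total_cost_nonneg[OF Theta_params[OF \<theta>o(1)]]
      by (intro Bochner_Integration.integral_nonneg) auto
    have gap: "objective L \<theta> - objective L \<theta>s \<le> C * residual L \<theta> g"
      if "\<theta>s \<in> Theta L" "\<theta> \<in> Theta L" "g \<in> normal_cone L \<theta>" for \<theta> \<theta>s g
    proof -
      \<comment> \<open>The gap is estimated against \<theta>o. Its objective is at most that of any
        other member of \<Theta>, so the estimate passes to the minimizer \<theta>s.\<close>
      interpret lqr_comparison L \<theta>o \<theta> by standard (use \<theta>o that opt in auto)
      have "objective L \<theta> - objective L \<theta>o \<le> K"
        using objective_upper[OF ub that(2)] \<open>objective L \<theta>o \<ge> 0\<close> by (simp add: K_def)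
      from gap_le_residual[OF that(3) this] opt[OF Theta_params[OF that(1)]] show ?thesis
        by (simp add: C_def \<kappa>_def)
    qed
    \<comment> \<open>The estimate \<open>gap\<close> holds for every element of the normal cone, in
      particular for one that attains the minimum; with this constant the prefactor in the condition
      is \<open>C\<close>.\<close>
    have "PLK_condition L (1 / (2 * C))"
      unfolding PLK_condition_def
    proof (intro allI impI ballI)
      fix \<theta>s \<theta> assume "is_arg_min (objective L) (\<lambda>\<theta>. \<theta> \<in> Theta L) \<theta>s" and \<theta>: "\<theta> \<in> Theta L"
      then have \<theta>s: "\<theta>s \<in> Theta L" by (simp add: is_arg_min_def)
      obtain g where g: "is_arg_min (residual L \<theta>) (\<lambda>g. g \<in> normal_cone L \<theta>) g"
        using normal_cone_attains_min by blast
      then have "g \<in> normal_cone L \<theta>" by (simp add: is_arg_min_def)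
      from gap[OF \<theta>s \<theta> this] g show "\<exists>g. is_arg_min (residual L \<theta>) (\<lambda>g. g \<in> normal_cone L \<theta>) g \<and>
          objective L \<theta> - objective L \<theta>s \<le> 1 / (2 * (1 / (2 * C))) * residual L \<theta> g"
        using C by auto
    qed
    moreover have "1 / (1 / (2 * C)) = rate (real (dimS L), real (dimA L), real (horizon L), sQ, sR, 1 / sigmaR_min L,
                    sigmaTheta_max L, sX, 1 / sigmaX_min L, sW, spectral_norm (matB L))"
      by (simp add: rate_def C_def K_def \<kappa>_def mult.commute)
    ultimately show ?thesis using C by (intro exI[of _ "1 / (2 * C)"]) auto
  qed
  ultimately show ?thesis by blast
qed

end
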